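(* There exists a constant $c_5>0$ depending only on $n$ such that the following holds. Let $\epsilon\in(0,1)$, $M\ge1$, and let $V_0,W_0\in V_d(\mathbb{R}^n)$ be compactly supported $d$-varifolds with $\|V_0\|(\mathbb{R}^n)\le M$ and $\|W_0\|(\mathbb{R}^n)\le M$. Let $(V_\epsilon(t))_{t\in[0,1]}$ (resp. $(W_\epsilon(t))_{t\in[0,1]}$) be the approximate mean curvature flow starting from $V_0$ (resp. $W_0$). Then, for all $t\in[0,1]$, $$\Delta(V_\epsilon(t),W_\epsilon(t))\le\Delta(V_0,W_0)\,\exp\big(c_{5,M}\,t\,\epsilon^{-n-7}\big),\qquad c_{5,M}=c_5(M+1)^2.$$
   Context: Let $n\ge 2$, $1\le d\le n$. $G_{d,n}$ is the Grassmannian of $d$-dimensional linear subspaces of $\mathbb{R}^n$; $S\in G_{d,n}$ is identified with the orthogonal projection matrix onto $S$, the distance on $G_{d,n}$ is $\|S-T\|$ (operator norm), and $\mathbb{R}^n\times G_{d,n}$ carries the metric $|x-y|+\|S-T\|$. A $d$-varifold is a nonnegative Radon measure on $\mathbb{R}^n\times G_{d,n}$; $V_d(\mathbb{R}^n)$ is the set of $d$-varifolds; $\|V\|(A)=V(A\times G_{d,n})$. The bounded Lipschitz distance of finite Radon measures on a metric space $X$ is $\Delta(\mu,\nu)=\sup\{|\int\varphi\,d\mu-\int\varphi\,d\nu|:\varphi\in C^0(X,\mathbb{R}_+),\ \max(\|\varphi\|_\infty,\mathrm{Lip}(\varphi))\le 1\}$. Push-forward: for a $C^1$ diffeomorphism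 $f$ of $\mathbb{R}^n$, $f_\#V(\varphi)=\int\varphi(f(x),Df(x)(S))\,J_Sf(x)\,dV(x,S)$, where $J_Sf(x)=\det(Y^tY)^{1/2}$, $Y=Df(x)(s_1|\dots|s_d)$ with $(s_i)$ an orthonormal basis of $S$. Kernel: $\psi\in C^\infty(\mathbb{R}^n)$ is a fixed radially symmetric function (depending only on $n$) with $0\le\psi\le1$, $\psi=1$ on $\{|x|\le 1/2\}$, $\psi=0$ on $\{|x|\ge1\}$, $|\nabla\psi|\le3$; $\Phi_\epsilon(x)=c(\epsilon)\psi(x)(2\pi\epsilon^2)^{-n/2}\exp(-|x|^2/(2\epsilon^2))$ with $c(\epsilon)$ such that $\int\Phi_\epsilon=1$. Approximate mean curvature: $h_\epsilon(\cdot,V)=\Phi_\epsilon*\tilde h_\epsilon(\cdot,V)$, $\tilde h_\epsilon(y,V)=-\dfrac{(\delta V*\Phi_\epsilon)(y)}{(\|V\|*\Phi_\epsilon)(y)+\epsilon}$, where $(\|V\|*\Phi_\epsilon)(y)=\int\Phi_\epsilon(x-y)\,d\|V\|(x)$, $(\delta V*\Phi_\epsilon)(y)=\int S(\nabla\Phi_\epsilon(x-y))\,dV(x,S)$. Approximate mean curvature flow: for a subdivision $\mathcal{T}=\{0=t_0<\dots<t_m=1\}$ of $[0,1]$ with size $\delta(\mathcal{T})=\max_i(t_i-t_{i-1})$ satisfying $c_3\delta(\mathcal{T})\le(M+1)^{-3}\epsilon^8$ ($c_3$ a constant depending only on $n$ ensuring that all maps below are $C^1$ diffeomorphisms and masses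 stay $\le M+1$), set $V_{\epsilon,\mathcal{T}}(0)=V_0$ and $V_{\epsilon,\mathcal{T}}(t)=[\mathrm{id}+(t-t_i)h_\epsilon(\cdot,V_{\epsilon,\mathcal{T}}(t_i))]_\#V_{\epsilon,\mathcal{T}}(t_i)$ for $t\in[t_i,t_{i+1}]$. For $V_0$ compactly supported, $V_\epsilon(t)$ is the weak-$*$ limit of $V_{\epsilon,\mathcal{T}_j}(t)$ for any sequence of subdivisions with $\delta(\mathcal{T}_j)\to0$; the limit exists for every $t\in[0,1]$ and does not depend on the sequence. *)

theory Defs
  imports "HOL-Analysis.Analysis"
begin

section \<open>Grassmannian and varifolds\<close>

definition is_orth_proj :: "(real^'n) set \<Rightarrow> real^'n^'n \<Rightarrow> bool" where
  "is_orth_proj T P \<longleftrightarrow> (\<forall>x. P *v x \<in> T \<and> (\<forall>y\<in>T. orthogonal (x - P *v x) y))"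

definition orth_proj :: "(real^'n) set \<Rightarrow> real^'n^'n" where
  "orth_proj T = (THE P. is_orth_proj T P)"

text \<open>A \<open>d\<close>-dimensional subspace is represented by the matrix of the orthogonal projection onto
  it; the subspace is recovered from the matrix as its range.\<close>

definition grassmannian :: "nat \<Rightarrow> (real^'n^'n) set" where
  "grassmannian d = orth_proj ` {T. subspace T \<and> dim T = d}"

definition plane :: "real^'n^'n \<Rightarrow> (real^'n) set" where
  "plane S = range (\<lambda>x. S *v x)"

text \<open>The library metric on the product type is not the one wanted here, although it induces the
  same topology (and hence the same Borel sets).\<close>

definition vdist :: "(real^'n) \<times> (real^'n^'n) \<Rightarrow> (real^'n) \<times> (real^'n^'n) \<Rightarrow> real" where
  "vdist z w = norm (fst z - fst w) + onorm (\<lambda>v. (snd z - snd w) *v v)"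

definition varifold_space :: "nat \<Rightarrow> ((real^'n) \<times> (real^'n^'n)) measure" where
  "varifold_space d = restrict_space borel (UNIV \<times> grassmannian d)"

text \<open>On the locally compact separable metric space \<open>UNIV \<times> grassmannian d\<close> a Radon measure is the
  same thing as a Borel measure that is finite on compact sets.\<close>

definition varifold :: "nat \<Rightarrow> ((real^'n) \<times> (real^'n^'n)) measure \<Rightarrow> bool" where
  "varifold d V \<longleftrightarrow> sets V = sets (varifold_space d) \<and>
     (\<forall>K. compact K \<and> K \<subseteq> UNIV \<times> grassmannian d \<longrightarrow> emeasure V K < \<infinity>)"

definition weight :: "((real^'n) \<times> (real^'n^'n)) measure \<Rightarrow> (real^'n) measure" where
  "weight V = distr V borel fst"

definition compactly_supported :: "((real^'n) \<times> (real^'n^'n)) measure \<Rightarrow> bool" where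
  "compactly_supported V \<longleftrightarrow> (\<exists>K. compact K \<and> K \<subseteq> space V \<and> emeasure V (space V - K) = 0)"

definition bl_dist ::
    "'a::topological_space set \<Rightarrow> ('a \<Rightarrow> 'a \<Rightarrow> real) \<Rightarrow> 'a measure \<Rightarrow> 'a measure \<Rightarrow> real" where
  "bl_dist X \<rho> \<mu> \<nu> =
     (SUP \<phi> \<in> {\<phi>::'a \<Rightarrow> real. continuous_on X \<phi> \<and> (\<forall>z\<in>X. 0 \<le> \<phi> z \<and> \<phi> z \<le> 1) \<and>
                  (\<forall>z\<in>X. \<forall>w\<in>X. \<bar>\<phi> z - \<phi> w\<bar> \<le> \<rho> z w)}.
        \<bar>(LINT z|\<mu>. \<phi> z) - (LINT z|\<nu>. \<phi> z)\<bar>)"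

definition varifold_bl_dist ::
    "nat \<Rightarrow> ((real^'n) \<times> (real^'n^'n)) measure \<Rightarrow> ((real^'n) \<times> (real^'n^'n)) measure \<Rightarrow> real" where
  "varifold_bl_dist d = bl_dist (UNIV \<times> grassmannian d) vdist"

definition weak_star_limit ::
    "nat \<Rightarrow> (nat \<Rightarrow> ((real^'n) \<times> (real^'n^'n)) measure) \<Rightarrow> ((real^'n) \<times> (real^'n^'n)) measure \<Rightarrow> bool"
  where
  "weak_star_limit d Vs V \<longleftrightarrow>
     (\<forall>\<phi>::(real^'n) \<times> (real^'n^'n) \<Rightarrow> real. continuous_on (UNIV \<times> grassmannian d) \<phi> \<and>
        (\<exists>K. compact K \<and> (\<forall>z \<in> UNIV \<times> grassmannian d - K. \<phi> z = 0)) \<longrightarrow>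
        (\<lambda>j. LINT z|Vs j. \<phi> z) \<longlonglongrightarrow> (LINT z|V. \<phi> z))"


section \<open>Push-forward\<close>

text \<open>\<open>gram_det d y\<close> is the determinant of the \<open>d \<times> d\<close> matrix \<open>Y\<^sup>t Y\<close>, where \<open>Y\<close> has the columns
  \<open>y 0, \<dots>, y (d - 1)\<close>. The Leibniz formula is spelled out because the size \<open>d\<close> is a number,
  whereas the size in \<^const>\<open>Determinants.det\<close> is a type.\<close>

definition gram_det :: "nat \<Rightarrow> (nat \<Rightarrow> real^'n) \<Rightarrow> real" where
  "gram_det d y = (\<Sum>p | p permutes {..<d}. of_int (sign p) * (\<Prod>i<d. y i \<bullet> y (p i)))"

definition orthonormal_basis :: "nat \<Rightarrow> (real^'n) set \<Rightarrow> (nat \<Rightarrow> real^'n) \<Rightarrow> bool" where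
  "orthonormal_basis d T s \<longleftrightarrow>
     (\<forall>i<d. \<forall>j<d. s i \<bullet> s j = (if i = j then 1 else 0)) \<and> span (s ` {..<d}) = T"

text \<open>The tangential Jacobian does not depend on the orthonormal basis that is chosen.\<close>

definition tangential_jacobian ::
    "nat \<Rightarrow> (real^'n \<Rightarrow> real^'n) \<Rightarrow> real^'n \<Rightarrow> real^'n^'n \<Rightarrow> real" where
  "tangential_jacobian d f x S =
     (let s = (SOME s. orthonormal_basis d (plane S) s)
      in sqrt (gram_det d (\<lambda>i. frechet_derivative f (at x) (s i))))"

definition pushforward ::
    "nat \<Rightarrow> (real^'n \<Rightarrow> real^'n) \<Rightarrow> ((real^'n) \<times> (real^'n^'n)) measure
      \<Rightarrow> ((real^'n) \<times> (real^'n^'n)) measure" where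
  "pushforward d f V =
     distr (density V (\<lambda>(x, S). ennreal (tangential_jacobian d f x S))) (varifold_space d)
       (\<lambda>(x, S). (f x, orth_proj (frechet_derivative f (at x) ` plane S)))"


section \<open>Kernel\<close>

fun Ck :: "nat \<Rightarrow> (real^'n \<Rightarrow> real) \<Rightarrow> bool" where
  "Ck 0 f \<longleftrightarrow> continuous_on UNIV f"
| "Ck (Suc k) f \<longleftrightarrow> (\<forall>x. f differentiable (at x)) \<and>
     (\<forall>i. Ck k (\<lambda>x. frechet_derivative f (at x) (axis i 1)))"

definition gradient :: "(real^'n \<Rightarrow> real) \<Rightarrow> real^'n \<Rightarrow> real^'n" where
  "gradient f x = (\<chi> i. frechet_derivative f (at x) (axis i 1))"

definition cutoff :: "(real^'n \<Rightarrow> real) \<Rightarrow> bool" where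
  "cutoff \<psi> \<longleftrightarrow>
     (\<forall>k. Ck k \<psi>) \<and>
     (\<forall>x y. norm x = norm y \<longrightarrow> \<psi> x = \<psi> y) \<and>
     (\<forall>x. 0 \<le> \<psi> x \<and> \<psi> x \<le> 1) \<and>
     (\<forall>x. norm x \<le> 1/2 \<longrightarrow> \<psi> x = 1) \<and>
     (\<forall>x. norm x \<ge> 1 \<longrightarrow> \<psi> x = 0) \<and>
     (\<forall>x. norm (gradient \<psi> x) \<le> 3)"

definition truncated_gauss :: "(real^'n \<Rightarrow> real) \<Rightarrow> real \<Rightarrow> real^'n \<Rightarrow> real" where
  "truncated_gauss \<psi> \<epsilon> x =
     \<psi> x * (2 * pi * \<epsilon>\<^sup>2) powr (- (real CARD('n) / 2)) * exp (- (norm x)\<^sup>2 / (2 * \<epsilon>\<^sup>2))"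

definition kernel :: "(real^'n \<Rightarrow> real) \<Rightarrow> real \<Rightarrow> real^'n \<Rightarrow> real" where
  "kernel \<psi> \<epsilon> x = inverse (LINT y|lborel. truncated_gauss \<psi> \<epsilon> y) * truncated_gauss \<psi> \<epsilon> x"


section \<open>Approximate mean curvature\<close>

definition mollified_mass ::
    "(real^'n \<Rightarrow> real) \<Rightarrow> real \<Rightarrow> ((real^'n) \<times> (real^'n^'n)) measure \<Rightarrow> real^'n \<Rightarrow> real" where
  "mollified_mass \<psi> \<epsilon> V y = (LINT x|weight V. kernel \<psi> \<epsilon> (x - y))"

definition mollified_first_variation ::
    "(real^'n \<Rightarrow> real) \<Rightarrow> real \<Rightarrow> ((real^'n) \<times> (real^'n^'n)) measure \<Rightarrow> real^'n \<Rightarrow> real^'n" where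
  "mollified_first_variation \<psi> \<epsilon> V y =
     (LINT z|V. snd z *v gradient (kernel \<psi> \<epsilon>) (fst z - y))"

definition pre_mean_curvature ::
    "(real^'n \<Rightarrow> real) \<Rightarrow> real \<Rightarrow> ((real^'n) \<times> (real^'n^'n)) measure \<Rightarrow> real^'n \<Rightarrow> real^'n" where
  "pre_mean_curvature \<psi> \<epsilon> V y =
     - (mollified_first_variation \<psi> \<epsilon> V y /\<^sub>R (mollified_mass \<psi> \<epsilon> V y + \<epsilon>))"

definition approx_mean_curvature ::
    "(real^'n \<Rightarrow> real) \<Rightarrow> real \<Rightarrow> ((real^'n) \<times> (real^'n^'n)) measure \<Rightarrow> real^'n \<Rightarrow> real^'n" where
  "approx_mean_curvature \<psi> \<epsilon> V x =
     (LINT y|lborel. kernel \<psi> \<epsilon> (x - y) *\<^sub>R pre_mean_curvature \<psi> \<epsilon> V y)"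


section \<open>Approximate mean curvature flow\<close>

text \<open>A subdivision \<open>0 = t\<^sub>0 < \<dots> < t\<^sub>m = 1\<close> is the list of its nodes.\<close>

definition subdivision :: "real list \<Rightarrow> bool" where
  "subdivision ts \<longleftrightarrow> ts \<noteq> [] \<and> sorted_wrt (<) ts \<and> hd ts = 0 \<and> last ts = 1"

definition mesh :: "real list \<Rightarrow> real" where
  "mesh ts = Max ((\<lambda>i. ts ! Suc i - ts ! i) ` {i. Suc i < length ts})"

definition flow_step ::
    "(real^'n \<Rightarrow> real) \<Rightarrow> nat \<Rightarrow> real \<Rightarrow> real \<Rightarrow> ((real^'n) \<times> (real^'n^'n)) measure
      \<Rightarrow> ((real^'n) \<times> (real^'n^'n)) measure" where
  "flow_step \<psi> d \<epsilon> s V = pushforward d (\<lambda>x. x + s *\<^sub>R approx_mean_curvature \<psi> \<epsilon> V x) V"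

primrec flow_node ::
    "(real^'n \<Rightarrow> real) \<Rightarrow> nat \<Rightarrow> real \<Rightarrow> real list \<Rightarrow> ((real^'n) \<times> (real^'n^'n)) measure \<Rightarrow> nat
      \<Rightarrow> ((real^'n) \<times> (real^'n^'n)) measure" where
  "flow_node \<psi> d \<epsilon> ts V\<^sub>0 0 = V\<^sub>0"
| "flow_node \<psi> d \<epsilon> ts V\<^sub>0 (Suc i) =
     flow_step \<psi> d \<epsilon> (ts ! Suc i - ts ! i) (flow_node \<psi> d \<epsilon> ts V\<^sub>0 i)"

text \<open>At a node, the formulas of both adjacent intervals give \<^const>\<open>flow_node\<close>, because the
  push-forward by the identity is the identity on varifolds; so it does not matter which of the
  intervals containing \<open>t\<close> is selected.\<close>

definition discrete_flow ::
    "(real^'n \<Rightarrow> real) \<Rightarrow> nat \<Rightarrow> real \<Rightarrow> real list \<Rightarrow> ((real^'n) \<times> (real^'n^'n)) measure \<Rightarrow> real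
      \<Rightarrow> ((real^'n) \<times> (real^'n^'n)) measure" where
  "discrete_flow \<psi> d \<epsilon> ts V\<^sub>0 t =
     (let i = (LEAST i. t \<le> ts ! Suc i)
      in flow_step \<psi> d \<epsilon> (t - ts ! i) (flow_node \<psi> d \<epsilon> ts V\<^sub>0 i))"

text \<open>\<open>c\<^sub>3\<close> is the constant in the smallness condition on the subdivisions and \<open>M\<close> the mass bound.
  Along a sequence with mesh tending to 0 the condition holds eventually for any \<open>c\<^sub>3\<close>, so
  the limit does not depend on \<open>c\<^sub>3\<close> and \<open>M\<close>.\<close>

definition approx_mcf ::
    "(real^'n \<Rightarrow> real) \<Rightarrow> real \<Rightarrow> nat \<Rightarrow> real \<Rightarrow> real \<Rightarrow> ((real^'n) \<times> (real^'n^'n)) measure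
      \<Rightarrow> (real \<Rightarrow> ((real^'n) \<times> (real^'n^'n)) measure) \<Rightarrow> bool" where
  "approx_mcf \<psi> c\<^sub>3 d \<epsilon> M V\<^sub>0 V \<longleftrightarrow>
     (\<forall>t\<in>{0..1}. varifold d (V t) \<and>
        (\<forall>T::nat \<Rightarrow> real list.
           (\<forall>j. subdivision (T j) \<and> c\<^sub>3 * mesh (T j) \<le> inverse ((M + 1) ^ 3) * \<epsilon> ^ 8) \<and>
           (\<lambda>j. mesh (T j)) \<longlonglongrightarrow> 0 \<longrightarrow>
           weak_star_limit d (\<lambda>j. discrete_flow \<psi> d \<epsilon> (T j) V\<^sub>0 t) (V t)))"

end

theory Submission
  imports Defs
begin

text \<open>One step of the scheme pushes \<open>V\<close> forward by \<open>id + s h\<close> with \<open>h = h\<^sub>\<epsilon>(\<sqdot>, V)\<close>. The induced map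
  on \<open>(x, S)\<close> and the tangential Jacobian are \<open>1 + O(s)\<close>-Lipschitz, resp. \<open>O(s)\<close>-Lipschitz, and
  \<open>V \<mapsto> h\<close> is Lipschitz in \<open>C\<^sup>1\<close> for the bounded Lipschitz distance, because \<open>V\<close> enters only through
  integrals of translates of the kernel and its gradient. Hence one step multiplies the distance of
  two varifolds by at most \<open>1 + \<Gamma> s\<close>, where \<open>\<Gamma>\<close> is of order \<open>(M + 1)\<^sup>2 \<epsilon>\<^bsup>-n-7\<^esup>\<close> as long as the masses stay below
  \<open>M + 1\<close>. They do when the mesh is small enough, since the first variation of \<open>V\<close> along \<open>h\<close> is
  nonpositive, so that a step adds mass \<open>O(s\<^sup>2)\<close> only. Iterating along uniform subdivisions gives the
  factor \<open>exp (\<Gamma> t)\<close>, which passes to the weak-star limit after a cutoff in space.\<close>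

subsection \<open>Orthogonal projections\<close>

text \<open>The exponent \<open>n + 7\<close> rests on a pointwise bound of the kernel gradient: its
  height is of order \<open>\<epsilon>^(-n-2)\<close>, but it is at most
  \<open>\<epsilon>^(-2)\<close> times the kernel plus a constant. So its \<open>L^1\<close> norm is
  only of order \<open>\<epsilon>^(-2)\<close>, and in the quotient defining the curvature the
  mollified mass cancels, leaving order \<open>(M + 1) \<epsilon>^(-2)\<close>. Kernel heights enter
  only once, when two varifolds or two base points are compared. The factor in front of the distance
  must be \<open>1 + O(s)\<close> and not merely bounded, because it is multiplied over about
  \<open>1 / s\<close> steps. Hence the estimate between projections without loss of a constant, and
  the use of the maximum, not the sum, of sup and Lipschitz bounds of test functions. The Jacobian
  is defined through a chosen basis of the plane, from which no regularity in \<open>S\<close> can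
  be read off; it is rewritten as the square root of an \<open>n\<close> by \<open>n\<close>
  determinant explicit in \<open>S\<close>. Since the flow is the limit along every sequence of
  admissible subdivisions with mesh tending to 0, the mesh may be taken small depending on all data;
  only the rate \<open>\<Gamma>\<close> has to have the right size.\<close>

lemma is_orth_proj_exists:
  fixes T :: "(real^'n) set"
  assumes "subspace T"
  shows "\<exists>P. is_orth_proj T P"
proof -
  obtain B where B: "B \<subseteq> T" "pairwise orthogonal B" "\<And>x. x \<in> B \<Longrightarrow> norm x = 1"
      "independent B" "span B = T"
    using orthonormal_basis_subspace[OF assms] by metis
  have fin: "finite B" using B(4) independent_bound by blast
  define f where "f = (\<lambda>v::real^'n. \<Sum>b\<in>B. (b \<bullet> v) *\<^sub>R b)"
  have lin: "linear f"
    unfolding f_def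
    by (intro linearI) (simp_all add: inner_right_distrib scaleR_left_distrib sum.distrib scaleR_sum_right)
  have "f x \<in> T" for x
    unfolding f_def using B(1) assms by (intro subspace_sum subspace_scale) auto
  moreover have "orthogonal (x - f x) y" if "y \<in> T" for x y
  proof -
    have "orthogonal (x - f x) c" if c: "c \<in> B" for c
    proof -
      have "f x \<bullet> c = (\<Sum>b\<in>B. (b \<bullet> x) * (b \<bullet> c))"
        unfolding f_def by (simp add: inner_sum_left)
      also have "\<dots> = (\<Sum>b\<in>B. if b = c then (c \<bullet> x) else 0)"
        using B(2,3) c by (intro sum.cong)
          (auto simp: pairwise_def orthogonal_def dot_square_norm)
      also have "\<dots> = c \<bullet> x" using fin c by simp
      finally show ?thesis by (simp add: orthogonal_def inner_diff_left inner_diff_right inner_commute)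
    qed
    then show ?thesis using that B(5) orthogonal_to_span by (metis orthogonal_commute)
  qed
  ultimately have "is_orth_proj T (matrix f)"
    unfolding is_orth_proj_def using matrix_vector_mul(2)[OF lin]
    by (simp add: lin)
  then show ?thesis ..
qed

lemma is_orth_proj_unique:
  fixes T :: "(real^'n) set"
  assumes "subspace T" "is_orth_proj T P" "is_orth_proj T Q"
  shows "P = Q"
proof -
  have "P *v x = Q *v x" for x
  proof -
    let ?d = "P *v x - Q *v x"
    have d: "?d \<in> T" using assms unfolding is_orth_proj_def by (simp add: subspace_diff)
    have "orthogonal (x - P *v x) ?d" "orthogonal (x - Q *v x) ?d"
      using assms d unfolding is_orth_proj_def by blast+
    then have "?d \<bullet> ?d = 0" unfolding orthogonal_def by (simp add: inner_diff_left)
    then show ?thesis by simp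
  qed
  then show ?thesis by (simp add: matrix_eq)
qed

lemma orth_proj_eqI:
  assumes "subspace T" "is_orth_proj T P"
  shows "orth_proj T = P"
  unfolding orth_proj_def
proof (rule the_equality)
  show "is_orth_proj T P" by (rule assms(2))
  show "Q = P" if "is_orth_proj T Q" for Q by (rule is_orth_proj_unique[OF assms(1) that assms(2)])
qed

lemma is_orth_proj_orth_proj: "subspace T \<Longrightarrow> is_orth_proj T (orth_proj T)"
proof -
  assume T: "subspace T"
  obtain P where "is_orth_proj T P" using is_orth_proj_exists[OF T] ..
  then show ?thesis using orth_proj_eqI[OF T] by simp
qed

lemma is_orth_proj_fixes:
  assumes "subspace T" "is_orth_proj T P" "x \<in> T"
  shows "P *v x = x"
proof -
  have "P *v x \<in> T" "\<forall>y\<in>T. orthogonal (x - P *v x) y"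
    using assms unfolding is_orth_proj_def by auto
  then have "orthogonal (x - P *v x) (x - P *v x)" using assms(1,3) by (simp add: subspace_diff)
  then show ?thesis by (simp add: orthogonal_def)
qed

lemma plane_eq:
  assumes "subspace T" "is_orth_proj T P"
  shows "plane P = T"
proof
  show "plane P \<subseteq> T" using assms(2) by (auto simp: plane_def is_orth_proj_def)
  show "T \<subseteq> plane P"
  proof
    fix x assume "x \<in> T"
    then have "x = P *v x" using is_orth_proj_fixes[OF assms] by simp
    then show "x \<in> plane P" unfolding plane_def by (rule range_eqI)
  qed
qed

lemma subspace_plane: "subspace (plane S)"
  unfolding plane_def
  by (rule linear_subspace_image[OF matrix_vector_mul_linear subspace_UNIV])

text \<open>Symmetric idempotent matrices. Unlike \<open>orth_proj\<close>, this refers neither to a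
  subspace nor to \<open>THE\<close>, and both conditions pass to limits.\<close>

definition orthogonal_projection :: "real^'n^'n \<Rightarrow> bool" where
  "orthogonal_projection S \<longleftrightarrow>
     (\<forall>x y. (S *v x) \<bullet> y = x \<bullet> (S *v y)) \<and> (\<forall>x. S *v (S *v x) = S *v x)"

lemma is_orth_proj_imp_orthogonal_projection:
  assumes "subspace T" "is_orth_proj T P"
  shows "orthogonal_projection P"
proof -
  have "(P *v x) \<bullet> y = (P *v x) \<bullet> (P *v y)" for x y
  proof -
    have "orthogonal (y - P *v y) (P *v x)" using assms(2) unfolding is_orth_proj_def by blast
    then have "(P *v x) \<bullet> (y - P *v y) = 0" by (simp add: orthogonal_def inner_commute)
    then show ?thesis by (simp add: inner_diff_right)
  qed
  moreover have "P *v (P *v x) = P *v x" for x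
    using is_orth_proj_fixes[OF assms] assms(2) unfolding is_orth_proj_def by blast
  ultimately show ?thesis unfolding orthogonal_projection_def
    by (metis inner_commute)
qed

lemma orthogonal_projection_imp_is_orth_proj:
  assumes "orthogonal_projection S"
  shows "is_orth_proj (plane S) S"
proof -
  have "(x - S *v x) \<bullet> (S *v z) = 0" for x z
  proof -
    have "(x - S *v x) \<bullet> (S *v z) = (S *v (x - S *v x)) \<bullet> z"
      using assms unfolding orthogonal_projection_def by simp
    then show ?thesis
      using assms by (simp add: matrix_vector_mult_diff_distrib orthogonal_projection_def)
  qed
  then show ?thesis by (auto simp: is_orth_proj_def plane_def orthogonal_def)
qed

text \<open>Replaces the image of the \<open>THE\<close>-operator by algebraic conditions plus the
  rank; membership is used in this form from here on.\<close>

lemma grassmannian_iff: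
  "S \<in> grassmannian d \<longleftrightarrow> orthogonal_projection S \<and> dim (plane S) = d"
proof
  assume "S \<in> grassmannian d"
  then obtain T where T: "S = orth_proj T" "subspace T" "dim T = d"
    unfolding grassmannian_def by auto
  have i: "is_orth_proj T S" using T is_orth_proj_orth_proj by auto
  then show "orthogonal_projection S \<and> dim (plane S) = d"
    using T is_orth_proj_imp_orthogonal_projection plane_eq by metis
next
  assume a: "orthogonal_projection S \<and> dim (plane S) = d"
  have "orth_proj (plane S) = S"
    using orth_proj_eqI[OF subspace_plane orthogonal_projection_imp_is_orth_proj] a by auto
  then show "S \<in> grassmannian d"
    unfolding grassmannian_def using a subspace_plane by (metis (mono_tags, lifting) imageI mem_Collect_eq)
qed

lemma orthogonal_projection_norm_split:
  assumes "orthogonal_projection S"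
  shows "(norm x)\<^sup>2 = (norm (S *v x))\<^sup>2 + (norm (x - S *v x))\<^sup>2"
proof -
  have "(S *v x) \<bullet> (x - S *v x) = x \<bullet> (S *v (x - S *v x))"
    using assms unfolding orthogonal_projection_def by blast
  then have "(S *v x) \<bullet> (x - S *v x) = 0"
    using assms by (simp add: matrix_vector_mult_diff_distrib orthogonal_projection_def)
  then show ?thesis
    using norm_add_Pythagorean[of "S *v x" "x - S *v x"] by (simp add: orthogonal_def)
qed

lemma orthogonal_projection_norm_le:
  assumes "orthogonal_projection S"
  shows "norm (S *v x) \<le> norm x"
proof (rule power2_le_imp_le)
  show "(norm (S *v x))\<^sup>2 \<le> (norm x)\<^sup>2"
    unfolding orthogonal_projection_norm_split[OF assms, of x] by simp
qed simp

lemma orthogonal_projection_plane: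
  assumes "orthogonal_projection S" "x \<in> plane S"
  shows "S *v x = x"
proof -
  obtain z where "x = S *v z" using assms(2) by (auto simp: plane_def)
  then show ?thesis using assms(1) by (simp add: orthogonal_projection_def)
qed

text \<open>Split \<open>v\<close> into \<open>Q *v v\<close> and \<open>w = v - Q *v v\<close>.
  Then \<open>(P - Q) *v v\<close> is the sum of \<open>P *v w\<close> and a vector orthogonal to
  the range of \<open>P\<close>, and each summand is at most \<open>c\<close> times its part of
  \<open>v\<close>. Pythagoras on both sides gives \<open>c\<close> itself, with no factor
  lost.\<close>

lemma orthogonal_projection_dist_le:
  assumes P: "orthogonal_projection P" and Q: "orthogonal_projection Q"
    and c: "0 \<le> c"
    and PQ: "\<And>x. x \<in> plane P \<Longrightarrow> norm (x - Q *v x) \<le> c * norm x"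
    and QP: "\<And>x. x \<in> plane Q \<Longrightarrow> norm (x - P *v x) \<le> c * norm x"
  shows "onorm (\<lambda>v. (P - Q) *v v) \<le> c"
proof (rule onorm_le)
  fix v
  define w where "w = v - Q *v v"
  have Qw: "Q *v w = 0"
    unfolding w_def using Q by (simp add: orthogonal_projection_def matrix_vector_mult_diff_distrib)
  have sp: "(P *v x) \<bullet> y = x \<bullet> (P *v y)" "P *v (P *v x) = P *v x"
       "(Q *v x) \<bullet> y = x \<bullet> (Q *v y)" for x y
    using P Q unfolding orthogonal_projection_def by auto
  \<comment> \<open>A duality argument: since \<open>Q *v w = 0\<close>, the square of
    \<open>norm (P *v w)\<close> is the inner product of \<open>w\<close> with
    \<open>P *v w - Q *v (P *v w)\<close>, and \<open>PQ\<close> applies to the vector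
    \<open>P *v w\<close> of \<open>plane P\<close>.\<close>
  have 1: "norm (P *v w) \<le> c * norm w"
  proof (cases "P *v w = 0")
    case False
    have "(norm (P *v w))\<^sup>2 = (P *v w) \<bullet> w"
      by (simp add: power2_norm_eq_inner sp) 
    also have "\<dots> = (P *v w - Q *v (P *v w)) \<bullet> w"
      by (simp add: inner_diff_left sp(3) Qw)
    also have "\<dots> \<le> norm (P *v w - Q *v (P *v w)) * norm w" by (rule norm_cauchy_schwarz)
    also have "\<dots> \<le> (c * norm (P *v w)) * norm w"
      by (intro mult_right_mono PQ) (auto simp: plane_def)
    finally show ?thesis using False by (simp add: power2_eq_square)
  qed (use c in auto)
  have 2: "norm (Q *v v - P *v (Q *v v)) \<le> c * norm (Q *v v)"
    by (rule QP) (auto simp: plane_def)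
  have e: "(P - Q) *v v = P *v w + - (Q *v v - P *v (Q *v v))"
    unfolding w_def by (simp add: matrix_vector_mult_diff_distrib matrix_vector_mult_diff_rdistrib)
  have o: "orthogonal (P *v w) (- (Q *v v - P *v (Q *v v)))"
    unfolding orthogonal_def by (simp add: inner_diff_right sp)
  have "(norm ((P - Q) *v v))\<^sup>2 = (norm (P *v w))\<^sup>2 + (norm (Q *v v - P *v (Q *v v)))\<^sup>2"
    unfolding e norm_add_Pythagorean[OF o] by (simp add: norm_minus_commute)
  also have "\<dots> \<le> (c * norm w)\<^sup>2 + (c * norm (Q *v v))\<^sup>2"
    using 1 2 by (intro add_mono power_mono) auto
  also have "\<dots> = (c * norm v)\<^sup>2"
    using orthogonal_projection_norm_split[OF Q, of v]
    by (simp add: w_def power_mult_distrib algebra_simps)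
  finally show "norm ((P - Q) *v v) \<le> c * norm v"
    by (rule power2_le_imp_le) (simp add: c)
qed

section \<open>Norms of matrices, and the images of nearby planes under nearby linear maps\<close>

lemma onorm_matrix: "norm ((A::real^'n^'m) *v x) \<le> onorm (\<lambda>v. A *v v) * norm x"
  by (rule onorm) simp

text \<open>The metric uses the operator norm, the topology of the type the library norm. The crude
  dimensional factors of this comparison and the next serve only topological purposes (closedness,
  compactness, continuity) and never enter the final rate.\<close>

lemma onorm_matrix_le_norm:
  "onorm (\<lambda>v. (A::real^'n^'n) *v v) \<le> real CARD('n) * real CARD('n) * norm A"
proof (rule onorm_le_matrix_component)
  fix i j
  have "\<bar>A $ i $ j\<bar> \<le> norm (A $ i)" by (rule component_le_norm_cart)
  also have "\<dots> \<le> norm A" by (rule Finite_Cartesian_Product.norm_nth_le)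
  finally show "\<bar>A $ i $ j\<bar> \<le> norm A" .
qed

lemma norm_matrix_le_onorm:
  fixes A :: "real^'n^'n"
  shows "norm A \<le> real CARD('n) * real CARD('n) * onorm (\<lambda>v. A *v v)"
proof -
  have "norm (A $ i) \<le> real CARD('n) * onorm (\<lambda>v. A *v v)" for i
  proof -
    have "\<bar>A $ i $ j\<bar> \<le> onorm (\<lambda>v. A *v v)" for j
    proof -
      have "A $ i $ j = (A *v axis j 1) $ i" by (simp add: matrix_vector_mul_component inner_axis)
      also have "\<bar>\<dots>\<bar> \<le> norm (A *v axis j 1)" by (rule component_le_norm_cart)
      also have "\<dots> \<le> onorm (\<lambda>v. A *v v) * norm (axis j (1::real) :: real^'n)" by (rule onorm_matrix)
      finally show ?thesis by (simp add: norm_axis_1)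
    qed
    then have "(\<Sum>j\<in>UNIV. \<bar>A $ i $ j\<bar>) \<le> (\<Sum>j\<in>(UNIV::'n set). onorm (\<lambda>v. A *v v))" by (intro sum_mono)
    then show ?thesis using norm_le_l1_cart[of "A $ i"] by simp
  qed
  then have "(\<Sum>i\<in>UNIV. norm (A $ i)) \<le> (\<Sum>i\<in>(UNIV::'n set). real CARD('n) * onorm (\<lambda>v. A *v v))"
    by (intro sum_mono)
  moreover have "norm A \<le> (\<Sum>i\<in>UNIV. norm (A $ i))"
    unfolding norm_vec_def[of A] by (rule L2_set_le_sum) simp
  ultimately show ?thesis by simp
qed

lemma orthogonal_projection_orth_proj: "subspace T \<Longrightarrow> orthogonal_projection (orth_proj T)"
  by (rule is_orth_proj_imp_orthogonal_projection[OF _ is_orth_proj_orth_proj])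

lemma plane_orth_proj: "subspace T \<Longrightarrow> plane (orth_proj T) = T"
  by (rule plane_eq[OF _ is_orth_proj_orth_proj])

lemma orth_proj_closest:
  assumes "subspace T" "y \<in> T"
  shows "norm (x - orth_proj T *v x) \<le> norm (x - y)"
proof -
  let ?P = "orth_proj T"
  have P: "is_orth_proj T ?P" using assms is_orth_proj_orth_proj by auto
  have "?P *v x - y \<in> T" using P assms by (simp add: is_orth_proj_def subspace_diff)
  then have "orthogonal (x - ?P *v x) (?P *v x - y)" using P by (simp add: is_orth_proj_def)
  from norm_add_Pythagorean[OF this]
  have "(norm (x - y))\<^sup>2 = (norm (x - ?P *v x))\<^sup>2 + (norm (?P *v x - y))\<^sup>2" by simp
  then have "(norm (x - ?P *v x))\<^sup>2 \<le> (norm (x - y))\<^sup>2" by simp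
  then show ?thesis by (rule power2_le_imp_le) simp
qed

text \<open>A vector \<open>u + s L u\<close> of the first image is compared with the competitor
  \<open>T u + s K (T u)\<close> in the second. The denominator comes from
  \<open>norm (u + s L u) \<ge> (1 - s \<kappa>) norm u\<close>. The distance of the planes is
  multiplied by \<open>1 + O(s)\<close> only.\<close>

lemma orth_proj_image_dist_le:
  fixes L K :: "real^'n \<Rightarrow> real^'n"
  assumes S: "S \<in> grassmannian d" and T: "T \<in> grassmannian d"
    and lin: "linear L" "linear K"
    and s: "0 \<le> s" "s * \<kappa> < 1"
    and L: "\<And>v. norm (L v) \<le> \<kappa> * norm v" and K: "\<And>v. norm (K v) \<le> \<kappa> * norm v"
    and LK: "\<And>v. norm (L v - K v) \<le> q * norm v"
  shows "onorm (\<lambda>v. (orth_proj ((\<lambda>v. v + s *\<^sub>R L v) ` plane S)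
             - orth_proj ((\<lambda>v. v + s *\<^sub>R K v) ` plane T)) *v v)
     \<le> ((1 + s * \<kappa>) * onorm (\<lambda>v. (S - T) *v v) + s * q) / (1 - s * \<kappa>)"
proof -
  have \<kappa>: "0 \<le> \<kappa>" 
    using order_trans[OF norm_ge_zero L[of "axis undefined 1"]] by (simp add: norm_axis_1)
  have q: "0 \<le> q" 
    using order_trans[OF norm_ge_zero LK[of "axis undefined 1"]] by (simp add: norm_axis_1)
  define c where "c = onorm (\<lambda>v. (S - T) *v v)"
  have c: "c \<ge> 0" unfolding c_def by (rule onorm_pos_le) simp
  \<comment> \<open>Planes and maps are quantified afresh, because the estimate is applied twice,
    the second time with \<open>S\<close>, \<open>T\<close> and \<open>L\<close>, \<open>K\<close>
    exchanged.\<close>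
  have key: "norm (x - orth_proj ((\<lambda>v. v + s *\<^sub>R K v) ` plane T) *v x)
       \<le> ((1 + s * \<kappa>) * c + s * q) / (1 - s * \<kappa>) * norm x"
    if x: "x \<in> (\<lambda>v. v + s *\<^sub>R L v) ` plane S" 
      and S: "S \<in> grassmannian d" and T: "T \<in> grassmannian d"
      and c: "0 \<le> c" "\<And>v. norm ((S - T) *v v) \<le> c * norm v"
      and lin: "linear L" "linear K" 
      and L: "\<And>v. norm (L v) \<le> \<kappa> * norm v" and K: "\<And>v. norm (K v) \<le> \<kappa> * norm v"
      and LK: "\<And>v. norm (L v - K v) \<le> q * norm v"
      for x S T L K
  proof -
    obtain u where u: "u \<in> plane S" "x = u + s *\<^sub>R L u" using x by auto
    have Su: "S *v u = u" using orthogonal_projection_plane S u grassmannian_iff by metis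
    have "T *v u \<in> plane T" by (auto simp: plane_def)
    moreover have "subspace ((\<lambda>v. v + s *\<^sub>R K v) ` plane T)"
      by (intro linear_subspace_image subspace_plane linear_compose_add linear_ident
           linear_compose_scale_right lin)
    ultimately have "norm (x - orth_proj ((\<lambda>v. v + s *\<^sub>R K v) ` plane T) *v x)
       \<le> norm (x - (T *v u + s *\<^sub>R K (T *v u)))"
      by (intro orth_proj_closest) auto
    also have "x - (T *v u + s *\<^sub>R K (T *v u))
       = (S - T) *v u + s *\<^sub>R ((L u - K u) + K ((S - T) *v u))"
      using Su u(2) lin by (simp add: matrix_vector_mult_diff_rdistrib linear_diff algebra_simps)
    also have "norm \<dots> \<le> c * norm u + s * (q * norm u + \<kappa> * (c * norm u))"
    proof -
      have "norm (K ((S - T) *v u)) \<le> \<kappa> * (c * norm u)"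
        using K[of "(S - T) *v u"] c(2)[of u] \<kappa> by (meson mult_left_mono order_trans)
      then have "norm ((L u - K u) + K ((S - T) *v u)) \<le> q * norm u + \<kappa> * (c * norm u)"
        using LK[of u] norm_triangle_mono by blast
      then show ?thesis using c(2)[of u] s
        by (intro norm_triangle_mono) (auto simp: mult_left_mono)
    qed
    also have "\<dots> = ((1 + s * \<kappa>) * c + s * q) * norm u" by (simp add: algebra_simps)
    also have "\<dots> \<le> ((1 + s * \<kappa>) * c + s * q) * (norm x / (1 - s * \<kappa>))"
    proof (rule mult_left_mono)
      have "norm u \<le> norm x + s * (\<kappa> * norm u)"
      proof -
        have "norm u \<le> norm x + norm (s *\<^sub>R L u)"
          using u(2) norm_triangle_ineq4[of x "s *\<^sub>R L u"] by simp
        then show ?thesis using L[of u] s by simp (smt (verit) mult_left_mono)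
      qed
      then have "norm u * (1 - s * \<kappa>) \<le> norm x" by (simp add: algebra_simps)
      then show "norm u \<le> norm x / (1 - s * \<kappa>)" using s by (simp add: pos_le_divide_eq)
    qed (use s \<kappa> q c in simp)
    finally show ?thesis by simp
  qed
  have sub: "subspace ((\<lambda>v. v + s *\<^sub>R L v) ` plane S)" if "linear L" for L S
    by (intro linear_subspace_image subspace_plane linear_compose_add linear_ident
           linear_compose_scale_right that)
  have cST: "norm ((S - T) *v v) \<le> c * norm v" for v unfolding c_def by (rule onorm_matrix)
  have cTS: "norm ((T - S) *v v) \<le> c * norm v" for v
    using cST[of v] by (simp add: matrix_vector_mult_diff_rdistrib norm_minus_commute)
  show ?thesis
    unfolding c_def[symmetric]
  proof (rule orthogonal_projection_dist_le)
    show "orthogonal_projection (orth_proj ((\<lambda>v. v + s *\<^sub>R L v) ` plane S))"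
      "orthogonal_projection (orth_proj ((\<lambda>v. v + s *\<^sub>R K v) ` plane T))"
      by (rule orthogonal_projection_orth_proj, rule sub, rule lin)+
    show "0 \<le> ((1 + s * \<kappa>) * c + s * q) / (1 - s * \<kappa>)" using s \<kappa> c q by simp
  next
    fix x assume "x \<in> plane (orth_proj ((\<lambda>v. v + s *\<^sub>R L v) ` plane S))"
    then have "x \<in> (\<lambda>v. v + s *\<^sub>R L v) ` plane S"
      by (simp only: plane_orth_proj[OF sub[OF lin(1)]])
    from key[OF this S T c cST lin L K LK]
    show "norm (x - orth_proj ((\<lambda>v. v + s *\<^sub>R K v) ` plane T) *v x)
         \<le> ((1 + s * \<kappa>) * c + s * q) / (1 - s * \<kappa>) * norm x" .
  next
    fix x assume "x \<in> plane (orth_proj ((\<lambda>v. v + s *\<^sub>R K v) ` plane T))"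
    then have "x \<in> (\<lambda>v. v + s *\<^sub>R K v) ` plane T"
      by (simp only: plane_orth_proj[OF sub[OF lin(2)]])
    from key[OF this T S c cTS lin(2,1) K L LK[unfolded norm_minus_commute[of "L _"]]]
    show "norm (x - orth_proj ((\<lambda>v. v + s *\<^sub>R L v) ` plane S) *v x)
         \<le> ((1 + s * \<kappa>) * c + s * q) / (1 - s * \<kappa>) * norm x" .
  qed
qed

section \<open>The Grassmannian: stability under injective linear maps, and compactness\<close>

lemma orth_proj_image_grassmannian:
  assumes "S \<in> grassmannian d" "linear f" "inj f"
  shows "orth_proj (f ` plane S) \<in> grassmannian d"
proof -
  have 1: "subspace (f ` plane S)" by (rule linear_subspace_image[OF assms(2) subspace_plane])
  have "dim (f ` plane S) = dim (plane S)"
    by (rule dim_image_eq[OF assms(2)]) (rule inj_on_subset[OF assms(3)], simp)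
  then have 2: "dim (f ` plane S) = d" using assms(1) by (simp add: grassmannian_iff)
  show ?thesis unfolding grassmannian_def by (rule imageI) (simp add: 1 2)
qed

text \<open>Symmetry and idempotence survive limits. The rank does too, because two projections at
  operator distance below 1 have ranges of equal dimension.\<close>

lemma closed_grassmannian: "closed (grassmannian d :: (real^'n^'n) set)"
proof (unfold closed_sequential_limits, safe)
  fix X :: "nat \<Rightarrow> real^'n^'n" and P
  assume X: "\<forall>n. X n \<in> grassmannian d" and lim: "X \<longlonglongrightarrow> P"
  have limv: "(\<lambda>n. X n *v v) \<longlonglongrightarrow> P *v v" for v
  proof (rule bounded_linear.tendsto[OF _ lim])
    have "linear (\<lambda>A :: real^'n^'n. A *v v)"
      by (intro linearI) (simp_all add: matrix_vector_mult_add_rdistrib scaleR_matrix_vector_assoc)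
    then show "bounded_linear (\<lambda>A :: real^'n^'n. A *v v)" by (simp add: linear_conv_bounded_linear)
  qed
  have Xp: "(X n *v x) \<bullet> y = x \<bullet> (X n *v y)" "X n *v (X n *v x) = X n *v x" for n x y
    using X unfolding grassmannian_iff orthogonal_projection_def by auto
  have sym: "(P *v x) \<bullet> y = x \<bullet> (P *v y)" for x y
  proof (rule LIMSEQ_unique)
    show "(\<lambda>n. (X n *v x) \<bullet> y) \<longlonglongrightarrow> (P *v x) \<bullet> y" by (intro tendsto_intros limv)
    have "(\<lambda>n. x \<bullet> (X n *v y)) \<longlonglongrightarrow> x \<bullet> (P *v y)" by (intro tendsto_intros limv)
    then show "(\<lambda>n. (X n *v x) \<bullet> y) \<longlonglongrightarrow> x \<bullet> (P *v y)" by (simp only: Xp(1))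
  qed
  \<comment> \<open>Tested against \<open>y\<close>: by symmetry one factor moves to the other side,
    so only pointwise limits of \<open>X n\<close> are needed and never the limit of a matrix
    product.\<close>
  have idem: "P *v (P *v x) = P *v x" for x
  proof -
    have "(P *v (P *v x)) \<bullet> y = (P *v x) \<bullet> y" for y
    proof (rule LIMSEQ_unique)
      show "(\<lambda>n. (X n *v x) \<bullet> y) \<longlonglongrightarrow> (P *v x) \<bullet> y" by (intro tendsto_intros limv)
      have "(\<lambda>n. (X n *v x) \<bullet> (X n *v y)) \<longlonglongrightarrow> (P *v x) \<bullet> (P *v y)"
        by (intro tendsto_intros limv)
      moreover have "(X n *v x) \<bullet> (X n *v y) = (X n *v x) \<bullet> y" for n
        using Xp(1)[of n "X n *v x" y] by (simp only: Xp(2))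
      ultimately show "(\<lambda>n. (X n *v x) \<bullet> y) \<longlonglongrightarrow> (P *v (P *v x)) \<bullet> y"
        by (simp only: sym)
    qed
    then show ?thesis by (metis vector_eq_rdot)
  qed
  have P: "orthogonal_projection P" using sym idem unfolding orthogonal_projection_def by auto
  \<comment> \<open>\<open>R\<close> is injective on \<open>plane Q\<close>: a vector of
    \<open>plane Q\<close> killed by \<open>R\<close> has the same norm as its image under
    \<open>Q - R\<close>.\<close>
  have dimle: "dim (plane Q) \<le> dim (plane R)"
    if QR: "\<And>v. v \<noteq> 0 \<Longrightarrow> norm ((Q - R) *v v) < norm v" and Q: "orthogonal_projection Q"
    for Q R :: "real^'n^'n"
  proof -
    have "inj_on (\<lambda>v. R *v v) (plane Q)"
    proof (rule linear_injective_on_subspace_0[THEN iffD2])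
      show "\<forall>x\<in>plane Q. R *v x = 0 \<longrightarrow> x = 0"
      proof safe
        fix x assume "x \<in> plane Q" "R *v x = 0"
        then have "norm ((Q - R) *v x) = norm x"
          using orthogonal_projection_plane[OF Q] by (simp add: matrix_vector_mult_diff_rdistrib)
        then show "x = 0" using QR[of x] by force
      qed
    qed (auto simp: subspace_plane)
    then have "dim (plane Q) = dim ((\<lambda>v. R *v v) ` plane Q)"
      using dim_image_eq[OF matrix_vector_mul_linear, of R "plane Q"]
        span_eq_iff[THEN iffD2, OF subspace_plane[of Q]] by simp
    also have "\<dots> \<le> dim (plane R)" unfolding plane_def by (intro dim_subset) auto
    finally show ?thesis .
  qed
  \<comment> \<open>The threshold undoes the factor in \<open>onorm_matrix_le_norm\<close>; the
    added 1 makes the operator distance strictly less than 1.\<close>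
  have "eventually (\<lambda>n. dist (X n) P < inverse (real CARD('n) * real CARD('n) + 1)) sequentially"
    by (intro tendstoD[OF lim]) (simp add: add_nonneg_pos)
  then obtain n where n: "dist (X n) P < inverse (real CARD('n) * real CARD('n) + 1)"
    using eventually_happens'[OF sequentially_bot] by blast
  have ns: "norm ((X n - P) *v v) < norm v" if "v \<noteq> 0" for v
  proof -
    have "onorm (\<lambda>v. (X n - P) *v v) \<le> real CARD('n) * real CARD('n) * dist (X n) P"
      unfolding dist_norm by (rule onorm_matrix_le_norm)
    also have "\<dots> < 1" 
    proof -
      have "real CARD('n) * real CARD('n) * dist (X n) P \<le> (real CARD('n) * real CARD('n)) * inverse (real CARD('n) * real CARD('n) + 1)"
        using n by (intro mult_left_mono) auto
      also have "\<dots> < 1" by (simp add: field_simps add_pos_nonneg)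
      finally show ?thesis .
    qed
    finally have "onorm (\<lambda>v. (X n - P) *v v) * norm v < 1 * norm v"
      using that by (intro mult_strict_right_mono) auto
    then show ?thesis using onorm_matrix[of "X n - P" v] by simp
  qed
  then have ns': "norm ((P - X n) *v v) < norm v" if "v \<noteq> 0" for v
    using that by (simp add: matrix_vector_mult_diff_rdistrib norm_minus_commute)
  have "dim (plane P) = dim (plane (X n))"
  proof (rule antisym)
    have "orthogonal_projection (X n)" using X by (simp add: grassmannian_iff)
    then show "dim (plane (X n)) \<le> dim (plane P)" using ns by (rule dimle[rotated])
    show "dim (plane P) \<le> dim (plane (X n))" using P ns' by (rule dimle[rotated])
  qed
  then show "P \<in> grassmannian d" using P X by (simp add: grassmannian_iff)
qed

lemma compact_grassmannian: "compact (grassmannian d :: (real^'n^'n) set)"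
proof -
  have "norm S \<le> real CARD('n) * real CARD('n)" if S: "S \<in> grassmannian d" for S :: "real^'n^'n"
  proof -
    have "onorm (\<lambda>v. S *v v) \<le> 1"
    proof (rule onorm_le)
      show "norm (S *v x) \<le> 1 * norm x" for x
        using S orthogonal_projection_norm_le[of S x] by (simp add: grassmannian_iff)
    qed
    then have "real CARD('n) * real CARD('n) * onorm (\<lambda>v. S *v v) \<le> real CARD('n) * real CARD('n) * 1"
      by (intro mult_left_mono) auto
    then show ?thesis using norm_matrix_le_onorm[of S] by linarith
  qed
  then have "bounded (grassmannian d :: (real^'n^'n) set)" unfolding bounded_iff by blast
  then show ?thesis using closed_grassmannian compact_eq_bounded_closed by blast
qed

subsection \<open>Gram determinants and the tangential Jacobian\<close>

text \<open>Needed because \<open>gram_det\<close> sums over permutations of \<open>{..<d}\<close>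
  whereas \<open>det\<close> sums over permutations of the index type. Surjectivity comes from
  counting.\<close>

lemma bij_betw_map_permutation:
  assumes f: "bij_betw f A B" and fin: "finite A"
  shows "bij_betw (map_permutation A f) {p. p permutes A} {p. p permutes B}"
proof -
  have inj: "inj_on f A" and finB: "finite B" and card: "card A = card B"
    using f fin by (auto simp: bij_betw_def bij_betw_same_card dest: card_image)
  have i: "inj_on (map_permutation A f) {p. p permutes A}"
  proof (rule inj_onI)
    fix p p' assume p: "p \<in> {p. p permutes A}" "p' \<in> {p. p permutes A}"
      and e: "map_permutation A f p = map_permutation A f p'"
    show "p = p'"
    proof
      fix x
      show "p x = p' x"
      proof (cases "x \<in> A")
        case True
        have "f (p x) = f (p' x)"
          using map_permutation_apply[OF inj True, of p] map_permutation_apply[OF inj True, of p'] e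
          by simp
        moreover have "p x \<in> A" "p' x \<in> A" using p True by (auto simp: permutes_in_image)
        ultimately show ?thesis using inj by (simp add: inj_on_eq_iff)
      next
        case False
        then show ?thesis using p by (simp add: permutes_not_in)
      qed
    qed
  qed
  have "map_permutation A f ` {p. p permutes A} = {p. p permutes B}"
  proof (rule card_subset_eq)
    show "finite {p. p permutes B}" using finB by (rule finite_permutations)
    show "map_permutation A f ` {p. p permutes A} \<subseteq> {p. p permutes B}"
      using map_permutation_permutes[OF f] by blast
    show "card (map_permutation A f ` {p. p permutes A}) = card {p. p permutes B}"
      using card_image[OF i] card_permutations[OF refl fin] card_permutations[OF refl finB] card
      by simp
  qed
  then show ?thesis using i by (simp add: bij_betw_def)
qed

text \<open>A permutation that moves an index \<open>i\<close> outside \<open>D\<close> picks an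
  off-diagonal entry of an identity row, so its term is 0; the remaining permutations fix everything
  outside \<open>D\<close>.\<close>

lemma det_eq_sum_permutes_subset:
  fixes M :: "real^'n^'n"
  assumes M: "\<And>k l. k \<notin> D \<Longrightarrow> M $ k $ l = (if k = l then 1 else 0)"
  shows "det M = (\<Sum>p | p permutes D. of_int (sign p) * (\<Prod>i\<in>D. M $ i $ p i))"
proof -
  have "det M = (\<Sum>p | p permutes D. of_int (sign p) * (\<Prod>i\<in>UNIV. M $ i $ p i))"
    unfolding det_def
  proof (rule sum.mono_neutral_right)
    show "{p. p permutes D} \<subseteq> {p. p permutes UNIV}" by (auto intro: permutes_subset)
    show "\<forall>p\<in>{p. p permutes UNIV} - {p. p permutes D}.
       of_int (sign p) * (\<Prod>i\<in>UNIV. M $ i $ p i) = 0"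
    proof
      fix p assume p: "p \<in> {p. p permutes UNIV} - {p. p permutes D}"
      have "\<exists>i. i \<notin> D \<and> p i \<noteq> i"
      proof (rule ccontr)
        assume "\<not> ?thesis"
        then have "p permutes D" using p permutes_superset[of p UNIV D] by auto
        then show False using p by simp
      qed
      then obtain i where "i \<notin> D" "p i \<noteq> i" by blast
      then have "M $ i $ p i = 0" using M[of i "p i"] by simp
      then have "(\<Prod>i\<in>UNIV. M $ i $ p i) = 0" by (intro prod_zero) auto
      then show "of_int (sign p) * (\<Prod>i\<in>UNIV. M $ i $ p i) = 0" by simp
    qed
  qed (simp add: finite_permutations)
  also have "\<dots> = (\<Sum>p | p permutes D. of_int (sign p) * (\<Prod>i\<in>D. M $ i $ p i))"
  proof (intro sum.cong refl arg_cong2[where f = "(*)"])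
    fix p assume p: "p \<in> {p. p permutes D}"
    show "(\<Prod>i\<in>UNIV. M $ i $ p i) = (\<Prod>i\<in>D. M $ i $ p i)"
      by (rule prod.mono_neutral_right) (use p M in \<open>auto simp: permutes_not_in\<close>)
  qed
  finally show ?thesis .
qed

text \<open>The \<open>n \<times> n\<close> matrix of the bilinear form that equals \<open>(A u) \<bullet> (A v)\<close> on the range of \<open>S\<close> and
  the inner product on its orthogonal complement.\<close>

definition gram_matrix :: "(real^'n \<Rightarrow> real^'n) \<Rightarrow> real^'n^'n \<Rightarrow> real^'n^'n" where
  "gram_matrix A S = (\<chi> k l. (if k = l then 1 else 0)
     + A (S *v axis k 1) \<bullet> A (S *v axis l 1) - (S *v axis k 1) \<bullet> (S *v axis l 1))"

lemma inner_gram_matrix: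
  assumes A: "linear A"
  shows "u \<bullet> (gram_matrix A S *v v) = u \<bullet> v + A (S *v u) \<bullet> A (S *v v) - (S *v u) \<bullet> (S *v v)"
proof -
  have ex: "w = (\<Sum>k\<in>UNIV. (w $ k) *\<^sub>R axis k (1::real))" for w :: "real^'n"
    by (simp add: vec_eq_iff axis_def if_distrib cong: if_cong)
  have Sw: "S *v w = (\<Sum>k\<in>UNIV. (w $ k) *\<^sub>R (S *v axis k 1))" for w
    by (subst ex) (simp add: linear_sum[OF matrix_vector_mul_linear] matrix_vector_mult_scaleR)
  have ASw: "A (S *v w) = (\<Sum>k\<in>UNIV. (w $ k) *\<^sub>R A (S *v axis k 1))" for w
    by (subst Sw) (simp add: linear_sum[OF A] linear_scale[OF A])
  have "u \<bullet> (gram_matrix A S *v v) = (\<Sum>k\<in>UNIV. \<Sum>l\<in>UNIV. u $ k * v $ l * gram_matrix A S $ k $ l)"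
    by (simp add: inner_vec_def matrix_vector_mult_def sum_distrib_left algebra_simps)
  also have "\<dots> = (\<Sum>k\<in>UNIV. \<Sum>l\<in>UNIV. u $ k * v $ l * (if k = l then 1 else 0))
      + (\<Sum>k\<in>UNIV. \<Sum>l\<in>UNIV. u $ k * v $ l * (A (S *v axis k 1) \<bullet> A (S *v axis l 1)))
      - (\<Sum>k\<in>UNIV. \<Sum>l\<in>UNIV. u $ k * v $ l * ((S *v axis k 1) \<bullet> (S *v axis l 1)))"
    by (simp add: gram_matrix_def sum.distrib sum_subtractf distrib_left right_diff_distrib)
  also have "(\<Sum>k\<in>UNIV. \<Sum>l\<in>UNIV. u $ k * v $ l * (if k = l then 1 else 0)) = u \<bullet> v"
    by (simp add: inner_vec_def if_distrib cong: if_cong)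
  also have "(\<Sum>k\<in>UNIV. \<Sum>l\<in>UNIV. u $ k * v $ l * (A (S *v axis k 1) \<bullet> A (S *v axis l 1)))
      = A (S *v u) \<bullet> A (S *v v)"
    unfolding ASw[of u] ASw[of v] inner_sum_left
    by (simp add: inner_sum_right sum_distrib_left mult_ac)
  also have "(\<Sum>k\<in>UNIV. \<Sum>l\<in>UNIV. u $ k * v $ l * ((S *v axis k 1) \<bullet> (S *v axis l 1)))
      = (S *v u) \<bullet> (S *v v)"
    unfolding Sw[of u] Sw[of v] inner_sum_left
    by (simp add: inner_sum_right sum_distrib_left mult_ac)
  finally show ?thesis .
qed

text \<open>Complete \<open>q\<close> to an orthonormal basis of the whole space by a basis of the
  kernel of \<open>S\<close>. In this basis \<open>gram_matrix A S\<close> is block diagonal, with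
  the Gram matrix of the \<open>A (q i)\<close> and an identity block, and an orthogonal change of
  basis keeps the determinant.\<close>

lemma gram_det_eq_det_gram_matrix:
  fixes S :: "real^'n^'n"
  assumes S: "orthogonal_projection S" and A: "linear A"
    and q: "orthonormal_basis d (plane S) q"
  shows "gram_det d (\<lambda>i. A (q i)) = det (gram_matrix A S)"
proof -
  have qq: "q i \<bullet> q j = (if i = j then 1 else 0)" if "i < d" "j < d" for i j
    using q that by (auto simp: orthonormal_basis_def)
  have q_inj: "inj_on q {..<d}"
  proof (rule inj_onI)
    fix i j assume ij: "i \<in> {..<d}" "j \<in> {..<d}" "q i = q j"
    then show "i = j" using qq[of i j] qq[of j j] by (auto split: if_splits)
  qed
  have qS: "q i \<in> plane S" if "i < d" for i
  proof -
    have "q i \<in> span (q ` {..<d})" by (rule span_base) (use that in simp)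
    then show ?thesis using q by (simp add: orthonormal_basis_def)
  qed
  \<comment> \<open>The orthogonal complement of \<open>plane S\<close>, as \<open>S\<close> is
    symmetric.\<close>
  define Z where "Z = {v. S *v v = 0}"
  have subZ: "subspace Z"
    unfolding Z_def by (auto simp: subspace_def matrix_vector_right_distrib matrix_vector_mult_scaleR)
  obtain C where C: "C \<subseteq> Z" "pairwise orthogonal C" "\<And>x. x \<in> C \<Longrightarrow> norm x = 1"
      "independent C" "span C = Z"
    using orthonormal_basis_subspace[OF subZ] by metis
  define B where "B = q ` {..<d} \<union> C"
  have SZ: "u \<bullet> v = 0" if "u \<in> plane S" "v \<in> Z" for u v
  proof -
    have "u \<bullet> v = (S *v u) \<bullet> v" using orthogonal_projection_plane[OF S that(1)] by simp
    also have "\<dots> = u \<bullet> (S *v v)" using S by (simp add: orthogonal_projection_def)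
    finally show ?thesis using that by (simp add: Z_def)
  qed
  have BB: "u \<bullet> v = (if u = v then 1 else 0)" if "u \<in> B" "v \<in> B" for u v
  proof -
    have CC: "u \<bullet> v = (if u = v then 1 else 0)" if "u \<in> C" "v \<in> C" for u v
      using C(2,3) that by (auto simp: pairwise_def orthogonal_def dot_square_norm)
    have ne: "q i \<noteq> v" if "i < d" "v \<in> C" for i v
      using qq[OF that(1) that(1)] SZ[OF qS[OF that(1)], of v] C(1) that(2) by auto
    consider (1) i j where "i < d" "j < d" "u = q i" "v = q j" | (2) "u \<in> C" "v \<in> C"
      | (3) i where "i < d" "u = q i" "v \<in> C" | (4) i where "i < d" "v = q i" "u \<in> C"
      using \<open>u \<in> B\<close> \<open>v \<in> B\<close> unfolding B_def by blast
    then show ?thesis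
    proof cases
      case 1
      then show ?thesis using qq inj_on_eq_iff[OF q_inj, of i j] by auto
    next
      case 2
      then show ?thesis by (rule CC)
    next
      case 3
      then show ?thesis using ne[of i v] SZ[OF qS, of i v] C(1) by auto
    next
      case 4
      then show ?thesis using ne[of i u] SZ[OF qS, of i u] C(1) by (auto simp: inner_commute)
    qed
  qed
  have "independent B"
  proof (rule pairwise_orthogonal_independent)
    show "pairwise orthogonal B" using BB by (auto simp: pairwise_def orthogonal_def)
    show "0 \<notin> B" using BB[of 0 0] by auto
  qed
  then have finB: "finite B" using independent_bound by blast
  have "span B = UNIV"
  proof (intro set_eqI iffI UNIV_I)
    fix x
    have "S *v x \<in> span (q ` {..<d})"
      using q by (auto simp: orthonormal_basis_def plane_def)
    then have 1: "S *v x \<in> span B" unfolding B_def by (meson span_mono Un_upper1 subsetD)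
    have "x - S *v x \<in> span C"
      using S by (simp add: C(5) Z_def matrix_vector_mult_diff_distrib orthogonal_projection_def)
    then have "x - S *v x \<in> span B" unfolding B_def by (meson span_mono Un_upper2 subsetD)
    from span_add[OF 1 this] show "x \<in> span B" by simp
  qed
  then have "card B = CARD('n)"
    using \<open>independent B\<close> dim_eq_card[of B UNIV] by (simp add: dim_UNIV)
  then obtain e :: "'n \<Rightarrow> real^'n" where e: "bij_betw e UNIV B"
    using finite_same_card_bij[of "UNIV :: 'n set" B] finB by auto
  have eB: "e k \<in> B" for k using e by (auto simp: bij_betw_def)
  have ee: "e k \<bullet> e l = (if k = l then 1 else 0)" for k l
    using BB[OF eB eB] e by (auto simp: bij_betw_def inj_on_eq_iff)
  \<comment> \<open>The orthogonal matrix with columns \<open>e k\<close>, so that \<open>M\<close>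
    below is the bilinear form in the new basis.\<close>
  define U :: "real^'n^'n" where "U = (\<chi> i k. e k $ i)"
  have colU: "column k U = e k" for k by (simp add: column_def U_def vec_eq_iff)
  have tU: "(transpose U ** Y) $ k $ l = e k \<bullet> column l Y" for Y :: "real^'n^'n" and k l
    by (simp add: matrix_matrix_mult_def transpose_def column_def inner_vec_def U_def)
  have "transpose U ** U = mat 1"
    by (simp add: tU colU ee mat_def vec_eq_iff)
  then have "det (transpose U) * det U = 1" by (metis det_mul det_I)
  then have detU: "det U * det U = 1" by (simp add: det_transpose)
  define M where "M = transpose U ** (gram_matrix A S ** U)"
  have M: "M $ k $ l = e k \<bullet> e l + A (S *v e k) \<bullet> A (S *v e l) - (S *v e k) \<bullet> (S *v e l)" for k l
  proof -
    have "column l (gram_matrix A S ** U) = gram_matrix A S *v column l U"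
      by (simp add: column_def matrix_matrix_mult_def matrix_vector_mult_def vec_eq_iff)
    then have "M $ k $ l = e k \<bullet> (gram_matrix A S *v e l)"
      by (simp add: M_def tU colU)
    then show ?thesis by (simp add: inner_gram_matrix[OF A])
  qed
  have "det M = det U * det U * det (gram_matrix A S)"
    unfolding M_def by (simp add: det_mul det_transpose)
  then have detM: "det (gram_matrix A S) = det M" using detU by simp
  \<comment> \<open>\<open>D\<close> holds the labels of the basis vectors that come from
    \<open>q\<close>, and \<open>f\<close> relabels \<open>{..<d}\<close> by \<open>D\<close>; rows
    of \<open>M\<close> outside \<open>D\<close> are identity rows.\<close>
  define D where "D = {k. e k \<in> q ` {..<d}}"
  define f where "f = (\<lambda>i. inv e (q i))"
  have inve: "e (inv e v) = v" if "v \<in> B" for v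
    using e that by (metis bij_betw_imp_surj_on f_inv_into_f)
  have ef: "e (f i) = q i" if "i < d" for i
    unfolding f_def using that by (intro inve) (simp add: B_def)
  have bf: "bij_betw f {..<d} D"
  proof (rule bij_betw_imageI)
    show "inj_on f {..<d}"
    proof (rule inj_onI)
      fix i j assume ij: "i \<in> {..<d}" "j \<in> {..<d}" "f i = f j"
      then have "q i = q j" using ef[of i] ef[of j] by simp
      then show "i = j" using ij q_inj by (simp add: inj_on_eq_iff)
    qed
    show "f ` {..<d} = D"
    proof safe
      fix i assume "i < d" then show "f i \<in> D" by (simp add: D_def ef)
    next
      fix k assume "k \<in> D"
      then obtain i where i: "i < d" "e k = q i" by (auto simp: D_def)
      then have "k = f i" using e by (metis f_def bij_betw_imp_inj_on inv_f_f)
      then show "k \<in> f ` {..<d}" using i by simp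
    qed
  qed
  have Se: "S *v e k = 0" if "k \<notin> D" for k
    using that eB[of k] C(1) by (auto simp: D_def B_def Z_def)
  have "det M = (\<Sum>p | p permutes D. of_int (sign p) * (\<Prod>i\<in>D. M $ i $ p i))"
    by (rule det_eq_sum_permutes_subset) (simp add: M Se linear_0[OF A] ee)
  also have "\<dots> = (\<Sum>p | p permutes {..<d}. of_int (sign (map_permutation {..<d} f p))
       * (\<Prod>i\<in>D. M $ i $ map_permutation {..<d} f p i))"
    by (rule sum.reindex_bij_betw[OF bij_betw_map_permutation[OF bf], symmetric]) simp
  also have "\<dots> = (\<Sum>p | p permutes {..<d}. of_int (sign p) * (\<Prod>i<d. A (q i) \<bullet> A (q (p i))))"
  proof (intro sum.cong refl arg_cong2[where f = "(*)"])
    fix p assume "p \<in> {p. p permutes {..<d}}"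
    then have p: "p permutes {..<d}" by simp
    have inj: "inj_on f {..<d}" using bf by (simp add: bij_betw_def)
    show "(of_int (sign (map_permutation {..<d} f p)) :: real) = of_int (sign p)"
      using sign_map_permutation[OF inj p] by simp
    have "(\<Prod>i\<in>D. M $ i $ map_permutation {..<d} f p i)
        = (\<Prod>i<d. M $ f i $ map_permutation {..<d} f p (f i))"
      by (rule prod.reindex_bij_betw[OF bf, symmetric])
    also have "\<dots> = (\<Prod>i<d. A (q i) \<bullet> A (q (p i)))"
    proof (rule prod.cong[OF refl])
      fix i assume "i \<in> {..<d}"
      then have i: "i < d" "p i < d" using permutes_in_image[OF p, of i] by auto
      have "map_permutation {..<d} f p (f i) = f (p i)"
        using map_permutation_apply[OF inj, of i p] i by simp
      then show "M $ f i $ map_permutation {..<d} f p (f i) = A (q i) \<bullet> A (q (p i))"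
        using i by (simp add: M ef orthogonal_projection_plane[OF S qS])
    qed
    finally show "(\<Prod>i\<in>D. M $ i $ map_permutation {..<d} f p i) = (\<Prod>i<d. A (q i) \<bullet> A (q (p i)))" .
  qed
  finally show ?thesis by (simp add: gram_det_def detM)
qed

lemma orthonormal_basis_exists:
  assumes "subspace T" "dim T = d"
  shows "\<exists>q. orthonormal_basis d T q"
proof -
  obtain B where B: "B \<subseteq> T" "pairwise orthogonal B" "\<And>x. x \<in> B \<Longrightarrow> norm x = 1"
      "independent B" "card B = d" "span B = T"
    using orthonormal_basis_subspace[OF assms(1)] assms(2) by metis
  have "finite B" using B(4) independent_bound by blast
  then obtain q where q: "bij_betw q {..<d} B"
    using finite_same_card_bij[of "{..<d}" B] B(5) by auto
  have "q i \<bullet> q j = (if i = j then 1 else 0)" if "i < d" "j < d" for i j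
  proof (cases "i = j")
    case True
    have "norm (q i) = 1" using q B(3) that by (auto simp: bij_betw_def)
    then show ?thesis using True by (simp add: dot_square_norm)
  next
    case False
    then have "q i \<noteq> q j" using q that by (auto simp: bij_betw_def inj_on_def)
    moreover have "q i \<in> B" "q j \<in> B" using q that by (auto simp: bij_betw_def)
    ultimately show ?thesis using B(2) False by (auto simp: pairwise_def orthogonal_def)
  qed
  moreover have "span (q ` {..<d}) = T" using q B(6) by (simp add: bij_betw_def)
  ultimately have "orthonormal_basis d T q" unfolding orthonormal_basis_def by blast
  then show ?thesis by blast
qed

text \<open>Eliminates the basis chosen by \<open>SOME\<close>: the right-hand side is an explicit
  function of \<open>A\<close> and \<open>S\<close>.\<close>

lemma tangential_jacobian_eq:
  assumes S: "S \<in> grassmannian d" and f: "(f has_derivative A) (at x)"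
  shows "tangential_jacobian d f x S = sqrt (det (gram_matrix A S))"
proof -
  have fd: "frechet_derivative f (at x) = A" using f by (simp add: frechet_derivative_at[symmetric])
  have "\<exists>q. orthonormal_basis d (plane S) q"
    using S subspace_plane by (intro orthonormal_basis_exists) (auto simp: grassmannian_iff)
  then have "orthonormal_basis d (plane S) (SOME s. orthonormal_basis d (plane S) s)"
    by (rule someI_ex)
  moreover have "orthogonal_projection S" using S by (simp add: grassmannian_iff)
  moreover have "linear A" using f by (rule has_derivative_linear)
  ultimately show ?thesis
    unfolding tangential_jacobian_def Let_def fd
    by (subst gram_det_eq_det_gram_matrix) auto
qed

section \<open>Determinants close to the identity\<close>

lemma prod_one_plus_bounds:
  fixes e :: "'a \<Rightarrow> real"
  assumes "finite A" "\<And>i. i \<in> A \<Longrightarrow> \<bar>e i\<bar> \<le> \<delta>" "0 \<le> \<delta>" "\<delta> \<le> 1"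
  shows "\<bar>\<Prod>i\<in>A. 1 + e i\<bar> \<le> 2 ^ card A \<and> \<bar>(\<Prod>i\<in>A. 1 + e i) - 1\<bar> \<le> 2 ^ card A * \<delta>
    \<and> \<bar>(\<Prod>i\<in>A. 1 + e i) - 1 - (\<Sum>i\<in>A. e i)\<bar> \<le> 2 ^ card A * \<delta>\<^sup>2"
  using assms(1,2)
proof (induction A rule: finite_induct)
  case empty
  then show ?case using assms by simp
next
  case (insert a A)
  define P where "P = (\<Prod>i\<in>A. 1 + e i)"
  define N where "N = (2::real) ^ card A"
  \<comment> \<open>The three bounds are proved together because each order uses the previous one:
    the first-order error needs the size of \<open>P\<close>, the second-order error needs
    \<open>P - 1\<close>.\<close>
  have IH: "\<bar>P\<bar> \<le> N" "\<bar>P - 1\<bar> \<le> N * \<delta>" "\<bar>P - 1 - (\<Sum>i\<in>A. e i)\<bar> \<le> N * \<delta>\<^sup>2"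
    using insert unfolding P_def N_def by auto
  have ea: "\<bar>e a\<bar> \<le> \<delta>" using insert by simp
  have "\<bar>e a * P\<bar> \<le> \<delta> * N" unfolding abs_mult using ea IH(1) assms by (intro mult_mono) auto
  moreover have "\<delta> * N \<le> 1 * N" using assms by (intro mult_right_mono) (auto simp: N_def)
  moreover have "\<bar>e a * (P - 1)\<bar> \<le> \<delta> * (N * \<delta>)"
    unfolding abs_mult using ea IH(2) assms by (intro mult_mono) auto
  moreover have "(1 + e a) * P = P + e a * P"
      "(1 + e a) * P - 1 - (e a + (\<Sum>i\<in>A. e i)) = (P - 1 - (\<Sum>i\<in>A. e i)) + e a * (P - 1)"
      "\<delta> * (N * \<delta>) = N * \<delta>\<^sup>2" "\<delta> * N = N * \<delta>"
    by (simp_all add: algebra_simps power2_eq_square)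
  ultimately have "\<bar>(1 + e a) * P\<bar> \<le> 2 * N \<and> \<bar>(1 + e a) * P - 1\<bar> \<le> 2 * (N * \<delta>)
    \<and> \<bar>(1 + e a) * P - 1 - (e a + (\<Sum>i\<in>A. e i))\<bar> \<le> 2 * (N * \<delta>\<^sup>2)"
    using IH by (intro conjI) linarith+
  then show ?case
    using insert.hyps by (simp add: P_def[symmetric] N_def[symmetric] mult.assoc)
qed

text \<open>A crude common constant: it dominates the Lipschitz constant of \<open>det\<close> on
  matrices with entries at most 2, the second-order remainder at the identity, and the
  dimension.\<close>

definition det_const :: "nat \<Rightarrow> real" where
  "det_const n = 4 * fact n * 2 ^ n * real n"

lemma det_const_ge:
  assumes "n > 0"
  shows "det_const n \<ge> real n" "det_const n \<ge> 1" "det_const n \<ge> 2 ^ n + fact n * 2 ^ n"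
    "det_const n \<ge> fact n * (2 ^ n * real n)"
proof -
  have f: "(1::real) \<le> fact n" by (rule fact_ge_1)
  have p: "(1::real) \<le> 2 ^ n" by simp
  have n: "(1::real) \<le> real n" using assms by simp
  have fp: "1 * 1 \<le> fact n * (2::real) ^ n" using f p by (intro mult_mono) auto
  have fpn: "1 * real n \<le> (fact n * 2 ^ n) * real n" using fp n by (intro mult_right_mono) auto
  show "det_const n \<ge> real n" using fpn n unfolding det_const_def by simp
  then show "det_const n \<ge> 1" using n by simp
  have "fact n * (2::real) ^ n * 1 \<le> fact n * 2 ^ n * real n"
    using n fp by (intro mult_left_mono) auto
  moreover have "1 * (2::real) ^ n \<le> fact n * 2 ^ n" using f by (intro mult_right_mono) auto
  ultimately show "det_const n \<ge> 2 ^ n + fact n * 2 ^ n"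
    unfolding det_const_def using fpn n by linarith
  show "det_const n \<ge> fact n * (2 ^ n * real n)"
    using fpn n unfolding det_const_def by (simp add: mult.assoc)
qed

lemma card_pos_UNIV: "CARD('n::finite) > 0"
  by simp

text \<open>Term by term in the Leibniz formula. Entries are halved so that they lie in the unit
  ball, where a difference of products is at most the sum of the differences of the factors; this
  costs \<open>2 ^ n\<close>.\<close>

lemma det_diff_le:
  fixes X Y :: "real^'n^'n"
  assumes X: "\<And>i j. \<bar>X $ i $ j\<bar> \<le> 2" and Y: "\<And>i j. \<bar>Y $ i $ j\<bar> \<le> 2"
    and XY: "\<And>i j. \<bar>X $ i $ j - Y $ i $ j\<bar> \<le> \<delta>"
  shows "\<bar>det X - det Y\<bar> \<le> det_const CARD('n) * \<delta>"
proof -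
  let ?P = "{p. p permutes (UNIV :: 'n set)}"
  have \<delta>: "0 \<le> \<delta>" using XY order_trans abs_ge_zero by blast
  have t: "\<bar>(\<Prod>i\<in>UNIV. X $ i $ p i) - (\<Prod>i\<in>UNIV. Y $ i $ p i)\<bar> \<le> 2 ^ CARD('n) * real CARD('n) * \<delta>"
    for p :: "'n \<Rightarrow> 'n"
  proof -
    have r: "(\<Prod>i\<in>UNIV. Z $ i $ p i) = 2 ^ CARD('n) * (\<Prod>i\<in>UNIV. Z $ i $ p i / 2)"
      for Z :: "real^'n^'n" by (simp add: prod_dividef)
    have "\<bar>(\<Prod>i\<in>UNIV. X $ i $ p i / 2) - (\<Prod>i\<in>UNIV. Y $ i $ p i / 2)\<bar>
        \<le> (\<Sum>i\<in>UNIV. norm (X $ i $ p i / 2 - Y $ i $ p i / 2))"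
      using norm_prod_diff[of UNIV "\<lambda>i. X $ i $ p i / 2" "\<lambda>i. Y $ i $ p i / 2"] X Y by simp
    also have "\<dots> \<le> (\<Sum>i\<in>(UNIV :: 'n set). \<delta>)"
    proof (rule sum_mono)
      fix i show "norm (X $ i $ p i / 2 - Y $ i $ p i / 2) \<le> \<delta>"
        using XY[of i "p i"] \<delta> by (simp add: diff_divide_distrib[symmetric])
    qed
    finally have "2 ^ CARD('n) * \<bar>(\<Prod>i\<in>UNIV. X $ i $ p i / 2) - (\<Prod>i\<in>UNIV. Y $ i $ p i / 2)\<bar>
        \<le> 2 ^ CARD('n) * (real CARD('n) * \<delta>)" by simp
    then show ?thesis unfolding r[of X] r[of Y] right_diff_distrib[symmetric] abs_mult
      by (simp add: mult.assoc)
  qed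
  have "\<bar>det X - det Y\<bar> = \<bar>\<Sum>p\<in>?P. of_int (sign p) * ((\<Prod>i\<in>UNIV. X $ i $ p i) - (\<Prod>i\<in>UNIV. Y $ i $ p i))\<bar>"
    by (simp add: det_def sum_subtractf right_diff_distrib)
  also have "\<dots> \<le> (\<Sum>p\<in>?P. \<bar>of_int (sign p) * ((\<Prod>i\<in>UNIV. X $ i $ p i) - (\<Prod>i\<in>UNIV. Y $ i $ p i))\<bar>)"
    by (rule sum_abs)
  also have "\<dots> \<le> (\<Sum>p\<in>?P. 2 ^ CARD('n) * real CARD('n) * \<delta>)"
  proof (rule sum_mono)
    fix p :: "'n \<Rightarrow> 'n"
    have "\<bar>real_of_int (sign p)\<bar> = 1" by (simp flip: of_int_abs)
    then show "\<bar>of_int (sign p) * ((\<Prod>i\<in>UNIV. X $ i $ p i) - (\<Prod>i\<in>UNIV. Y $ i $ p i))\<bar>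
        \<le> 2 ^ CARD('n) * real CARD('n) * \<delta>"
      using t[of p] by (simp add: abs_mult)
  qed
  also have "\<dots> = (fact CARD('n) * (2 ^ CARD('n) * real CARD('n))) * \<delta>"
    by (simp add: card_permutations)
  also have "\<dots> \<le> det_const CARD('n) * \<delta>"
    by (intro mult_right_mono det_const_ge(4) \<delta>) simp
  finally show ?thesis .
qed

text \<open>The identity permutation contributes the product of the diagonal. Every other
  permutation moves at least two indices, hence picks two off-diagonal entries of size at most
  \<open>\<delta>\<close>.\<close>

lemma det_one_plus_expansion:
  fixes E :: "real^'n^'n"
  assumes E: "\<And>i j. \<bar>E $ i $ j\<bar> \<le> \<delta>" and \<delta>: "\<delta> \<le> 1"
  shows "\<bar>det (mat 1 + E) - 1 - (\<Sum>k\<in>UNIV. E $ k $ k)\<bar> \<le> det_const CARD('n) * \<delta>\<^sup>2"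
proof -
  let ?P = "{p. p permutes (UNIV :: 'n set)}"
  let ?M = "mat 1 + E"
  have \<delta>0: "0 \<le> \<delta>" using E order_trans abs_ge_zero by blast
  have fin: "finite ?P" by (simp add: finite_permutations)
  have M2: "\<bar>?M $ i $ j\<bar> \<le> 2" for i j
    using E[of i j] \<delta> by (auto simp: mat_def)
  have t: "\<bar>\<Prod>i\<in>UNIV. ?M $ i $ p i\<bar> \<le> 2 ^ CARD('n) * \<delta>\<^sup>2" if p: "p \<in> ?P - {id}" for p
  proof -
    \<comment> \<open>The second moved index is \<open>p i\<close>: it is not fixed either, by
      injectivity of \<open>p\<close>.\<close>
    obtain i where i: "p i \<noteq> i" using p by (auto simp: fun_eq_iff)
    define j where "j = p i"
    have inj: "inj p" using p by (auto dest: permutes_inj)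
    have ij: "i \<noteq> j" using i by (simp add: j_def)
    have j: "p j \<noteq> j" using i inj unfolding j_def by (auto dest: injD)
    have "(\<Prod>k\<in>UNIV. ?M $ k $ p k) = ?M $ i $ p i * (?M $ j $ p j * (\<Prod>k\<in>UNIV - {i} - {j}. ?M $ k $ p k))"
      using ij by (subst prod.remove[of _ i], simp, simp, subst prod.remove[of _ j]) auto
    also have "\<bar>\<dots>\<bar> = \<bar>?M $ i $ p i\<bar> * (\<bar>?M $ j $ p j\<bar> * (\<Prod>k\<in>UNIV - {i} - {j}. \<bar>?M $ k $ p k\<bar>))"
      by (simp add: abs_mult abs_prod)
    also have "\<dots> \<le> \<delta> * (\<delta> * (\<Prod>k\<in>UNIV - {i} - {j}. 2))"
    proof (intro mult_mono prod_mono conjI)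
      show "\<bar>?M $ i $ p i\<bar> \<le> \<delta>" using i E[of i "p i"] by (simp add: mat_def)
      show "\<bar>?M $ j $ p j\<bar> \<le> \<delta>" using j E[of j "p j"] by (simp add: mat_def)
    qed (use M2 \<delta>0 in \<open>auto intro!: prod_nonneg mult_nonneg_nonneg\<close>)
    also have "\<dots> = \<delta>\<^sup>2 * 2 ^ card (UNIV - {i} - {j})" by (simp add: power2_eq_square)
    also have "\<dots> \<le> \<delta>\<^sup>2 * 2 ^ CARD('n)"
      by (intro mult_left_mono power_increasing card_mono) auto
    finally show ?thesis by (simp add: mult.commute)
  qed
  have "det ?M = (\<Prod>i\<in>UNIV. ?M $ i $ i) + (\<Sum>p\<in>?P - {id}. of_int (sign p) * (\<Prod>i\<in>UNIV. ?M $ i $ p i))"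
    unfolding det_def using fin by (subst sum.remove[of _ id]) (auto simp: permutes_id)
  moreover have "\<bar>(\<Prod>i\<in>UNIV. ?M $ i $ i) - 1 - (\<Sum>k\<in>UNIV. E $ k $ k)\<bar> \<le> 2 ^ CARD('n) * \<delta>\<^sup>2"
    using prod_one_plus_bounds[of UNIV "\<lambda>i. E $ i $ i" \<delta>] E \<delta> \<delta>0 by (simp add: mat_def)
  moreover have "\<bar>\<Sum>p\<in>?P - {id}. of_int (sign p) * (\<Prod>i\<in>UNIV. ?M $ i $ p i)\<bar>
      \<le> fact CARD('n) * 2 ^ CARD('n) * \<delta>\<^sup>2"
  proof -
    have "\<bar>\<Sum>p\<in>?P - {id}. of_int (sign p) * (\<Prod>i\<in>UNIV. ?M $ i $ p i)\<bar>
      \<le> (\<Sum>p\<in>?P - {id}. \<bar>of_int (sign p) * (\<Prod>i\<in>UNIV. ?M $ i $ p i)\<bar>)"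
      by (rule sum_abs)
    also have "\<dots> \<le> (\<Sum>p\<in>?P - {id}. 2 ^ CARD('n) * \<delta>\<^sup>2)"
    proof (rule sum_mono)
      fix p assume p: "p \<in> ?P - {id}"
      have "\<bar>real_of_int (sign p)\<bar> = 1" by (simp flip: of_int_abs)
      then show "\<bar>of_int (sign p) * (\<Prod>i\<in>UNIV. ?M $ i $ p i)\<bar> \<le> 2 ^ CARD('n) * \<delta>\<^sup>2"
        using t[OF p] by (simp add: abs_mult)
    qed
    also have "\<dots> \<le> (\<Sum>p\<in>?P. 2 ^ CARD('n) * \<delta>\<^sup>2)"
      by (rule sum_mono2[OF fin]) auto
    also have "\<dots> = fact CARD('n) * 2 ^ CARD('n) * \<delta>\<^sup>2" by (simp add: card_permutations)
    finally show ?thesis .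
  qed
  ultimately have "\<bar>det ?M - 1 - (\<Sum>k\<in>UNIV. E $ k $ k)\<bar> \<le> (2 ^ CARD('n) + fact CARD('n) * 2 ^ CARD('n)) * \<delta>\<^sup>2"
    by (simp add: algebra_simps)
  also have "\<dots> \<le> det_const CARD('n) * \<delta>\<^sup>2"
    by (intro mult_right_mono det_const_ge(3)) auto
  finally show ?thesis .
qed

section \<open>The tangential Jacobian of \<open>id + s L\<close>, written without a choice of
  basis\<close>

definition jac :: "real \<Rightarrow> (real^'n \<Rightarrow> real^'n) \<Rightarrow> real^'n^'n \<Rightarrow> real" where
  "jac s L S = sqrt (det (gram_matrix (\<lambda>v. v + s *\<^sub>R L v) S))"

text \<open>The inner products of \<open>S *v axis k 1\<close> and \<open>S *v axis l 1\<close>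
  cancel. No zeroth-order dependence on \<open>S\<close> is left, so everything but the identity
  carries a factor \<open>s\<close>.\<close>

lemma gram_matrix_entry:
  "gram_matrix (\<lambda>v. v + s *\<^sub>R L v) S $ k $ l = (if k = l then 1 else 0)
     + (s * (L (S *v axis k 1) \<bullet> (S *v axis l 1) + (S *v axis k 1) \<bullet> L (S *v axis l 1))
     + s\<^sup>2 * (L (S *v axis k 1) \<bullet> L (S *v axis l 1)))"
  by (simp add: gram_matrix_def inner_add_left inner_add_right power2_eq_square algebra_simps)

lemma norm_proj_axis:
  assumes "orthogonal_projection S"
  shows "norm (S *v axis k (1::real)) \<le> 1"
  using orthogonal_projection_norm_le[OF assms, of "axis k 1"] by (simp add: norm_axis_1)

lemma inner_le_mult:
  fixes a b :: "real^'n"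
  assumes "norm a \<le> x" "norm b \<le> y"
  shows "\<bar>a \<bullet> b\<bar> \<le> x * y"
proof -
  have "\<bar>a \<bullet> b\<bar> \<le> norm a * norm b" by (rule Cauchy_Schwarz_ineq2)
  also have "\<dots> \<le> x * y" using assms norm_ge_zero[of a] by (intro mult_mono) (auto intro: order_trans[OF norm_ge_zero])
  finally show ?thesis .
qed

context
  fixes s \<kappa> :: real
  assumes s: "0 \<le> s" "s * \<kappa> \<le> 1" and \<kappa>: "0 \<le> \<kappa>"
begin

lemma gram_matrix_perturbation:
  assumes S: "orthogonal_projection S" and L: "\<And>v. norm (L v) \<le> \<kappa> * norm v"
  shows "\<bar>gram_matrix (\<lambda>v. v + s *\<^sub>R L v) S $ k $ l - (if k = l then 1 else 0)\<bar> \<le> 3 * (s * \<kappa>)"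
proof -
  let ?a = "S *v axis k 1" and ?b = "S *v axis l 1"
  have a: "norm ?a \<le> 1" "norm ?b \<le> 1" by (intro norm_proj_axis S)+
  have La: "norm (L ?a) \<le> \<kappa>" "norm (L ?b) \<le> \<kappa>"
    using L[of ?a] L[of ?b] mult_left_mono[OF a(1) \<kappa>] mult_left_mono[OF a(2) \<kappa>] by auto
  have 1: "\<bar>L ?a \<bullet> ?b + ?a \<bullet> L ?b\<bar> \<le> 2 * \<kappa>"
    using inner_le_mult[OF La(1) a(2)] inner_le_mult[OF a(1) La(2)] by simp
  have 2: "\<bar>L ?a \<bullet> L ?b\<bar> \<le> \<kappa> * \<kappa>" using inner_le_mult[OF La(1) La(2)] .
  have 3: "\<bar>s * (L ?a \<bullet> ?b + ?a \<bullet> L ?b)\<bar> \<le> s * (2 * \<kappa>)"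
    unfolding abs_mult using 1 s by (intro mult_mono) auto
  have 4: "\<bar>s\<^sup>2 * (L ?a \<bullet> L ?b)\<bar> \<le> s\<^sup>2 * (\<kappa> * \<kappa>)"
    unfolding abs_mult using 2 s by (intro mult_mono) auto
  have "s\<^sup>2 * (\<kappa> * \<kappa>) = (s * \<kappa>) * (s * \<kappa>)" by (simp add: power2_eq_square)
  also have "\<dots> \<le> 1 * (s * \<kappa>)" using s \<kappa> by (intro mult_right_mono) auto
  finally show ?thesis using 3 4 unfolding gram_matrix_entry by simp
qed

text \<open>The identity parts cancel and the rest is telescoped bilinearly. The bound is
  proportional to \<open>s\<close>; this is the source of the \<open>O(s)\<close> Lipschitz constant
  of the Jacobian in point and plane.\<close>

lemma gram_matrix_diff:
  assumes S: "orthogonal_projection S" and T: "orthogonal_projection T"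
    and L: "\<And>v. norm (L v) \<le> \<kappa> * norm v" and K: "\<And>v. norm (K v) \<le> \<kappa> * norm v"
    and lin: "linear K"
    and LK: "\<And>v. norm (L v - K v) \<le> q * norm v"
    and ST: "\<And>v. norm ((S - T) *v v) \<le> c * norm v"
  shows "\<bar>gram_matrix (\<lambda>v. v + s *\<^sub>R L v) S $ k $ l - gram_matrix (\<lambda>v. v + s *\<^sub>R K v) T $ k $ l\<bar>
    \<le> 6 * s * (q + \<kappa> * c)"
proof -
  let ?a = "S *v axis k 1" and ?b = "S *v axis l 1" and ?a' = "T *v axis k 1" and ?b' = "T *v axis l 1"
  have q: "0 \<le> q" 
    using order_trans[OF norm_ge_zero LK[of "axis undefined 1"]] by (simp add: norm_axis_1)
  have c: "0 \<le> c" 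
    using order_trans[OF norm_ge_zero ST[of "axis undefined 1"]] by (simp add: norm_axis_1)
  have a: "norm ?a \<le> 1" "norm ?b \<le> 1" "norm ?a' \<le> 1" "norm ?b' \<le> 1"
    by (intro norm_proj_axis S T)+
  have bd: "norm (L v) \<le> \<kappa>" "norm (K v) \<le> \<kappa>" if "norm v \<le> 1" for v
    using L[of v] K[of v] mult_left_mono[OF that \<kappa>] by auto
  have d: "norm (?a - ?a') \<le> c" "norm (?b - ?b') \<le> c"
    using ST[of "axis k 1"] ST[of "axis l 1"]
    by (simp_all add: matrix_vector_mult_diff_rdistrib norm_axis_1)
  have Ld: "norm (L u - K v) \<le> q + \<kappa> * c" if "norm u \<le> 1" "norm (u - v) \<le> c" for u v
  proof -
    have "L u - K v = (L u - K u) + K (u - v)" by (simp add: linear_diff[OF lin])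
    moreover have "norm (L u - K u) \<le> q" using LK[of u] mult_left_mono[OF that(1) q] by simp
    moreover have "norm (K (u - v)) \<le> \<kappa> * c"
      using K[of "u - v"] mult_left_mono[OF that(2) \<kappa>] by simp
    ultimately show ?thesis by (metis norm_triangle_mono)
  qed
  define r where "r = q + \<kappa> * c"
  have r: "0 \<le> r" "\<kappa> * c \<le> r" unfolding r_def using q \<kappa> c by auto
  have La: "norm (L ?a - K ?a') \<le> r" "norm (L ?b - K ?b') \<le> r"
    unfolding r_def using Ld a d by auto
  have 1: "\<bar>L ?a \<bullet> ?b - K ?a' \<bullet> ?b'\<bar> \<le> 2 * r"
  proof -
    have "L ?a \<bullet> ?b - K ?a' \<bullet> ?b' = (L ?a - K ?a') \<bullet> ?b + K ?a' \<bullet> (?b - ?b')"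
      by (simp add: inner_diff_left inner_diff_right)
    then show ?thesis
      using inner_le_mult[OF La(1) a(2)] inner_le_mult[OF bd(2)[OF a(3)] d(2)] r by simp
  qed
  have 2: "\<bar>?a \<bullet> L ?b - ?a' \<bullet> K ?b'\<bar> \<le> 2 * r"
  proof -
    have "?a \<bullet> L ?b - ?a' \<bullet> K ?b' = ?a \<bullet> (L ?b - K ?b') + (?a - ?a') \<bullet> K ?b'"
      by (simp add: inner_diff_left inner_diff_right)
    then show ?thesis
      using inner_le_mult[OF a(1) La(2)] inner_le_mult[OF d(1) bd(2)[OF a(4)]] r by (simp add: mult.commute)
  qed
  have 3: "\<bar>L ?a \<bullet> L ?b - K ?a' \<bullet> K ?b'\<bar> \<le> 2 * (\<kappa> * r)"
  proof -
    have "L ?a \<bullet> L ?b - K ?a' \<bullet> K ?b' = (L ?a - K ?a') \<bullet> L ?b + K ?a' \<bullet> (L ?b - K ?b')"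
      by (simp add: inner_diff_left inner_diff_right)
    then show ?thesis
      using inner_le_mult[OF La(1) bd(1)[OF a(2)]] inner_le_mult[OF bd(2)[OF a(3)] La(2)]
      by (simp add: mult.commute)
  qed
  have 4: "\<bar>s * ((L ?a \<bullet> ?b - K ?a' \<bullet> ?b') + (?a \<bullet> L ?b - ?a' \<bullet> K ?b'))\<bar> \<le> s * (4 * r)"
    unfolding abs_mult using 1 2 s by (intro mult_mono) auto
  have 5: "\<bar>s\<^sup>2 * (L ?a \<bullet> L ?b - K ?a' \<bullet> K ?b')\<bar> \<le> s\<^sup>2 * (2 * (\<kappa> * r))"
    unfolding abs_mult using 3 s by (intro mult_mono) auto
  have "s\<^sup>2 * (2 * (\<kappa> * r)) = (s * \<kappa>) * (2 * s * r)" by (simp add: power2_eq_square)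
  also have "\<dots> \<le> 1 * (2 * s * r)" using s r by (intro mult_right_mono) auto
  finally have "s\<^sup>2 * (2 * (\<kappa> * r)) \<le> 2 * s * r" by simp
  moreover have "gram_matrix (\<lambda>v. v + s *\<^sub>R L v) S $ k $ l - gram_matrix (\<lambda>v. v + s *\<^sub>R K v) T $ k $ l
     = s * ((L ?a \<bullet> ?b - K ?a' \<bullet> ?b') + (?a \<bullet> L ?b - ?a' \<bullet> K ?b'))
       + s\<^sup>2 * (L ?a \<bullet> L ?b - K ?a' \<bullet> K ?b')"
    unfolding gram_matrix_entry by (simp add: algebra_simps)
  ultimately show ?thesis using 4 5 unfolding r_def[symmetric] by simp
qed

end

context
  fixes s \<kappa> :: real and L :: "real^'n \<Rightarrow> real^'n" and S :: "real^'n^'n"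
  assumes s: "0 \<le> s" "6 * det_const CARD('n) * (s * \<kappa>) \<le> 1" and \<kappa>: "0 \<le> \<kappa>"
    and S: "orthogonal_projection S"
    and L: "\<And>v. norm (L v) \<le> \<kappa> * norm v"
begin

lemma perturbation_small: "3 * (s * \<kappa>) \<le> 1"
proof -
  have "1 * (s * \<kappa>) \<le> det_const CARD('n) * (s * \<kappa>)"
    using s \<kappa> by (intro mult_right_mono det_const_ge(2)) auto
  moreover have "0 \<le> s * \<kappa>" using s \<kappa> by simp
  ultimately show ?thesis using s(2) by linarith
qed

lemma gram_matrix_le_2: "\<bar>gram_matrix (\<lambda>v. v + s *\<^sub>R L v) S $ k $ l\<bar> \<le> 2"
  using gram_matrix_perturbation[OF s(1) _ \<kappa> S L, of k l] perturbation_small s(1) \<kappa>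
  by (auto split: if_splits simp: abs_le_iff)

lemma abs_det_gram_matrix_minus_1:
  "\<bar>det (gram_matrix (\<lambda>v. v + s *\<^sub>R L v) S) - 1\<bar> \<le> 3 * det_const CARD('n) * (s * \<kappa>)"
proof -
  have sk: "s * \<kappa> \<le> 1" using perturbation_small s \<kappa> by simp
  have "\<bar>det (gram_matrix (\<lambda>v. v + s *\<^sub>R L v) S) - det (mat 1 :: real^'n^'n)\<bar>
     \<le> det_const CARD('n) * (3 * (s * \<kappa>))"
    by (rule det_diff_le)
      (use gram_matrix_le_2 gram_matrix_perturbation[OF s(1) sk \<kappa> S L] in \<open>auto simp: mat_def\<close>)
  then show ?thesis by simp
qed

text \<open>The factor 6 in the smallness hypothesis is chosen for this bound, which keeps the
  square root in \<open>jac\<close> away from its singularity at 0.\<close>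

lemma det_gram_matrix_ge: "1 / 2 \<le> det (gram_matrix (\<lambda>v. v + s *\<^sub>R L v) S)"
  using abs_det_gram_matrix_minus_1 s(2) by linarith

lemma jac_nonneg: "0 \<le> jac s L S"
  using det_gram_matrix_ge by (simp add: jac_def)

lemma jac_ge_half: "1 / 2 \<le> jac s L S"
  unfolding jac_def using det_gram_matrix_ge by (intro real_le_rsqrt) (simp add: power2_eq_square)

lemma jac_le: "jac s L S \<le> 1 + 3 * det_const CARD('n) * (s * \<kappa>)"
proof -
  let ?D = "det (gram_matrix (\<lambda>v. v + s *\<^sub>R L v) S)"
  define a where "a = 3 * det_const CARD('n) * (s * \<kappa>)"
  have a: "0 \<le> a"
    using det_const_ge(2)[OF card_pos_UNIV[where 'n='n]] s \<kappa> by (simp add: a_def)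
  have "?D \<le> 1 + a" using abs_det_gram_matrix_minus_1 by (simp add: a_def)
  also have "\<dots> \<le> (1 + a)\<^sup>2"
    using a by (simp add: power2_eq_square algebra_simps)
  finally show ?thesis unfolding jac_def a_def[symmetric] using a by (intro real_le_lsqrt) auto
qed

text \<open>For linear \<open>L\<close> the sum is the trace of \<open>L\<close> along the plane,
  that is, the tangential divergence. The bound is one-sided, which suffices to control mass from
  above.\<close>

lemma jac_expansion_le:
  "jac s L S \<le> 1 + s * (\<Sum>k\<in>UNIV. L (S *v axis k 1) \<bullet> (S *v axis k 1)) + 5 * det_const CARD('n) * (s * \<kappa>)\<^sup>2"
proof -
  let ?G = "gram_matrix (\<lambda>v. v + s *\<^sub>R L v) S"
  define E where "E = ?G - mat 1"
  define \<sigma> where "\<sigma> = (\<Sum>k\<in>UNIV. L (S *v axis k 1) \<bullet> (S *v axis k 1))"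
  have sk: "s * \<kappa> \<le> 1" using perturbation_small s \<kappa> by simp
  have E: "\<bar>E $ k $ l\<bar> \<le> 3 * (s * \<kappa>)" for k l
    using gram_matrix_perturbation[OF s(1) sk \<kappa> S L, of k l] by (simp add: E_def mat_def)
  have G: "?G = mat 1 + E" by (simp add: E_def)
  have Ekk: "E $ k $ k \<le> 2 * s * (L (S *v axis k 1) \<bullet> (S *v axis k 1)) + (s * \<kappa>)\<^sup>2" for k
  proof -
    have "L (S *v axis k 1) \<bullet> L (S *v axis k 1) \<le> \<kappa>\<^sup>2"
    proof -
      have "norm (L (S *v axis k 1)) \<le> \<kappa>"
        using L[of "S *v axis k 1"] mult_left_mono[OF norm_proj_axis[OF S, of k] \<kappa>] s sk \<kappa> by simp
      then show ?thesis unfolding power2_norm_eq_inner[symmetric] by (intro power_mono) auto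
    qed
    then have "s\<^sup>2 * (L (S *v axis k 1) \<bullet> L (S *v axis k 1)) \<le> s\<^sup>2 * \<kappa>\<^sup>2" by (intro mult_left_mono) auto
    then show ?thesis
      using gram_matrix_entry[of s L S k k]
      by (simp add: E_def mat_def power_mult_distrib inner_commute)
  qed
  have "(\<Sum>k\<in>UNIV. E $ k $ k) \<le> (\<Sum>k\<in>UNIV. 2 * s * (L (S *v axis k 1) \<bullet> (S *v axis k 1)) + (s * \<kappa>)\<^sup>2)"
    by (intro sum_mono Ekk)
  also have "\<dots> = 2 * s * \<sigma> + real CARD('n) * (s * \<kappa>)\<^sup>2"
    by (simp add: \<sigma>_def sum.distrib sum_distrib_left)
  also have "\<dots> \<le> 2 * s * \<sigma> + det_const CARD('n) * (s * \<kappa>)\<^sup>2"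
    by (intro add_left_mono mult_right_mono det_const_ge(1)) auto
  finally have tr: "(\<Sum>k\<in>UNIV. E $ k $ k) \<le> 2 * s * \<sigma> + det_const CARD('n) * (s * \<kappa>)\<^sup>2" .
  have "det ?G - 1 - (\<Sum>k\<in>UNIV. E $ k $ k) \<le> det_const CARD('n) * (3 * (s * \<kappa>))\<^sup>2"
    using det_one_plus_expansion[OF E perturbation_small] unfolding G by linarith
  \<comment> \<open>The 10 is 9, from the determinant expansion with entries of size
    \<open>3 s \<kappa>\<close>, plus 1 from the quadratic part of the trace; it is halved
    below.\<close>
  then have D: "det ?G \<le> 1 + 2 * s * \<sigma> + 10 * det_const CARD('n) * (s * \<kappa>)\<^sup>2"
    using tr by (simp add: power_mult_distrib)
  \<comment> \<open>The arithmetic-geometric mean inequality takes the place of a Taylor expansion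
    of the square root.\<close>
  have "jac s L S \<le> (1 + det ?G) / 2"
    unfolding jac_def using arith_geo_mean_sqrt[of 1 "det ?G"] det_gram_matrix_ge by simp
  then show ?thesis using D unfolding \<sigma>_def[symmetric] by simp
qed

end

text \<open>The difference of the square roots is the difference of the determinants divided by the
  sum of the roots, and that sum is at least 1.\<close>

lemma jac_diff_le:
  fixes L K :: "real^'n \<Rightarrow> real^'n"
  assumes s: "0 \<le> s" "6 * det_const CARD('n) * (s * \<kappa>) \<le> 1" and \<kappa>: "0 \<le> \<kappa>"
    and S: "orthogonal_projection S" and T: "orthogonal_projection T"
    and L: "\<And>v. norm (L v) \<le> \<kappa> * norm v" and K: "\<And>v. norm (K v) \<le> \<kappa> * norm v"
    and lin: "linear K"
    and LK: "\<And>v. norm (L v - K v) \<le> q * norm v"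
    and ST: "\<And>v. norm ((S - T) *v v) \<le> c * norm v"
  shows "\<bar>jac s L S - jac s K T\<bar> \<le> 6 * det_const CARD('n) * s * (q + \<kappa> * c)"
proof -
  let ?G = "gram_matrix (\<lambda>v. v + s *\<^sub>R L v) S" and ?H = "gram_matrix (\<lambda>v. v + s *\<^sub>R K v) T"
  have sk: "s * \<kappa> \<le> 1"
    using perturbation_small[OF s \<kappa> S L] s \<kappa> by simp
  have 1: "\<bar>det ?G - det ?H\<bar> \<le> det_const CARD('n) * (6 * s * (q + \<kappa> * c))"
    by (rule det_diff_le[OF gram_matrix_le_2[OF s \<kappa> S L] gram_matrix_le_2[OF s \<kappa> T K]
        gram_matrix_diff[OF s(1) sk \<kappa> S T L K lin LK ST]])
  have 2: "1 / 2 \<le> jac s L S" "1 / 2 \<le> jac s K T"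
    using jac_ge_half[OF s \<kappa> S L] jac_ge_half[OF s \<kappa> T K] by auto
  have "det ?G - det ?H = (jac s L S - jac s K T) * (jac s L S + jac s K T)"
    using det_gram_matrix_ge[OF s \<kappa> S L] det_gram_matrix_ge[OF s \<kappa> T K]
    by (simp add: jac_def algebra_simps flip: power2_eq_square)
  then have "\<bar>det ?G - det ?H\<bar> = \<bar>jac s L S - jac s K T\<bar> * (jac s L S + jac s K T)"
    using 2 by (simp add: abs_mult)
  moreover have "\<bar>jac s L S - jac s K T\<bar> * 1 \<le> \<bar>jac s L S - jac s K T\<bar> * (jac s L S + jac s K T)"
    using 2 by (intro mult_left_mono) auto
  ultimately show ?thesis using 1 by (simp add: mult_ac)
qed

subsection \<open>Bounded Lipschitz distance\<close>

type_synonym 'n vmeasure = "((real^'n) \<times> (real^'n^'n)) measure"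

text \<open>Finiteness on compact sets does not make bounded continuous test functions integrable;
  finite total mass does.\<close>

definition finite_varifold :: "nat \<Rightarrow> 'n::finite vmeasure \<Rightarrow> bool" where
  "finite_varifold d V \<longleftrightarrow> sets V = sets (varifold_space d) \<and> finite_measure V"

definition mass :: "'n::finite vmeasure \<Rightarrow> real" where
  "mass V = measure V (space V)"

lemma mass_nonneg: "0 \<le> mass V"
  by (simp add: mass_def)

lemma space_varifold_space: "space (varifold_space d) = UNIV \<times> grassmannian d"
  by (simp add: varifold_space_def space_restrict_space)

lemma space_finite_varifold: "sets V = sets (varifold_space d) \<Longrightarrow> space V = UNIV \<times> grassmannian d"
  using sets_eq_imp_space_eq space_varifold_space by metis

lemma measurable_varifold_continuous:
  assumes "sets V = sets (varifold_space d)" "continuous_on (UNIV \<times> grassmannian d) \<phi>"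
  shows "\<phi> \<in> borel_measurable V"
proof -
  have "\<phi> \<in> borel_measurable (varifold_space d)"
    unfolding varifold_space_def by (rule borel_measurable_continuous_on_restrict[OF assms(2)])
  then show ?thesis using measurable_cong_sets[OF assms(1) refl] by blast
qed

lemma integrable_finite_varifold:
  fixes \<phi> :: "_ \<Rightarrow> 'b::{banach, second_countable_topology}"
  assumes "finite_varifold d V" "continuous_on (UNIV \<times> grassmannian d) \<phi>"
    and "\<And>z. z \<in> UNIV \<times> grassmannian d \<Longrightarrow> norm (\<phi> z) \<le> B"
  shows "integrable V \<phi>"
proof -
  interpret finite_measure V using assms(1) by (simp add: finite_varifold_def)
  have s: "sets V = sets (varifold_space d)" using assms(1) by (simp add: finite_varifold_def)
  show ?thesis
    by (rule integrable_const_bound[of _ B])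
      (use assms(3) space_finite_varifold[OF s] measurable_varifold_continuous[OF s assms(2)] in auto)
qed

lemma norm_integral_finite_varifold_le:
  fixes \<phi> :: "_ \<Rightarrow> 'b::{banach, second_countable_topology}"
  assumes V: "finite_varifold d V" and c: "continuous_on (UNIV \<times> grassmannian d) \<phi>"
    and B: "\<And>z. z \<in> UNIV \<times> grassmannian d \<Longrightarrow> norm (\<phi> z) \<le> B"
  shows "norm (LINT z|V. \<phi> z) \<le> B * mass V"
proof -
  interpret finite_measure V using V by (simp add: finite_varifold_def)
  have s: "space V = UNIV \<times> grassmannian d"
    using V space_finite_varifold by (auto simp: finite_varifold_def)
  have i: "integrable V \<phi>" by (rule integrable_finite_varifold[OF V c B])
  have "norm (LINT z|V. \<phi> z) \<le> (LINT z|V. norm (\<phi> z))" by (rule integral_norm_bound)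
  also have "\<dots> \<le> (LINT z|V. B)"
    by (rule integral_mono) (use i B s in auto)
  finally have "norm (LINT z|V. \<phi> z) \<le> (LINT z|V. B)" .
  then show ?thesis by (simp add: mass_def mult.commute)
qed

lemma vdist_nonneg: "0 \<le> vdist z w"
  unfolding vdist_def by (intro add_nonneg_nonneg onorm_pos_le) auto

lemma vdist_ge_fst: "norm (fst z - fst w) \<le> vdist z w"
  unfolding vdist_def using onorm_pos_le[OF matrix_vector_mul_bounded_linear[of "snd z - snd w"]] by simp

lemma vdist_ge_snd: "onorm (\<lambda>v. (snd z - snd w) *v v) \<le> vdist z w"
  unfolding vdist_def by simp

lemma vdist_le_dist:
  fixes z w :: "(real^'n) \<times> (real^'n^'n)"
  shows "vdist z w \<le> (1 + real CARD('n) * real CARD('n)) * dist z w"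
proof -
  have "norm (fst z - fst w) \<le> dist z w" using dist_fst_le[of z w] by (simp add: dist_norm)
  moreover have "norm (snd z - snd w) \<le> dist z w" using dist_snd_le[of z w] by (simp add: dist_norm)
  then have "real CARD('n) * real CARD('n) * norm (snd z - snd w) \<le> real CARD('n) * real CARD('n) * dist z w"
    by (intro mult_left_mono) auto
  ultimately show ?thesis
    using onorm_matrix_le_norm[of "snd z - snd w"] unfolding vdist_def distrib_right by linarith
qed

text \<open>The bridge from Lipschitz estimates in \<open>vdist\<close> to the topology of the
  product type. Continuity, measurability and integrability of the integrands below are mostly
  obtained through it.\<close>

lemma continuous_on_vdist_lipschitz:
  fixes \<phi> :: "(real^'n) \<times> (real^'n^'n) \<Rightarrow> 'b::real_normed_vector"
  assumes "\<And>z w. z \<in> X \<Longrightarrow> w \<in> X \<Longrightarrow> norm (\<phi> z - \<phi> w) \<le> B * vdist z w" "0 \<le> B"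
  shows "continuous_on X \<phi>"
proof (rule lipschitz_on_continuous_on)
  show "(B * (1 + real CARD('n) * real CARD('n)))-lipschitz_on X \<phi>"
  proof (rule lipschitz_onI)
    fix z w assume "z \<in> X" "w \<in> X"
    then have "dist (\<phi> z) (\<phi> w) \<le> B * vdist z w" using assms(1) by (simp add: dist_norm)
    also have "\<dots> \<le> B * ((1 + real CARD('n) * real CARD('n)) * dist z w)"
      by (intro mult_left_mono vdist_le_dist assms)
    finally show "dist (\<phi> z) (\<phi> w) \<le> B * (1 + real CARD('n) * real CARD('n)) * dist z w"
      by (simp add: mult.assoc)
  qed (use assms(2) in simp)
qed

definition bl_test :: "nat \<Rightarrow> ((real^'n) \<times> (real^'n^'n) \<Rightarrow> real) set" where
  "bl_test d = {\<phi>. continuous_on (UNIV \<times> grassmannian d) \<phi> \<and>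
     (\<forall>z\<in>UNIV \<times> grassmannian d. 0 \<le> \<phi> z \<and> \<phi> z \<le> 1) \<and>
     (\<forall>z\<in>UNIV \<times> grassmannian d. \<forall>w\<in>UNIV \<times> grassmannian d. \<bar>\<phi> z - \<phi> w\<bar> \<le> vdist z w)}"

lemma varifold_bl_dist_eq:
  "varifold_bl_dist d V W = (SUP \<phi>\<in>bl_test d. \<bar>(LINT z|V. \<phi> z) - (LINT z|W. \<phi> z)\<bar>)"
  unfolding varifold_bl_dist_def bl_dist_def bl_test_def ..

lemma zero_in_bl_test: "(\<lambda>z. 0) \<in> bl_test d" and one_in_bl_test: "(\<lambda>z. 1) \<in> bl_test d"
  by (auto simp: bl_test_def vdist_nonneg)

lemma bl_dist_upper:
  fixes \<phi> :: "(real^'n) \<times> (real^'n^'n) \<Rightarrow> real"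
  assumes V: "finite_varifold d V" and W: "finite_varifold d W" and \<phi>: "\<phi> \<in> bl_test d"
  shows "\<bar>(LINT z|V. \<phi> z) - (LINT z|W. \<phi> z)\<bar> \<le> varifold_bl_dist d V W"
  unfolding varifold_bl_dist_eq
\<comment> \<open>The real supremum is meaningful only for a bounded family; the sum of the two
  masses is a bound.\<close>
proof (rule cSUP_upper[OF \<phi>], rule bdd_aboveI2)
  fix \<phi> :: "(real^'n) \<times> (real^'n^'n) \<Rightarrow> real" assume "\<phi> \<in> bl_test d"
  then have c: "continuous_on (UNIV \<times> grassmannian d) \<phi>"
    and b: "\<And>z. z \<in> UNIV \<times> grassmannian d \<Longrightarrow> norm (\<phi> z) \<le> 1"
    by (auto simp: bl_test_def)
  show "\<bar>(LINT z|V. \<phi> z) - (LINT z|W. \<phi> z)\<bar> \<le> mass V + mass W"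
    using norm_integral_finite_varifold_le[OF V c b] norm_integral_finite_varifold_le[OF W c b] by simp
qed

lemma varifold_bl_dist_nonneg:
  assumes "finite_varifold d V" "finite_varifold d W"
  shows "0 \<le> varifold_bl_dist d V W"
  using bl_dist_upper[OF assms zero_in_bl_test] by simp

text \<open>Dividing by \<open>C\<close> produces an admissible test function. Only the larger of
  the sup bound and the Lipschitz bound counts, not their sum; otherwise the one-step factor could
  not be \<open>1 + O(s)\<close>.\<close>

lemma bl_dist_nonneg_function:
  assumes V: "finite_varifold d V" and W: "finite_varifold d W"
    and u: "\<And>z. z \<in> UNIV \<times> grassmannian d \<Longrightarrow> 0 \<le> u z \<and> u z \<le> A"
    and lip: "\<And>z w. z \<in> UNIV \<times> grassmannian d \<Longrightarrow> w \<in> UNIV \<times> grassmannian d \<Longrightarrow>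
        \<bar>u z - u w\<bar> \<le> B * vdist z w"
    and AB: "A \<le> C" "B \<le> C" "0 < C"
  shows "\<bar>(LINT z|V. u z) - (LINT z|W. u z)\<bar> \<le> C * varifold_bl_dist d V W"
proof -
  have "(\<lambda>z. u z / C) \<in> bl_test d"
  proof -
    have 1: "\<bar>u z / C - u w / C\<bar> \<le> 1 * vdist z w"
      if "z \<in> UNIV \<times> grassmannian d" "w \<in> UNIV \<times> grassmannian d" for z w
    proof -
      have "\<bar>u z - u w\<bar> \<le> C * vdist z w"
        using lip[OF that] mult_right_mono[OF AB(2) vdist_nonneg[of z w]] by linarith
      then show ?thesis using AB by (simp add: diff_divide_distrib[symmetric] pos_divide_le_eq mult.commute)
    qed
    moreover have "continuous_on (UNIV \<times> grassmannian d) (\<lambda>z. u z / C)"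
      by (rule continuous_on_vdist_lipschitz[where B = 1]) (use 1 in auto)
    moreover have "0 \<le> u z / C \<and> u z / C \<le> 1" if "z \<in> UNIV \<times> grassmannian d" for z
      using u[OF that] AB by simp
    ultimately show ?thesis by (simp add: bl_test_def)
  qed
  from bl_dist_upper[OF V W this]
  have "\<bar>(LINT z|V. u z) - (LINT z|W. u z)\<bar> / C \<le> varifold_bl_dist d V W"
    using AB by (simp add: diff_divide_distrib[symmetric])
  then show ?thesis using AB by (simp add: pos_divide_le_eq mult.commute)
qed

lemma bl_dist_mass:
  assumes V: "finite_varifold d V" and W: "finite_varifold d W"
  shows "\<bar>mass V - mass W\<bar> \<le> varifold_bl_dist d V W"
  using bl_dist_upper[OF V W one_in_bl_test] V W
  by (simp add: mass_def finite_varifold_def finite_measure.emeasure_eq_measure)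

text \<open>Test functions have to be nonnegative, so \<open>u\<close> is shifted by
  \<open>A\<close>. The shifted function costs \<open>2 A + B\<close>, and removing the shift costs
  \<open>A\<close> times the difference of the masses.\<close>

lemma bl_dist_function:
  assumes V: "finite_varifold d V" and W: "finite_varifold d W"
    and u: "\<And>z. z \<in> UNIV \<times> grassmannian d \<Longrightarrow> \<bar>u z\<bar> \<le> A"
    and lip: "\<And>z w. z \<in> UNIV \<times> grassmannian d \<Longrightarrow> w \<in> UNIV \<times> grassmannian d \<Longrightarrow>
        \<bar>u z - u w\<bar> \<le> B * vdist z w"
    and AB: "0 < A" "0 \<le> B"
  shows "\<bar>(LINT z|V. u z) - (LINT z|W. u z)\<bar> \<le> (3 * A + B) * varifold_bl_dist d V W"
proof -
  interpret V: finite_measure V using V by (simp add: finite_varifold_def)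
  interpret W: finite_measure W using W by (simp add: finite_varifold_def)
  have c: "continuous_on (UNIV \<times> grassmannian d) u"
    by (rule continuous_on_vdist_lipschitz[where B = B]) (use lip AB in auto)
  have i: "integrable V u" "integrable W u"
    using integrable_finite_varifold[OF V c] integrable_finite_varifold[OF W c] u by auto
  have "\<bar>(LINT z|V. u z + A) - (LINT z|W. u z + A)\<bar> \<le> (2 * A + B) * varifold_bl_dist d V W"
  proof (rule bl_dist_nonneg_function[OF V W, where A = "2 * A" and B = B])
    show "0 \<le> u z + A \<and> u z + A \<le> 2 * A" if "z \<in> UNIV \<times> grassmannian d" for z
      using u[OF that] by auto
  qed (use lip AB in auto)
  moreover have "(LINT z|V. u z + A) = (LINT z|V. u z) + A * mass V"
    "(LINT z|W. u z + A) = (LINT z|W. u z) + A * mass W"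
    using i by (simp_all add: mass_def)
  moreover have "\<bar>A * mass V - A * mass W\<bar> \<le> A * varifold_bl_dist d V W"
    using mult_left_mono[OF bl_dist_mass[OF V W], of A] AB
    by (simp add: right_diff_distrib[symmetric] abs_mult)
  ultimately show ?thesis by (simp add: algebra_simps)
qed

subsection \<open>Convolution with a compactly supported kernel\<close>

definition unit_vol :: "'n::finite itself \<Rightarrow> real" where
  "unit_vol _ = measure lborel (cball 0 1 :: (real^'n) set)"

lemma measure_cball_1: "measure lborel (cball (x::real^'n) 1) = unit_vol TYPE('n)"
  unfolding unit_vol_def by (simp add: content_cball)

lemma unit_vol_pos: "0 < unit_vol TYPE('n::finite)"
  unfolding unit_vol_def by (simp add: content_cball)

text \<open>Two balls, because the difference of two translates of a kernel supported in the unit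
  ball lives on the union of two unit balls.\<close>

lemma integral_ball_bound:
  fixes f :: "real^'n \<Rightarrow> 'b::{banach, second_countable_topology}"
  assumes f: "f \<in> borel_measurable borel"
    and b: "\<And>y. norm (f y) \<le> C * indicator (cball x 1) y + D * indicator (cball x' 1) y"
  shows "integrable lborel f" "norm (LINT y|lborel. f y) \<le> (C + D) * unit_vol TYPE('n)"
proof -
  have fin: "emeasure lborel (cball z 1 :: (real^'n) set) < \<infinity>" for z
    using emeasure_bounded_finite[OF bounded_cball] .
  let ?B = "\<lambda>y::real^'n. C * indicator (cball x 1) y + D * indicator (cball x' 1) y"
  have i: "integrable lborel ?B"
    by (intro Bochner_Integration.integrable_add integrable_mult_right integrable_real_indicator)
      (use fin in auto)
  show fi: "integrable lborel f"
    by (rule Bochner_Integration.integrable_bound[OF i]) (use f b in \<open>auto intro: order_trans[OF b abs_ge_self]\<close>)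
  have "norm (LINT y|lborel. f y) \<le> (LINT y|lborel. ?B y)"
    by (rule Bochner_Integration.integral_norm_bound_integral[OF fi i b])
  also have "\<dots> = (C + D) * unit_vol TYPE('n)"
    using fin by (subst Bochner_Integration.integral_add)
      (auto simp: measure_cball_1 distrib_right intro!: integrable_mult_right integrable_real_indicator)
  finally show "norm (LINT y|lborel. f y) \<le> (C + D) * unit_vol TYPE('n)" .
qed

lemma lborel_integral_reflect:
  fixes f :: "real^'n \<Rightarrow> 'b::{banach, second_countable_topology}"
  assumes "f \<in> borel_measurable borel"
  shows "(LINT y|lborel. f (x - y)) = (LINT y|lborel. f y)"
proof -
  have e: "lborel = distr lborel borel (\<lambda>y::real^'n. x - y)"
    using lborel_affine[of "-1" x] by (simp add: density_1)
  show ?thesis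
    by (subst (2) e) (simp add: integral_distr assms)
qed

lemma lborel_integrable_reflect:
  fixes f :: "real^'n \<Rightarrow> 'b::{banach, second_countable_topology}"
  assumes "f \<in> borel_measurable borel" "integrable lborel f"
  shows "integrable lborel (\<lambda>y. f (x - y))"
proof -
  have e: "lborel = distr lborel borel (\<lambda>y::real^'n. x - y)"
    using lborel_affine[of "-1" x] by (simp add: density_1)
  have "integrable (distr lborel borel (\<lambda>y::real^'n. x - y)) f" using assms(2) e by metis
  then show ?thesis using assms(1) by (subst (asm) integrable_distr_eq) auto
qed

subsection \<open>Approximate mean curvature of a varifold of finite mass\<close>

text \<open>Collects what the stability argument uses of the kernel. \<open>K\<close> bounds the
  kernel, \<open>A\<close> its gradient, \<open>B\<close> is a Lipschitz constant of the gradient,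
  and \<open>a\<close>, \<open>b\<close> are the constants of the gradient bound relative to the
  kernel. They are instantiated at the end with powers of \<open>1 / \<epsilon>\<close>:
  \<open>a\<close> of order 2, \<open>b\<close> of order 0, \<open>K\<close>, \<open>A\<close>,
  \<open>B\<close> of orders \<open>n\<close>, \<open>n + 2\<close>, \<open>n + 3\<close>.\<close>

locale mollifier =
  fixes \<psi> :: "real^'n \<Rightarrow> real" and \<epsilon> :: real
    and a b K A B \<omega> D :: real
  fixes k :: "real^'n \<Rightarrow> real" and g :: "real^'n \<Rightarrow> real^'n"
  defines "k \<equiv> kernel \<psi> \<epsilon>" and "g \<equiv> gradient k"
  assumes \<omega>_def: "\<omega> = unit_vol TYPE('n)" and D_def: "D = det_const CARD('n)"
    and eps: "0 < \<epsilon>"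
    and k_range: "0 \<le> k x" "k x \<le> K"
    and k_outside: "norm x \<ge> 1 \<Longrightarrow> k x = 0"
    and g_outside: "norm x \<ge> 1 \<Longrightarrow> g x = 0"
    and k_integral: "(LINT x|lborel. k x) = 1"
    and k_deriv: "(k has_derivative (\<lambda>v. g x \<bullet> v)) (at x)"
    and g_le_k: "norm (g x) \<le> a * k x + b"
    and g_le: "norm (g x) \<le> A"
    and g_lip: "norm (g x - g y) \<le> B * norm (x - y)"
    and nonneg: "0 \<le> a" "0 \<le> b" "0 < A" "0 < B" "0 < K"
begin

lemma k_cont: "continuous_on S k"
  using k_deriv has_derivative_continuous continuous_at_imp_continuous_on by blast

lemma g_cont: "continuous_on S g"
proof (rule lipschitz_on_continuous_on)
  show "B-lipschitz_on S g"
    by (rule lipschitz_onI) (use g_lip nonneg in \<open>auto simp: dist_norm\<close>)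
qed

lemma k_meas [measurable]: "k \<in> borel_measurable borel"
  by (rule borel_measurable_continuous_onI[OF k_cont])

lemma g_meas [measurable]: "g \<in> borel_measurable borel"
  by (rule borel_measurable_continuous_onI[OF g_cont])

lemma k_lip: "\<bar>k x - k y\<bar> \<le> A * norm (x - y)"
proof -
  have "norm (k x - k y) \<le> A * norm (x - y)"
  proof (rule differentiable_bound[of UNIV k "\<lambda>x v. g x \<bullet> v"])
    show "onorm (\<lambda>v. g x \<bullet> v) \<le> A" for x
    proof (rule onorm_le)
      fix v
      have "norm (g x \<bullet> v) \<le> norm (g x) * norm v" by (simp add: Cauchy_Schwarz_ineq2)
      also have "\<dots> \<le> A * norm v" using g_le by (intro mult_right_mono) auto
      finally show "norm (g x \<bullet> v) \<le> A * norm v" .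
    qed
  qed (use k_deriv in \<open>auto intro: has_derivative_at_withinI\<close>)
  then show ?thesis by simp
qed

lemma k_taylor: "\<bar>k (x + v) - k x - g x \<bullet> v\<bar> \<le> B * (norm v)\<^sup>2"
proof -
  have "norm (k (x + v) - k x - g x \<bullet> (x + v - x)) \<le> norm (x + v - x) * (B * norm v)"
  proof (rule differentiable_bound_linearization[of x "x + v" "cball x (norm v)" k "\<lambda>y w. g y \<bullet> w"])
    show "x + t *\<^sub>R (x + v - x) \<in> cball x (norm v)" if "t \<in> {0..1}" for t
      using that mult_right_mono[of t 1 "norm v"] by (simp add: dist_norm)
    show "(k has_derivative (\<lambda>w. g y \<bullet> w)) (at y within cball x (norm v))" for y
      using k_deriv by (rule has_derivative_at_withinI)
    show "onorm ((\<lambda>w. g y \<bullet> w) - (\<lambda>w. g x \<bullet> w)) \<le> B * norm v" if "y \<in> cball x (norm v)" for y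
      unfolding fun_diff_def
    proof (rule onorm_le)
      fix w
      have "norm (g y \<bullet> w - g x \<bullet> w) \<le> norm (g y - g x) * norm w"
        by (simp add: inner_diff_left[symmetric] Cauchy_Schwarz_ineq2)
      also have "\<dots> \<le> (B * norm v) * norm w"
      proof (rule mult_right_mono)
        have "norm (g y - g x) \<le> B * norm (y - x)" by (rule g_lip)
        also have "\<dots> \<le> B * norm v"
          using that nonneg by (intro mult_left_mono) (auto simp: dist_norm norm_minus_commute)
        finally show "norm (g y - g x) \<le> B * norm v" .
      qed simp
      finally show "norm (g y \<bullet> w - g x \<bullet> w) \<le> B * norm v * norm w" .
    qed
  qed simp
  then show ?thesis by (simp add: power2_eq_square mult_ac)
qed

lemma k_integrable: "integrable lborel k"
  by (rule integral_ball_bound(1)[where C = K and D = 0 and x = 0 and x' = 0])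
    (use k_range k_outside in \<open>auto simp: indicator_def\<close>)

lemma integral_k_shift: "(LINT y|lborel. k (x - y)) = 1" "integrable lborel (\<lambda>y. k (x - y))"
  using lborel_integral_reflect[OF k_meas] lborel_integrable_reflect[OF k_meas k_integrable] k_integral
  by auto

text \<open>Integrating \<open>g_le_k\<close> against a kernel of integral 1. The direct bound
  \<open>A * \<omega>\<close> would be worse by the factor \<open>\<epsilon>^(-n)\<close>.\<close>

lemma integral_g_shift:
  "integrable lborel (\<lambda>y. norm (g (x - y)))" "(LINT y|lborel. norm (g (x - y))) \<le> a + b * \<omega>"
proof -
  have bd: "norm (g (x - y)) \<le> a * k (x - y) + b * indicator (cball x 1) y" for y
    using g_le_k[of "x - y"] g_outside[of "x - y"] k_range(1)[of "x - y"] nonneg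
    by (auto simp: indicator_def dist_norm)
  have i: "integrable lborel (\<lambda>y. b * indicator (cball x 1) y :: real)"
    by (rule integral_ball_bound(1)[where C = b and D = 0 and x' = 0]) (use nonneg in \<open>auto simp: indicator_def\<close>)
  have e: "(LINT y|lborel. b * indicator (cball x 1) y :: real) = b * \<omega>"
    by (simp add: measure_cball_1 \<omega>_def)
  have i': "integrable lborel (\<lambda>y. a * k (x - y) + b * indicator (cball x 1) y)"
    using integral_k_shift(2) i by auto
  show ig: "integrable lborel (\<lambda>y. norm (g (x - y)))"
  proof (rule Bochner_Integration.integrable_bound[OF i'])
    show "AE y in lborel. norm (norm (g (x - y))) \<le> norm (a * k (x - y) + b * indicator (cball x 1) y)"
      by (intro always_eventually allI) (simp only: real_norm_def abs_norm_cancel order_trans[OF bd abs_ge_self])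
  qed measurable
  have "(LINT y|lborel. norm (g (x - y))) \<le> (LINT y|lborel. a * k (x - y) + b * indicator (cball x 1) y)"
    by (rule integral_mono[OF ig i' bd])
  also have "\<dots> = a + b * \<omega>"
    using integral_k_shift i e by simp
  finally show "(LINT y|lborel. norm (g (x - y))) \<le> a + b * \<omega>" .
qed

section \<open>Convolution of a bounded measurable field with the kernel\<close>

definition conv :: "(real^'n \<Rightarrow> real^'n) \<Rightarrow> real^'n \<Rightarrow> real^'n" where
  "conv p x = (LINT y|lborel. k (x - y) *\<^sub>R p y)"

text \<open>The derivative of \<open>conv p\<close> at \<open>x\<close> in direction
  \<open>v\<close>, with the differentiation falling on the kernel, so that \<open>p\<close> has to
  be bounded and measurable only.\<close>

definition dconv :: "(real^'n \<Rightarrow> real^'n) \<Rightarrow> real^'n \<Rightarrow> real^'n \<Rightarrow> real^'n" where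
  "dconv p x v = (LINT y|lborel. (g (x - y) \<bullet> v) *\<^sub>R p y)"

context
  fixes p :: "real^'n \<Rightarrow> real^'n" and H :: real
  assumes p_meas [measurable]: "p \<in> borel_measurable borel" and p_le: "\<And>y. norm (p y) \<le> H"
begin

lemma H_nonneg: "0 \<le> H"
  using p_le order_trans norm_ge_zero by blast

lemma conv_integrable: "integrable lborel (\<lambda>y. k (x - y) *\<^sub>R p y)"
  and norm_conv_le: "norm (conv p x) \<le> H"
proof -
  have bd: "norm (k (x - y) *\<^sub>R p y) \<le> H * k (x - y)" for y
    using mult_left_mono[OF p_le[of y] k_range(1)[of "x - y"]] k_range(1) by (simp add: mult.commute)
  have i: "integrable lborel (\<lambda>y. H * k (x - y))" using integral_k_shift(2) by auto
  show i2: "integrable lborel (\<lambda>y. k (x - y) *\<^sub>R p y)"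
  proof (rule Bochner_Integration.integrable_bound[OF i])
    show "AE y in lborel. norm (k (x - y) *\<^sub>R p y) \<le> norm (H * k (x - y))"
      by (intro always_eventually allI order_trans[OF bd]) (simp only: real_norm_def abs_ge_self)
  qed measurable
  have "norm (conv p x) \<le> (LINT y|lborel. H * k (x - y))"
    unfolding conv_def by (rule Bochner_Integration.integral_norm_bound_integral[OF i2 i bd])
  then show "norm (conv p x) \<le> H" using integral_k_shift by simp
qed

lemma dconv_integrable: "integrable lborel (\<lambda>y. (g (x - y) \<bullet> v) *\<^sub>R p y)"
  and norm_dconv_le: "norm (dconv p x v) \<le> H * (a + b * \<omega>) * norm v"
proof -
  have bd: "norm ((g (x - y) \<bullet> v) *\<^sub>R p y) \<le> (H * norm v) * norm (g (x - y))" for y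
  proof -
    have "\<bar>g (x - y) \<bullet> v\<bar> * norm (p y) \<le> (norm (g (x - y)) * norm v) * H"
      by (intro mult_mono Cauchy_Schwarz_ineq2 p_le) auto
    then show ?thesis by (simp add: mult_ac)
  qed
  have i: "integrable lborel (\<lambda>y. (H * norm v) * norm (g (x - y)))" using integral_g_shift(1) by auto
  show i2: "integrable lborel (\<lambda>y. (g (x - y) \<bullet> v) *\<^sub>R p y)"
  proof (rule Bochner_Integration.integrable_bound[OF i])
    show "AE y in lborel. norm ((g (x - y) \<bullet> v) *\<^sub>R p y) \<le> norm ((H * norm v) * norm (g (x - y)))"
      by (intro always_eventually allI order_trans[OF bd]) (simp only: real_norm_def abs_ge_self)
  qed measurable
  have "norm (dconv p x v) \<le> (LINT y|lborel. (H * norm v) * norm (g (x - y)))"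
    unfolding dconv_def by (rule Bochner_Integration.integral_norm_bound_integral[OF i2 i bd])
  also have "\<dots> = (H * norm v) * (LINT y|lborel. norm (g (x - y)))" by simp
  also have "\<dots> \<le> (H * norm v) * (a + b * \<omega>)"
    using H_nonneg by (intro mult_left_mono integral_g_shift(2)) auto
  finally show "norm (dconv p x v) \<le> H * (a + b * \<omega>) * norm v" by (simp add: mult_ac)
qed

lemma dconv_linear: "linear (dconv p x)"
proof (rule linearI)
  show "dconv p x (v + w) = dconv p x v + dconv p x w" for v w
    unfolding dconv_def
    by (subst Bochner_Integration.integral_add[symmetric])
      (simp_all add: dconv_integrable inner_add_right scaleR_add_left)
  show "dconv p x (c *\<^sub>R v) = c *\<^sub>R dconv p x v" for c v
    unfolding dconv_def
    by (subst integral_scaleR_right[symmetric]) simp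
qed

lemma dconv_lip: "norm (dconv p x v - dconv p x' v) \<le> (2 * H * B * \<omega>) * norm (x - x') * norm v"
proof -
  let ?C = "H * (B * norm (x - x') * norm v)"
  have C: "0 \<le> ?C" using H_nonneg nonneg by simp
  have "dconv p x v - dconv p x' v
      = (LINT y|lborel. (g (x - y) \<bullet> v) *\<^sub>R p y - (g (x' - y) \<bullet> v) *\<^sub>R p y)"
    unfolding dconv_def by (rule Bochner_Integration.integral_diff[symmetric, OF dconv_integrable dconv_integrable])
  also have "norm \<dots> \<le> (?C + ?C) * \<omega>"
  proof (unfold \<omega>_def, rule integral_ball_bound(2)[of _ _ x _ x'])
    fix y
    show "norm ((g (x - y) \<bullet> v) *\<^sub>R p y - (g (x' - y) \<bullet> v) *\<^sub>R p y)
       \<le> ?C * indicator (cball x 1) y + ?C * indicator (cball x' 1) y"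
    proof (cases "y \<in> cball x 1 \<or> y \<in> cball x' 1")
      case True
      have "norm ((g (x - y) \<bullet> v) *\<^sub>R p y - (g (x' - y) \<bullet> v) *\<^sub>R p y)
          = \<bar>(g (x - y) - g (x' - y)) \<bullet> v\<bar> * norm (p y)"
        by (simp add: scaleR_diff_left[symmetric] inner_diff_left[symmetric])
      also have "\<dots> \<le> (norm (g (x - y) - g (x' - y)) * norm v) * H"
        by (intro mult_mono Cauchy_Schwarz_ineq2 p_le) auto
      also have "\<dots> \<le> (B * norm (x - x') * norm v) * H"
        using g_lip[of "x - y" "x' - y"] H_nonneg by (intro mult_right_mono) auto
      finally have "norm ((g (x - y) \<bullet> v) *\<^sub>R p y - (g (x' - y) \<bullet> v) *\<^sub>R p y) \<le> ?C" by (simp add: mult_ac)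
      moreover have "?C \<le> ?C * indicator (cball x 1) y + ?C * indicator (cball x' 1) y"
        using True C by (auto simp: indicator_def)
      ultimately show ?thesis by (rule order_trans)
    next
      case False
      then have "g (x - y) = 0" "g (x' - y) = 0" by (auto intro!: g_outside simp: dist_norm)
      then show ?thesis using C by simp
    qed
  qed measurable
  finally show ?thesis by (simp add: mult_ac)
qed

text \<open>No differentiation under the integral sign: the quadratic Taylor remainder of the kernel
  is integrated over the union of two unit balls and gives a remainder of order
  \<open>(norm v)^2\<close> directly.\<close>

lemma conv_has_derivative: "(conv p has_derivative dconv p x) (at x)"
proof -
  have bl: "bounded_linear (dconv p x)"
    using dconv_linear by (simp add: linear_conv_bounded_linear)
  define C where "C = 2 * (H * B) * \<omega>"
  have rem: "norm (conv p (x + v) - conv p x - dconv p x v) \<le> C * (norm v)\<^sup>2" for v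
  proof -
    let ?C = "H * (B * (norm v)\<^sup>2)"
    have C: "0 \<le> ?C" using H_nonneg nonneg by simp
    have "conv p (x + v) - conv p x - dconv p x v
      = (LINT y|lborel. k (x + v - y) *\<^sub>R p y - k (x - y) *\<^sub>R p y - (g (x - y) \<bullet> v) *\<^sub>R p y)"
      unfolding conv_def dconv_def
      by (subst Bochner_Integration.integral_diff
          | intro Bochner_Integration.integrable_diff conv_integrable dconv_integrable | rule refl)+
    also have "norm \<dots> \<le> (?C + ?C) * \<omega>"
    proof (unfold \<omega>_def, rule integral_ball_bound(2)[of _ _ "x + v" _ x])
      fix y
      show "norm (k (x + v - y) *\<^sub>R p y - k (x - y) *\<^sub>R p y - (g (x - y) \<bullet> v) *\<^sub>R p y)
       \<le> ?C * indicator (cball (x + v) 1) y + ?C * indicator (cball x 1) y"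
      proof (cases "y \<in> cball (x + v) 1 \<or> y \<in> cball x 1")
        case True
        have "norm (k (x + v - y) *\<^sub>R p y - k (x - y) *\<^sub>R p y - (g (x - y) \<bullet> v) *\<^sub>R p y)
          = \<bar>k (x - y + v) - k (x - y) - g (x - y) \<bullet> v\<bar> * norm (p y)"
        proof -
          have "x + v - y = x - y + v" by simp
          then show ?thesis by (simp only: scaleR_diff_left[symmetric] norm_scaleR)
        qed
        also have "\<dots> \<le> (B * (norm v)\<^sup>2) * H"
          using nonneg by (intro mult_mono k_taylor p_le) auto
        finally have "norm (k (x + v - y) *\<^sub>R p y - k (x - y) *\<^sub>R p y - (g (x - y) \<bullet> v) *\<^sub>R p y) \<le> ?C"
          by (simp add: mult_ac)
        moreover have "?C \<le> ?C * indicator (cball (x + v) 1) y + ?C * indicator (cball x 1) y"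
          using True C by (auto simp: indicator_def)
        ultimately show ?thesis by (rule order_trans)
      next
        case False
        then have "k (x + v - y) = 0" "k (x - y) = 0" "g (x - y) = 0"
          by (auto intro!: g_outside k_outside simp: dist_norm)
        then show ?thesis using C by simp
      qed
    qed measurable
    finally show ?thesis by (simp add: C_def mult_ac)
  qed
  show ?thesis
    unfolding has_derivative_at
  proof (intro conjI bl)
    show "(\<lambda>v. norm (conv p (x + v) - conv p x - dconv p x v) / norm v) \<midarrow>0\<rightarrow> 0"
    proof (rule Lim_null_comparison[where g = "\<lambda>v. C * norm v"])
      show "(\<lambda>v. C * norm v) \<midarrow>0\<rightarrow> 0" using tendsto_mult_right_zero[OF tendsto_norm_zero[OF tendsto_ident_at]] .
      have "norm (norm (conv p (x + v) - conv p x - dconv p x v) / norm v) \<le> C * norm v" for v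
        using rem[of v] by (cases "v = 0") (auto simp: pos_divide_le_eq power2_eq_square mult.assoc)
      then show "\<forall>\<^sub>F v in at 0. norm (norm (conv p (x + v) - conv p x - dconv p x v) / norm v) \<le> C * norm v"
        by simp
    qed
  qed
qed

end

lemma conv_diff:
  assumes "p \<in> borel_measurable borel" "\<And>y. norm (p y) \<le> H"
    and "q \<in> borel_measurable borel" "\<And>y. norm (q y) \<le> H'"
  shows "conv p x - conv q x = conv (\<lambda>y. p y - q y) x"
    "dconv p x v - dconv q x v = dconv (\<lambda>y. p y - q y) x v"
  unfolding conv_def dconv_def scaleR_diff_right
  by (rule Bochner_Integration.integral_diff[symmetric];
      rule conv_integrable[OF assms(1,2)] conv_integrable[OF assms(3,4)]
        dconv_integrable[OF assms(1,2)] dconv_integrable[OF assms(3,4)])+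

end

context mollifier
begin

section \<open>The integrands of mollified mass and first variation as Lipschitz functions of point
  and plane\<close>

lemma kernel_shift_lip:
  "\<bar>k (fst z - y) - k (fst w - y)\<bar> \<le> A * vdist z w"
proof -
  have "\<bar>k (fst z - y) - k (fst w - y)\<bar> \<le> A * norm (fst z - fst w)"
    using k_lip[of "fst z - y" "fst w - y"] by simp
  also have "\<dots> \<le> A * vdist z w" using nonneg by (intro mult_left_mono vdist_ge_fst) auto
  finally show ?thesis .
qed

lemma proj_gradient_le:
  assumes "z \<in> UNIV \<times> grassmannian d"
  shows "norm (snd z *v g v) \<le> norm (g v)"
  using assms by (intro orthogonal_projection_norm_le) (auto simp: grassmannian_iff)

lemma proj_gradient_shift_lip:
  assumes "z \<in> UNIV \<times> grassmannian d" "w \<in> UNIV \<times> grassmannian d"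
  shows "norm (snd z *v g (fst z - y) - snd w *v g (fst w - y)) \<le> (A + B) * vdist z w"
proof -
  have "snd z *v g (fst z - y) - snd w *v g (fst w - y)
     = (snd z - snd w) *v g (fst z - y) + snd w *v (g (fst z - y) - g (fst w - y))"
    by (simp add: matrix_vector_mult_diff_rdistrib matrix_vector_mult_diff_distrib)
  moreover have "norm ((snd z - snd w) *v g (fst z - y)) \<le> vdist z w * A"
    by (rule order_trans[OF onorm_matrix mult_mono[OF vdist_ge_snd g_le vdist_nonneg norm_ge_zero]])
  moreover have "norm (snd w *v (g (fst z - y) - g (fst w - y))) \<le> B * vdist z w"
  proof -
    have "norm (snd w *v (g (fst z - y) - g (fst w - y))) \<le> norm (g (fst z - y) - g (fst w - y))"
      using assms by (intro orthogonal_projection_norm_le) (auto simp: grassmannian_iff)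
    also have "\<dots> \<le> B * norm (fst z - fst w)" using g_lip[of "fst z - y" "fst w - y"] by simp
    also have "\<dots> \<le> B * vdist z w" using nonneg by (intro mult_left_mono vdist_ge_fst) auto
    finally show ?thesis .
  qed
  ultimately show ?thesis
    using norm_triangle_mono[of "(snd z - snd w) *v g (fst z - y)" "vdist z w * A"
        "snd w *v (g (fst z - y) - g (fst w - y))" "B * vdist z w"]
    by (simp add: algebra_simps)
qed

lemma cont_kernel_shift: "continuous_on X (\<lambda>z::(real^'n) \<times> (real^'n^'n). k (fst z - y))"
  by (rule continuous_on_vdist_lipschitz[where B = A]) (use kernel_shift_lip nonneg in auto)

lemma cont_proj_gradient_shift:
  "continuous_on (UNIV \<times> grassmannian d) (\<lambda>z::(real^'n) \<times> (real^'n^'n). snd z *v g (fst z - y))"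
  by (rule continuous_on_vdist_lipschitz[where B = "A + B"]) (use proj_gradient_shift_lip nonneg in auto)

text \<open>Sup bound of the unsmoothed mean curvature of a varifold of mass at most
  \<Lambda>.\<close>

definition pmc_bound :: "real \<Rightarrow> real" where
  "pmc_bound \<Lambda> = a + b * \<Lambda> / \<epsilon>"

text \<open>Lipschitz constant, in sup norm, of the unsmoothed mean curvature as a function of the
  varifold: \<open>4 A + B\<close> comes from the numerator, \<open>K + A\<close> from the
  denominator, and the division by \<open>\<epsilon>\<close> from its lower bound.\<close>

definition pmc_lip :: "real \<Rightarrow> real" where
  "pmc_lip \<Lambda> = ((4 * A + B) + pmc_bound \<Lambda> * (K + A)) / \<epsilon>"

abbreviation "mm \<equiv> mollified_mass \<psi> \<epsilon>"
abbreviation "fv \<equiv> mollified_first_variation \<psi> \<epsilon>"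
abbreviation "pmc \<equiv> pre_mean_curvature \<psi> \<epsilon>"

lemma mean_curvature_eq_conv: "approx_mean_curvature \<psi> \<epsilon> V = conv (pmc V)"
  by (rule ext) (simp add: approx_mean_curvature_def conv_def k_def)

lemma mm_eq:
  assumes "sets V = sets (varifold_space d)"
  shows "mm V y = (LINT z|V. k (fst z - y))"
proof -
  have "fst \<in> borel_measurable V"
    by (rule measurable_varifold_continuous[OF assms]) (intro continuous_intros)
  then show ?thesis
    unfolding mollified_mass_def weight_def k_def[symmetric] by (subst integral_distr) auto
qed

lemma fv_eq: "fv V y = (LINT z|V. snd z *v g (fst z - y))"
  unfolding mollified_first_variation_def g_def k_def ..

context
  fixes V :: "'n vmeasure" and d :: nat
  assumes V: "finite_varifold d V"
begin

lemma sets_V: "sets V = sets (varifold_space d)"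
  using V by (simp add: finite_varifold_def)

lemma space_V: "space V = UNIV \<times> grassmannian d"
  by (rule space_finite_varifold[OF sets_V])

lemma integrable_kernel_shift: "integrable V (\<lambda>z. k (fst z - y))"
  by (rule integrable_finite_varifold[OF V cont_kernel_shift, where B = K]) (use k_range in auto)

lemma integrable_proj_gradient_shift: "integrable V (\<lambda>z. snd z *v g (fst z - y))"
  by (rule integrable_finite_varifold[OF V cont_proj_gradient_shift, where B = A])
    (rule order_trans[OF proj_gradient_le g_le])

lemma mm_nonneg: "0 \<le> mm V y"
  unfolding mm_eq[OF sets_V] using k_range by simp

lemma norm_fv_le: "norm (fv V y) \<le> a * mm V y + b * mass V"
proof -
  interpret finite_measure V using V by (simp add: finite_varifold_def)
  have "norm (fv V y) \<le> (LINT z|V. norm (snd z *v g (fst z - y)))"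
    unfolding fv_eq by (rule integral_norm_bound)
  also have "\<dots> \<le> (LINT z|V. a * k (fst z - y) + b)"
  proof (rule integral_mono)
    show "norm (snd z *v g (fst z - y)) \<le> a * k (fst z - y) + b" if "z \<in> space V" for z
      using order_trans[OF proj_gradient_le g_le_k] that unfolding space_V by blast
  qed (use integrable_kernel_shift integrable_proj_gradient_shift in auto)
  also have "\<dots> = a * mm V y + b * mass V"
    using integrable_kernel_shift by (simp add: mm_eq[OF sets_V] mass_def)
  finally show ?thesis .
qed

lemma cont_mm: "continuous_on UNIV (mm V)"
proof (rule lipschitz_on_continuous_on)
  show "(A * mass V)-lipschitz_on UNIV (mm V)"
  proof (rule lipschitz_onI)
    fix y y'
    have "mm V y - mm V y' = (LINT z|V. k (fst z - y) - k (fst z - y'))"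
      unfolding mm_eq[OF sets_V] using integrable_kernel_shift by simp
    also have "norm \<dots> \<le> (A * norm (y - y')) * mass V"
    proof (rule norm_integral_finite_varifold_le[OF V])
      show "continuous_on (UNIV \<times> grassmannian d)
          (\<lambda>z::(real^'n) \<times> (real^'n^'n). k (fst z - y) - k (fst z - y'))"
        by (intro continuous_on_diff cont_kernel_shift)
      show "norm (k (fst z - y) - k (fst z - y')) \<le> A * norm (y - y')" for z :: "(real^'n) \<times> (real^'n^'n)"
        using k_lip[of "fst z - y" "fst z - y'"] by (simp add: norm_minus_commute)
    qed
    finally show "dist (mm V y) (mm V y') \<le> A * mass V * dist y y'" by (simp add: dist_norm mult_ac)
  qed (use nonneg mass_nonneg[of V] in simp)
qed

lemma cont_fv: "continuous_on UNIV (fv V)"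
proof (rule lipschitz_on_continuous_on)
  show "(B * mass V)-lipschitz_on UNIV (fv V)"
  proof (rule lipschitz_onI)
    fix y y'
    have "fv V y - fv V y' = (LINT z|V. snd z *v g (fst z - y) - snd z *v g (fst z - y'))"
      unfolding fv_eq using integrable_proj_gradient_shift by simp
    also have "norm \<dots> \<le> (B * norm (y - y')) * mass V"
    proof (rule norm_integral_finite_varifold_le[OF V])
      show "continuous_on (UNIV \<times> grassmannian d) (\<lambda>z. snd z *v g (fst z - y) - snd z *v g (fst z - y'))"
        by (intro continuous_on_diff cont_proj_gradient_shift)
      fix z :: "(real^'n) \<times> (real^'n^'n)" assume z: "z \<in> UNIV \<times> grassmannian d"
      have "norm (snd z *v g (fst z - y) - snd z *v g (fst z - y'))
          \<le> norm (g (fst z - y) - g (fst z - y'))"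
        unfolding matrix_vector_mult_diff_distrib[symmetric]
        using z by (intro orthogonal_projection_norm_le) (auto simp: grassmannian_iff)
      also have "\<dots> \<le> B * norm (y - y')"
        using g_lip[of "fst z - y" "fst z - y'"] by (simp add: norm_minus_commute)
      finally show "norm (snd z *v g (fst z - y) - snd z *v g (fst z - y')) \<le> B * norm (y - y')" .
    qed
    finally show "dist (fv V y) (fv V y') \<le> B * mass V * dist y y'" by (simp add: dist_norm mult_ac)
  qed (use nonneg mass_nonneg[of V] in simp)
qed

lemma pmc_meas: "pmc V \<in> borel_measurable borel"
proof (rule borel_measurable_continuous_onI)
  have "mm V y + \<epsilon> \<noteq> 0" for y using mm_nonneg[of y] eps by simp
  then show "continuous_on UNIV (pmc V)"
    unfolding pre_mean_curvature_def
    by (intro continuous_intros cont_mm[unfolded eta_contract_eq] cont_fv) auto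
qed

context
  fixes \<Lambda> :: real
  assumes mass: "mass V \<le> \<Lambda>"
begin

text \<open>The numerator is at most \<open>a\<close> times the mollified mass plus
  \<open>b \<Lambda>\<close>. The first part is absorbed by the denominator, so only the
  \<open>b\<close> part pays a factor \<open>1 / \<epsilon>\<close>.\<close>

lemma norm_pmc_le: "norm (pmc V y) \<le> pmc_bound \<Lambda>"
proof -
  have d: "0 < mm V y + \<epsilon>" using mm_nonneg[of y] eps by simp
  have L: "0 \<le> \<Lambda>" using mass mass_nonneg order_trans by blast
  have "norm (fv V y) \<le> a * mm V y + b * \<Lambda>"
    using norm_fv_le[of y] mult_left_mono[OF mass nonneg(2)] by linarith
  also have "\<dots> \<le> (a + b * \<Lambda> / \<epsilon>) * (mm V y + \<epsilon>)"
    using nonneg L eps mm_nonneg[of y] by (simp add: distrib_left distrib_right)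
  finally show ?thesis
    unfolding pmc_bound_def pre_mean_curvature_def using d by (simp add: field_simps)
qed

lemma pmc_bound_nonneg: "0 \<le> pmc_bound \<Lambda>"
  using norm_pmc_le norm_ge_zero order_trans by blast

text \<open>The trace of \<open>dconv\<close> along the plane becomes an integral of the projected
  kernel gradient against the field, the form to which Fubini applies. Pointwise it is the expansion
  of an inner product in coordinates, together with \<open>S\<close> being symmetric and
  idempotent.\<close>

lemma sum_dconv_proj:
  assumes S: "orthogonal_projection S"
  shows "(\<Sum>i\<in>UNIV. dconv (pmc V) x (S *v axis i 1) \<bullet> (S *v axis i 1))
     = (LINT y|lborel. (S *v g (x - y)) \<bullet> pmc V y)"
proof -
  note int = dconv_integrable[OF pmc_meas norm_pmc_le]
  have "(\<Sum>i\<in>UNIV. dconv (pmc V) x (S *v axis i 1) \<bullet> (S *v axis i 1))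
     = (\<Sum>i\<in>UNIV. LINT y|lborel. ((g (x - y) \<bullet> (S *v axis i 1)) *\<^sub>R pmc V y) \<bullet> (S *v axis i 1))"
    unfolding dconv_def using int by (intro sum.cong refl integral_inner_left[symmetric]) auto
  also have "\<dots> = (LINT y|lborel. (\<Sum>i\<in>UNIV. ((g (x - y) \<bullet> (S *v axis i 1)) *\<^sub>R pmc V y) \<bullet> (S *v axis i 1)))"
    by (rule Bochner_Integration.integral_sum[symmetric]) (intro integrable_inner_left int)
  also have "\<dots> = (LINT y|lborel. (S *v g (x - y)) \<bullet> pmc V y)"
  proof (rule Bochner_Integration.integral_cong[OF refl])
    fix y
    have sw: "v \<bullet> (S *v w) = (S *v v) \<bullet> w" for v w
      using S by (simp add: orthogonal_projection_def)
    have id: "S *v (S *v v) = S *v v" for v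
      using S by (simp add: orthogonal_projection_def)
    have "(\<Sum>i\<in>UNIV. ((g (x - y) \<bullet> (S *v axis i 1)) *\<^sub>R pmc V y) \<bullet> (S *v axis i 1))
       = (\<Sum>i\<in>UNIV. (S *v g (x - y)) $ i * (S *v pmc V y) $ i)"
      unfolding inner_scaleR_left by (simp add: sw inner_axis)
    also have "\<dots> = (S *v g (x - y)) \<bullet> (S *v pmc V y)" by (simp add: inner_vec_def)
    finally show "(\<Sum>i\<in>UNIV. ((g (x - y) \<bullet> (S *v axis i 1)) *\<^sub>R pmc V y) \<bullet> (S *v axis i 1))
       = (S *v g (x - y)) \<bullet> pmc V y"
      by (simp add: sw id)
  qed
  finally show ?thesis .
qed

text \<open>By Fubini the first variation of \<open>V\<close> along its approximate mean curvature is
  \<open>-\<integral>|\<delta>V * \<Phi>|\<^sup>2 / (\<parallel>V\<parallel> * \<Phi> + \<epsilon>)\<close>; this is what keeps the masses bounded.\<close>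

lemma first_variation_mean_curvature:
  "integrable V (\<lambda>z. \<Sum>i\<in>UNIV. dconv (pmc V) (fst z) (snd z *v axis i 1) \<bullet> (snd z *v axis i 1))"
  "(LINT z|V. (\<Sum>i\<in>UNIV. dconv (pmc V) (fst z) (snd z *v axis i 1) \<bullet> (snd z *v axis i 1))) \<le> 0"
proof -
  interpret finite_measure V using V by (simp add: finite_varifold_def)
  interpret pair_sigma_finite V "lborel :: (real^'n) measure" ..
  define f where "f = (\<lambda>z y. (snd z *v g (fst z - y)) \<bullet> pmc V y)"
  note pmc_meas [measurable]
  have fst_meas [measurable]: "fst \<in> borel_measurable V"
    by (rule measurable_varifold_continuous[OF sets_V]) (intro continuous_intros)
  have comp_meas [measurable]: "(\<lambda>z. snd z $ i $ j) \<in> borel_measurable V" for i j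
    by (rule measurable_varifold_continuous[OF sets_V]) (intro continuous_intros)
  have nth_meas [measurable]: "(\<lambda>v::real^'n. v $ j) \<in> borel_measurable borel" for j
    by (rule borel_measurable_continuous_onI) (intro continuous_intros)
  \<comment> \<open>Coordinates reduce joint measurability on the product space to that of
    real-valued entries.\<close>
  have f_eq: "f z y = (\<Sum>i\<in>UNIV. \<Sum>j\<in>UNIV. snd z $ i $ j * g (fst z - y) $ j * pmc V y $ i)" for z y
    by (simp add: f_def inner_vec_def matrix_vector_mult_def sum_distrib_right)
  have f_meas [measurable]: "case_prod f \<in> borel_measurable (V \<Otimes>\<^sub>M lborel)"
  proof -
    have "(\<lambda>(z, y). \<Sum>i\<in>UNIV. \<Sum>j\<in>UNIV. snd z $ i $ j * g (fst z - y) $ j * pmc V y $ i)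
       \<in> borel_measurable (V \<Otimes>\<^sub>M lborel)"
      by measurable
    then show ?thesis by (simp add: f_eq split_beta')
  qed
  have bd: "norm (f z y) \<le> pmc_bound \<Lambda> * norm (g (fst z - y))" if "z \<in> UNIV \<times> grassmannian d" for z y
  proof -
    have "norm (f z y) \<le> norm (snd z *v g (fst z - y)) * norm (pmc V y)"
      unfolding f_def by (simp add: Cauchy_Schwarz_ineq2)
    also have "\<dots> \<le> norm (g (fst z - y)) * pmc_bound \<Lambda>"
      by (intro mult_mono proj_gradient_le[OF that] norm_pmc_le) auto
    finally show ?thesis by (simp add: mult.commute)
  qed
  have i1: "integrable lborel (\<lambda>y. f z y)" if z: "z \<in> space V" for z
  proof (rule Bochner_Integration.integrable_bound)
    show "integrable lborel (\<lambda>y. pmc_bound \<Lambda> * norm (g (fst z - y)))" using integral_g_shift(1) by auto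
    show "(\<lambda>y. f z y) \<in> borel_measurable lborel" using f_meas z by measurable
    show "AE y in lborel. norm (f z y) \<le> norm (pmc_bound \<Lambda> * norm (g (fst z - y)))"
    proof (intro always_eventually allI)
      fix y
      show "norm (f z y) \<le> norm (pmc_bound \<Lambda> * norm (g (fst z - y)))"
        using bd[of z y] z pmc_bound_nonneg unfolding space_V by simp
    qed
  qed
  have b1: "(LINT y|lborel. norm (f z y)) \<le> pmc_bound \<Lambda> * (a + b * \<omega>)" if z: "z \<in> space V" for z
  proof -
    have "(LINT y|lborel. norm (f z y)) \<le> (LINT y|lborel. pmc_bound \<Lambda> * norm (g (fst z - y)))"
      using i1[OF z] integral_g_shift(1) bd z unfolding space_V by (intro integral_mono) auto
    also have "\<dots> \<le> pmc_bound \<Lambda> * (a + b * \<omega>)"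
      using mult_left_mono[OF integral_g_shift(2) pmc_bound_nonneg] by simp
    finally show ?thesis .
  qed
  have int: "integrable (V \<Otimes>\<^sub>M lborel) (case_prod f)"
  proof (rule Fubini_integrable[OF f_meas])
    show "AE z in V. integrable lborel (\<lambda>y. case_prod f (z, y))" using i1 by (intro AE_I2) simp
    show "integrable V (\<lambda>z. LINT y|lborel. norm (case_prod f (z, y)))"
    proof (rule integrable_const_bound[where B = "pmc_bound \<Lambda> * (a + b * \<omega>)"])
      show "AE z in V. norm (LINT y|lborel. norm (case_prod f (z, y))) \<le> pmc_bound \<Lambda> * (a + b * \<omega>)"
        using b1 by (intro AE_I2) simp
      show "(\<lambda>z. LINT y|lborel. norm (case_prod f (z, y))) \<in> borel_measurable V"
        by measurable
    qed
  qed
  have eq: "(\<Sum>i\<in>UNIV. dconv (pmc V) (fst z) (snd z *v axis i 1) \<bullet> (snd z *v axis i 1)) = (LINT y|lborel. f z y)"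
    if z: "z \<in> space V" for z
    unfolding f_def by (rule sum_dconv_proj) (use z in \<open>auto simp: space_V grassmannian_iff\<close>)
  have "integrable V (\<lambda>z. LINT y|lborel. f z y)"
    using integrable_fst[OF int] by simp
  then show "integrable V (\<lambda>z. \<Sum>i\<in>UNIV. dconv (pmc V) (fst z) (snd z *v axis i 1) \<bullet> (snd z *v axis i 1))"
    using eq by (subst Bochner_Integration.integrable_cong[OF refl]) auto
  have "(LINT z|V. (\<Sum>i\<in>UNIV. dconv (pmc V) (fst z) (snd z *v axis i 1) \<bullet> (snd z *v axis i 1)))
      = (LINT z|V. LINT y|lborel. f z y)"
    using eq by (intro Bochner_Integration.integral_cong) auto
  also have "\<dots> = (LINT y|lborel. LINT z|V. f z y)" by (rule Fubini_integral[OF int, symmetric])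
  also have "\<dots> \<le> 0"
  proof -
    have le: "(LINT z|V. f z y) \<le> 0" for y
    proof -
    have "(LINT z|V. f z y) = fv V y \<bullet> pmc V y"
      unfolding f_def fv_eq by (rule integral_inner_left) (simp add: integrable_proj_gradient_shift)
    also have "\<dots> = - ((fv V y \<bullet> fv V y) / (mm V y + \<epsilon>))"
      by (simp add: pre_mean_curvature_def divide_inverse)
    also have "\<dots> \<le> 0" using mm_nonneg[of y] eps by simp
    finally show ?thesis .
    qed
    have "0 \<le> (LINT y|lborel. - (LINT z|V. f z y))"
      by (rule Bochner_Integration.integral_nonneg) (use le in simp)
    then show ?thesis by simp
  qed
  finally show "(LINT z|V. (\<Sum>i\<in>UNIV. dconv (pmc V) (fst z) (snd z *v axis i 1) \<bullet> (snd z *v axis i 1))) \<le> 0" .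
qed

end

end

section \<open>Lipschitz dependence of the approximate mean curvature on the varifold\<close>

context
  fixes V W :: "'n vmeasure" and d :: nat and \<Lambda> :: real
  assumes V: "finite_varifold d V" and W: "finite_varifold d W"
    and massV: "mass V \<le> \<Lambda>" and massW: "mass W \<le> \<Lambda>"
begin

abbreviation "\<Delta> \<equiv> varifold_bl_dist d V W"

lemma mm_diff_le: "\<bar>mm V y - mm W y\<bar> \<le> (K + A) * \<Delta>"
  unfolding mm_eq[OF sets_V[OF V]] mm_eq[OF sets_V[OF W]]
proof (rule bl_dist_nonneg_function[OF V W])
  show "0 \<le> k (fst z - y) \<and> k (fst z - y) \<le> K" for z :: "(real^'n) \<times> (real^'n^'n)"
    using k_range by simp
  show "\<bar>k (fst z - y) - k (fst w - y)\<bar> \<le> A * vdist z w" for z w :: "(real^'n) \<times> (real^'n^'n)"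
    by (rule kernel_shift_lip)
qed (use nonneg in auto)

text \<open>A vector-valued integral is tested in the direction \<open>e\<close> of the difference
  itself. This scalar test function changes sign, hence \<open>3 A\<close> plus its Lipschitz
  constant \<open>A + B\<close>.\<close>

lemma fv_diff_le: "norm (fv V y - fv W y) \<le> (4 * A + B) * \<Delta>"
proof (cases "fv V y - fv W y = 0")
  case True
  then show ?thesis using varifold_bl_dist_nonneg[OF V W] nonneg by simp
next
  case False
  define w where "w = fv V y - fv W y"
  define e where "e = w /\<^sub>R norm w"
  have e: "norm e = 1" "w \<bullet> e = norm w"
    using False by (simp_all add: e_def w_def[symmetric] dot_square_norm power2_eq_square)
  let ?u = "\<lambda>z::(real^'n) \<times> (real^'n^'n). (snd z *v g (fst z - y)) \<bullet> e"
  have "\<bar>(LINT z|V. ?u z) - (LINT z|W. ?u z)\<bar> \<le> (3 * A + (A + B)) * \<Delta>"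
  proof (rule bl_dist_function[OF V W])
    fix z z' :: "(real^'n) \<times> (real^'n^'n)"
    assume z: "z \<in> UNIV \<times> grassmannian d" and z': "z' \<in> UNIV \<times> grassmannian d"
    show "\<bar>?u z\<bar> \<le> A"
      using Cauchy_Schwarz_ineq2[of "snd z *v g (fst z - y)" e] e
        order_trans[OF proj_gradient_le[OF z] g_le, of "fst z - y"] by simp
    show "\<bar>?u z - ?u z'\<bar> \<le> (A + B) * vdist z z'"
      unfolding inner_diff_left[symmetric]
      using Cauchy_Schwarz_ineq2[of "snd z *v g (fst z - y) - snd z' *v g (fst z' - y)" e]
        proj_gradient_shift_lip[OF z z', of y] e by simp
  qed (use nonneg in auto)
  moreover have "(LINT z|V. ?u z) = fv V y \<bullet> e" "(LINT z|W. ?u z) = fv W y \<bullet> e"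
    unfolding fv_eq using integrable_proj_gradient_shift[OF V] integrable_proj_gradient_shift[OF W]
    by (simp_all add: integral_inner_left)
  ultimately have "\<bar>w \<bullet> e\<bar> \<le> (3 * A + (A + B)) * \<Delta>"
    by (simp add: w_def inner_diff_left)
  then show ?thesis using e by (simp add: w_def)
qed

text \<open>The change of the denominator is written as a relative change times
  \<open>pmc W\<close>, for which the good bound is known. Estimating \<open>fv W\<close> over the
  product of both denominators by the lower bound \<open>\<epsilon>\<close> would lose
  powers.\<close>

lemma norm_pmc_diff_le: "norm (pmc V y - pmc W y) \<le> pmc_lip \<Lambda> * \<Delta>"
proof -
  define m where "m = mm V y + \<epsilon>"
  define m' where "m' = mm W y + \<epsilon>"
  have m: "\<epsilon> \<le> m" "\<epsilon> \<le> m'" "0 < m" "0 < m'"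
    using mm_nonneg[OF V, of y] mm_nonneg[OF W, of y] eps by (auto simp: m_def m'_def)
  have "pmc V y - pmc W y = - ((fv V y - fv W y) /\<^sub>R m) + ((m - m') / m) *\<^sub>R (- pmc W y)"
  proof -
    have "fv V y /\<^sub>R m = (fv V y - fv W y) /\<^sub>R m + fv W y /\<^sub>R m"
      by (simp add: scaleR_diff_right)
    moreover have "((m - m') / m) *\<^sub>R (fv W y /\<^sub>R m') = fv W y /\<^sub>R m' - fv W y /\<^sub>R m"
    proof -
      have "(m - m') / m * inverse m' = inverse m' - inverse m" using m by (simp add: field_simps)
      then show ?thesis by (simp add: scaleR_diff_left[symmetric])
    qed
    ultimately show ?thesis by (simp add: pre_mean_curvature_def m_def[symmetric] m'_def[symmetric])
  qed
  also have "norm \<dots> \<le> (4 * A + B) * \<Delta> / \<epsilon> + ((K + A) * \<Delta> / \<epsilon>) * pmc_bound \<Lambda>"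
  proof (rule norm_triangle_mono)
    have "norm ((fv V y - fv W y) /\<^sub>R m) = norm (fv V y - fv W y) / m"
      using m by (simp add: divide_inverse mult.commute)
    also have "\<dots> \<le> (4 * A + B) * \<Delta> / \<epsilon>"
      using m eps order_trans[OF norm_ge_zero fv_diff_le] by (intro frac_le fv_diff_le) auto
    finally show "norm (- ((fv V y - fv W y) /\<^sub>R m)) \<le> (4 * A + B) * \<Delta> / \<epsilon>" by simp
    have "\<bar>m - m'\<bar> \<le> (K + A) * \<Delta>" using mm_diff_le[of y] by (simp add: m_def m'_def)
    then have hq: "\<bar>(m - m') / m\<bar> \<le> (K + A) * \<Delta> / \<epsilon>"
      using m eps by (simp add: abs_divide) (intro frac_le, auto)
    show "norm (((m - m') / m) *\<^sub>R (- pmc W y)) \<le> ((K + A) * \<Delta> / \<epsilon>) * pmc_bound \<Lambda>"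
      unfolding norm_scaleR norm_minus_cancel
      by (rule mult_mono[OF hq norm_pmc_le[OF W massW] order_trans[OF abs_ge_zero hq] norm_ge_zero])
  qed
  also have "\<dots> = pmc_lip \<Lambda> * \<Delta>" by (simp add: pmc_lip_def add_divide_distrib algebra_simps)
  finally show ?thesis .
qed

text \<open>Convolution is linear in the field, so the bounds for one bounded field apply to the
  difference. The derivative costs the \<open>L^1\<close> norm of the kernel gradient, not its
  height.\<close>

lemma mean_curvature_diff:
  "norm (conv (pmc V) x - conv (pmc W) x) \<le> pmc_lip \<Lambda> * \<Delta>"
  "norm (dconv (pmc V) x v - dconv (pmc W) x v) \<le> pmc_lip \<Lambda> * \<Delta> * (a + b * \<omega>) * norm v"
proof -
  note m = pmc_meas[OF V] pmc_meas[OF W]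
  note c = conv_diff[OF m(1) norm_pmc_le[OF V massV] m(2) norm_pmc_le[OF W massW]]
  have m': "(\<lambda>y. pmc V y - pmc W y) \<in> borel_measurable borel" using m by measurable
  show "norm (conv (pmc V) x - conv (pmc W) x) \<le> pmc_lip \<Lambda> * \<Delta>"
    unfolding c by (rule norm_conv_le[OF m' norm_pmc_diff_le])
  show "norm (dconv (pmc V) x v - dconv (pmc W) x v) \<le> pmc_lip \<Lambda> * \<Delta> * (a + b * \<omega>) * norm v"
    unfolding c by (rule norm_dconv_le[OF m' norm_pmc_diff_le])
qed

end

end

subsection \<open>One step of the flow\<close>

text \<open>\<open>\<kappa>\<close> is a Lipschitz constant of \<open>h\<close> and
  \<open>\<eta>\<close> one of its derivative. Carrying the derivative \<open>L\<close> as data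
  keeps \<open>frechet_derivative\<close> out of the estimates.\<close>

definition C11_field :: "real \<Rightarrow> real \<Rightarrow> (real^'n \<Rightarrow> real^'n) \<Rightarrow> (real^'n \<Rightarrow> real^'n \<Rightarrow> real^'n) \<Rightarrow> bool" where
  "C11_field \<kappa> \<eta> h L \<longleftrightarrow> (\<forall>x. (h has_derivative L x) (at x)) \<and>
     (\<forall>x v. norm (L x v) \<le> \<kappa> * norm v) \<and>
     (\<forall>x x' v. norm (L x v - L x' v) \<le> \<eta> * norm (x - x') * norm v)"

definition step_map :: "real \<Rightarrow> (real^'n \<Rightarrow> real^'n) \<Rightarrow> (real^'n \<Rightarrow> real^'n \<Rightarrow> real^'n) \<Rightarrow>
    (real^'n) \<times> (real^'n^'n) \<Rightarrow> (real^'n) \<times> (real^'n^'n)" where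
  "step_map s h L z = (fst z + s *\<^sub>R h (fst z),
     orth_proj ((\<lambda>v. v + s *\<^sub>R L (fst z) v) ` plane (snd z)))"

text \<open>The condition \<open>small\<close> bounds the derivative and its variation at once: its
  \<open>\<kappa>\<close> part is the smallness required by the Jacobian estimates, and the whole
  absorbs the quadratic terms of the one-step estimate. \<open>n_type\<close> fixes the dimension
  that enters \<open>D\<close>.\<close>

locale step =
  fixes n_type :: "'n::finite itself" and s \<kappa> \<eta> D :: real
  assumes s: "0 \<le> s" and \<kappa>: "0 \<le> \<kappa>" and \<eta>: "0 \<le> \<eta>"
    and D_def: "D = det_const CARD('n)"
    and small: "6 * D * (s * (\<kappa> + \<eta>)) \<le> 1"
begin

lemma D: "1 \<le> D"
  unfolding D_def by (rule det_const_ge) simp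

lemma step_bounds: "0 \<le> s * \<kappa>" "s * \<kappa> \<le> 1 / 6" "0 \<le> s * \<eta>" "s * \<eta> \<le> 1 / 6"
  "6 * det_const CARD('n) * (s * \<kappa>) \<le> 1" "s * \<kappa> \<le> D * (s * \<kappa>)" "s * \<eta> \<le> D * (s * \<eta>)"
  "6 * (D * (s * \<kappa>)) + 6 * (D * (s * \<eta>)) \<le> 1"
proof -
  show 1: "0 \<le> s * \<kappa>" "0 \<le> s * \<eta>" using s \<kappa> \<eta> by auto
  show 2: "s * \<kappa> \<le> D * (s * \<kappa>)" "s * \<eta> \<le> D * (s * \<eta>)"
    using 1 D mult_right_mono[of 1 D] by fastforce+
  show 3: "6 * (D * (s * \<kappa>)) + 6 * (D * (s * \<eta>)) \<le> 1"
    using small by (simp add: algebra_simps)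
  show "s * \<kappa> \<le> 1 / 6" "s * \<eta> \<le> 1 / 6" using 1 2 3 by linarith+
  have "6 * (D * (s * \<kappa>)) \<le> 1" using 1 2 3 by linarith
  then show "6 * det_const CARD('n) * (s * \<kappa>) \<le> 1" unfolding D_def[symmetric] by (simp add: mult.assoc)
qed

context
  fixes h :: "real^'n \<Rightarrow> real^'n" and L
  assumes h: "C11_field \<kappa> \<eta> h L"
begin

lemma h_deriv: "(h has_derivative L x) (at x)"
  and L_le: "norm (L x v) \<le> \<kappa> * norm v"
  and L_lip: "norm (L x v - L x' v) \<le> \<eta> * norm (x - x') * norm v"
  using h by (auto simp: C11_field_def)

lemma L_linear: "linear (L x)"
  using h_deriv by (rule has_derivative_linear)

lemma h_lip: "norm (h x - h y) \<le> \<kappa> * norm (x - y)"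
proof (rule differentiable_bound[of UNIV h L])
  show "onorm (L x) \<le> \<kappa>" for x by (rule onorm_le) (rule L_le)
qed (use h_deriv in \<open>auto intro: has_derivative_at_withinI\<close>)

lemma step_deriv: "((\<lambda>x. x + s *\<^sub>R h x) has_derivative (\<lambda>v. v + s *\<^sub>R L x v)) (at x)"
  by (auto intro!: derivative_eq_intros h_deriv)

lemma step_linear: "linear (\<lambda>v. v + s *\<^sub>R L x v)"
  by (intro linear_compose_add linear_ident linear_compose_scale_right L_linear)

lemma step_inj: "inj (\<lambda>v. v + s *\<^sub>R L x v)"
proof (subst linear_injective_0[OF step_linear], safe)
  fix v assume e: "v + s *\<^sub>R L x v = 0"
  then have "norm v = norm (s *\<^sub>R L x v)" by (metis add_eq_0_iff norm_minus_cancel)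
  also have "\<dots> \<le> s * (\<kappa> * norm v)" using s L_le[of x v] by (simp add: mult_left_mono)
  also have "\<dots> = (s * \<kappa>) * norm v" by simp
  also have "\<dots> \<le> (1 / 6) * norm v" using step_bounds by (intro mult_right_mono) auto
  finally show "v = 0" by simp
qed

lemma step_map_in: "z \<in> UNIV \<times> grassmannian d \<Longrightarrow> step_map s h L z \<in> UNIV \<times> grassmannian d"
  unfolding step_map_def using orth_proj_image_grassmannian[OF _ step_linear step_inj] by auto

abbreviation "J \<equiv> \<lambda>z::(real^'n) \<times> (real^'n^'n). jac s (L (fst z)) (snd z)"

lemma J_bounds:
  assumes "z \<in> UNIV \<times> grassmannian d"
  shows "0 \<le> J z" "J z \<le> 1 + 3 * (D * (s * \<kappa>))"
proof -
  have S: "orthogonal_projection (snd z)" using assms by (auto simp: grassmannian_iff)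
  show "0 \<le> J z" by (rule jac_nonneg[OF s step_bounds(5) \<kappa> S L_le])
  show "J z \<le> 1 + 3 * (D * (s * \<kappa>))"
    using jac_le[OF s step_bounds(5) \<kappa> S L_le] by (simp add: D_def mult.assoc)
qed

lemma J_le_2: "z \<in> UNIV \<times> grassmannian d \<Longrightarrow> J z \<le> 2"
  using J_bounds(2)[of z d] step_bounds by linarith

end

text \<open>Serves two purposes: with one field and two points it yields the Lipschitz constant of
  the step map, with one point and two fields the effect of changing the field.\<close>

lemma step_map_dist:
  fixes h h' :: "real^'n \<Rightarrow> real^'n"
  assumes h: "C11_field \<kappa> \<eta> h L" and h': "C11_field \<kappa> \<eta> h' L'"
    and z: "z \<in> UNIV \<times> grassmannian d" and w: "w \<in> UNIV \<times> grassmannian d"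
    and p: "norm (h (fst z) - h' (fst w)) \<le> p"
    and q: "\<And>v. norm (L (fst z) v - L' (fst w) v) \<le> q * norm v"
  shows "vdist (step_map s h L z) (step_map s h' L' w)
     \<le> norm (fst z - fst w) + s * p + (1 + 3 * (s * \<kappa>)) * onorm (\<lambda>v. (snd z - snd w) *v v) + 2 * (s * q)"
proof -
  define c where "c = onorm (\<lambda>v. (snd z - snd w) *v v)"
  have c: "0 \<le> c" unfolding c_def by (rule onorm_pos_le) simp
  have q0: "0 \<le> q"
    using order_trans[OF norm_ge_zero q[of "axis undefined 1"]] by (simp add: norm_axis_1)
  have G: "snd z \<in> grassmannian d" "snd w \<in> grassmannian d" using z w by auto
  have sk1: "s * \<kappa> < 1" using step_bounds by linarith
  have 1: "norm (fst (step_map s h L z) - fst (step_map s h' L' w)) \<le> norm (fst z - fst w) + s * p"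
  proof -
    have "fst (step_map s h L z) - fst (step_map s h' L' w) = (fst z - fst w) + s *\<^sub>R (h (fst z) - h' (fst w))"
      by (simp add: step_map_def algebra_simps)
    moreover have "norm (s *\<^sub>R (h (fst z) - h' (fst w))) \<le> s * p" using s p by (simp add: mult_left_mono)
    ultimately show ?thesis by (simp add: norm_triangle_le)
  qed
  have "onorm (\<lambda>v. (snd (step_map s h L z) - snd (step_map s h' L' w)) *v v)
      \<le> ((1 + s * \<kappa>) * c + s * q) / (1 - s * \<kappa>)"
    unfolding step_map_def snd_conv c_def
    by (rule orth_proj_image_dist_le[OF G L_linear[OF h] L_linear[OF h'] s sk1 L_le[OF h] L_le[OF h'] q])
  also have "\<dots> \<le> (1 + 3 * (s * \<kappa>)) * c + 2 * (s * q)"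
  proof -
    \<comment> \<open>With \<open>u \<le> 1 / 6\<close> the denominator can be cleared:
      \<open>(1 + u) / (1 - u) \<le> 1 + 3 u\<close> and \<open>1 / (1 - u) \<le> 2\<close>.\<close>
    define u where "u = s * \<kappa>"
    have u: "0 \<le> u" "u \<le> 1 / 6" using step_bounds by (auto simp: u_def)
    have "u * u \<le> u * (1 / 6)" using u by (intro mult_left_mono) auto
    then have "1 + u \<le> (1 + 3 * u) * (1 - u)" using u by (simp add: algebra_simps)
    then have "(1 + u) * c \<le> (1 + 3 * u) * (1 - u) * c" using c by (rule mult_right_mono)
    moreover have "s * q * 1 \<le> s * q * (2 * (1 - u))" using u s q0 by (intro mult_left_mono) auto
    ultimately have "(1 + u) * c + s * q \<le> ((1 + 3 * u) * c + 2 * (s * q)) * (1 - u)"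
      by (simp add: algebra_simps)
    then show ?thesis unfolding u_def[symmetric] using u by (simp add: pos_divide_le_eq)
  qed
  finally show ?thesis using 1 unfolding vdist_def c_def by simp
qed

lemma J_dist:
  fixes h h' :: "real^'n \<Rightarrow> real^'n"
  assumes h: "C11_field \<kappa> \<eta> h L" and h': "C11_field \<kappa> \<eta> h' L'"
    and z: "z \<in> UNIV \<times> grassmannian d" and w: "w \<in> UNIV \<times> grassmannian d"
    and q: "\<And>v. norm (L (fst z) v - L' (fst w) v) \<le> q * norm v"
  shows "\<bar>J L z - J L' w\<bar> \<le> 6 * D * s * (q + \<kappa> * onorm (\<lambda>v. (snd z - snd w) *v v))"
  unfolding D_def
  by (rule jac_diff_le[OF s step_bounds(5) \<kappa> _ _ L_le[OF h] L_le[OF h'] L_linear[OF h'] q])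
    (use z w in \<open>auto simp: grassmannian_iff intro: onorm_matrix\<close>)

context
  fixes h :: "real^'n \<Rightarrow> real^'n" and L
  assumes h: "C11_field \<kappa> \<eta> h L"
begin

lemma step_map_lip:
  assumes z: "z \<in> UNIV \<times> grassmannian d" and w: "w \<in> UNIV \<times> grassmannian d"
  shows "vdist (step_map s h L z) (step_map s h L w) \<le> (1 + 3 * (s * (\<kappa> + \<eta>))) * vdist z w"
proof -
  define r where "r = norm (fst z - fst w)"
  define c where "c = onorm (\<lambda>v. (snd z - snd w) *v v)"
  have rc: "0 \<le> r" "0 \<le> c" unfolding r_def c_def by (auto intro: onorm_pos_le)
  have "vdist (step_map s h L z) (step_map s h L w) \<le> r + s * (\<kappa> * r) + (1 + 3 * (s * \<kappa>)) * c + 2 * (s * (\<eta> * r))"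
    unfolding r_def c_def by (rule step_map_dist[OF h h z w h_lip[OF h] L_lip[OF h]])
  moreover have "s * \<kappa> * r \<ge> 0" "s * \<eta> * r \<ge> 0" "s * \<eta> * c \<ge> 0" using step_bounds rc by auto
  ultimately show ?thesis
    unfolding vdist_def r_def[symmetric] c_def[symmetric] by (simp add: algebra_simps)
qed

lemma J_lip:
  assumes z: "z \<in> UNIV \<times> grassmannian d" and w: "w \<in> UNIV \<times> grassmannian d"
  shows "\<bar>J L z - J L w\<bar> \<le> 6 * D * (s * (\<kappa> + \<eta>)) * vdist z w"
proof -
  define r where "r = norm (fst z - fst w)"
  define c where "c = onorm (\<lambda>v. (snd z - snd w) *v v)"
  have rc: "0 \<le> r" "0 \<le> c" unfolding r_def c_def by (auto intro: onorm_pos_le)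
  have "\<bar>J L z - J L w\<bar> \<le> 6 * D * s * (\<eta> * r + \<kappa> * c)"
    unfolding r_def c_def by (rule J_dist[OF h h z w L_lip[OF h]])
  also have "\<dots> \<le> 6 * D * s * ((\<kappa> + \<eta>) * (r + c))"
    using D s \<kappa> \<eta> rc by (intro mult_left_mono) (auto simp: algebra_simps)
  finally show ?thesis unfolding vdist_def r_def c_def by (simp add: mult.assoc)
qed

lemma cont_J: "continuous_on (UNIV \<times> grassmannian d) (J L)"
proof (rule continuous_on_vdist_lipschitz)
  show "norm (J L z - J L w) \<le> 6 * D * (s * (\<kappa> + \<eta>)) * vdist z w"
    if "z \<in> UNIV \<times> grassmannian d" "w \<in> UNIV \<times> grassmannian d" for z w
    unfolding real_norm_def by (rule J_lip[OF that])
  show "0 \<le> 6 * D * (s * (\<kappa> + \<eta>))" using D s \<kappa> \<eta> by simp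
qed

lemma cont_step_map: "continuous_on (UNIV \<times> grassmannian d) (step_map s h L)"
proof -
  let ?c = "1 + 3 * (s * (\<kappa> + \<eta>))"
  let ?N = "real CARD('n) * real CARD('n)"
  have c: "0 \<le> ?c" using s \<kappa> \<eta> by simp
  have "continuous_on (UNIV \<times> grassmannian d) (\<lambda>z. (fst (step_map s h L z), snd (step_map s h L z)))"
  proof (rule continuous_on_Pair)
    show "continuous_on (UNIV \<times> grassmannian d) (\<lambda>z. fst (step_map s h L z))"
      by (rule continuous_on_vdist_lipschitz[OF order_trans[OF vdist_ge_fst step_map_lip] c])
    \<comment> \<open>Here continuity refers to the library norm of matrices, hence the passage
      through \<open>norm_matrix_le_onorm\<close>.\<close>
    show "continuous_on (UNIV \<times> grassmannian d) (\<lambda>z. snd (step_map s h L z))"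
    proof (rule continuous_on_vdist_lipschitz)
      fix z w :: "(real^'n) \<times> (real^'n^'n)"
      assume zw: "z \<in> UNIV \<times> grassmannian d" "w \<in> UNIV \<times> grassmannian d"
      have "norm (snd (step_map s h L z) - snd (step_map s h L w))
        \<le> ?N * onorm (\<lambda>v. (snd (step_map s h L z) - snd (step_map s h L w)) *v v)"
        by (rule norm_matrix_le_onorm)
      also have "\<dots> \<le> ?N * (?c * vdist z w)"
        by (intro mult_left_mono order_trans[OF vdist_ge_snd step_map_lip[OF zw]]) simp
      finally show "norm (snd (step_map s h L z) - snd (step_map s h L w)) \<le> (?N * ?c) * vdist z w"
        by (simp add: mult.assoc)
    qed (use c in simp)
  qed
  then show ?thesis by simp
qed

context
  fixes V :: "'n vmeasure" and d :: nat
  assumes V: "finite_varifold d V"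
begin

lemma step_sets: "sets V = sets (varifold_space d)"
  using V by (simp add: finite_varifold_def)

lemma step_space: "space V = UNIV \<times> grassmannian d"
  by (rule space_finite_varifold[OF step_sets])

lemma J_meas: "J L \<in> borel_measurable V"
  by (rule measurable_varifold_continuous[OF step_sets cont_J])

lemma step_map_meas: "step_map s h L \<in> measurable V (varifold_space d)"
  unfolding varifold_space_def
  by (rule measurable_restrict_space2)
    (use step_map_in[OF h] measurable_varifold_continuous[OF step_sets cont_step_map] in \<open>auto simp: step_space\<close>)

abbreviation "V' \<equiv> pushforward d (\<lambda>x. x + s *\<^sub>R h x) V"

text \<open>The density in the definition hides a choice of bases, so its measurability is not
  visible. It agrees on the space of \<open>V\<close> with the continuous \<open>J L\<close> and
  inherits measurability from there.\<close>

lemma pushforward_eq: "V' = distr (density V (\<lambda>z. ennreal (J L z))) (varifold_space d) (step_map s h L)"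
proof -
  have fd: "frechet_derivative (\<lambda>x. x + s *\<^sub>R h x) (at x) = (\<lambda>v. v + s *\<^sub>R L x v)" for x
    using frechet_derivative_at[OF step_deriv[OF h]] by simp
  have m: "(\<lambda>(x, S). (x + s *\<^sub>R h x, orth_proj (frechet_derivative (\<lambda>x. x + s *\<^sub>R h x) (at x) ` plane S)))
      = step_map s h L"
    by (auto simp: step_map_def fd)
  have t: "(\<lambda>(x, S). ennreal (tangential_jacobian d (\<lambda>x. x + s *\<^sub>R h x) x S)) z = ennreal (J L z)"
    if "z \<in> space V" for z
    using that tangential_jacobian_eq[OF _ step_deriv[OF h]] unfolding step_space
    by (auto simp: jac_def)
  have "density V (\<lambda>(x, S). ennreal (tangential_jacobian d (\<lambda>x. x + s *\<^sub>R h x) x S))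
      = density V (\<lambda>z. ennreal (J L z))"
  proof (rule density_cong)
    show J: "(\<lambda>z. ennreal (J L z)) \<in> borel_measurable V" using J_meas by measurable
    show "(\<lambda>(x, S). ennreal (tangential_jacobian d (\<lambda>x. x + s *\<^sub>R h x) x S)) \<in> borel_measurable V"
      by (rule measurable_cong[THEN iffD2, OF t J])
    show "AE z in V. (\<lambda>(x, S). ennreal (tangential_jacobian d (\<lambda>x. x + s *\<^sub>R h x) x S)) z = ennreal (J L z)"
      using t by (rule AE_I2)
  qed
  then show ?thesis unfolding pushforward_def m by simp
qed

lemma sets_pushforward: "sets V' = sets (varifold_space d)"
  unfolding pushforward_eq by simp

lemma integral_pushforward:
  fixes \<phi> :: "_ \<Rightarrow> real"
  assumes "continuous_on (UNIV \<times> grassmannian d) \<phi>"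
  shows "(LINT z|V'. \<phi> z) = (LINT z|V. J L z * \<phi> (step_map s h L z))"
proof -
  have m: "step_map s h L \<in> measurable (density V (\<lambda>z. ennreal (J L z))) (varifold_space d)"
    using step_map_meas by simp
  have \<phi>: "\<phi> \<in> borel_measurable (varifold_space d)"
    by (rule measurable_varifold_continuous[OF refl assms])
  have "(LINT z|V'. \<phi> z) = (LINT z|density V (\<lambda>z. ennreal (J L z)). \<phi> (step_map s h L z))"
    unfolding pushforward_eq by (rule integral_distr[OF m \<phi>])
  also have "\<dots> = (LINT z|V. J L z *\<^sub>R \<phi> (step_map s h L z))"
  proof (rule integral_density)
    show "(\<lambda>z. \<phi> (step_map s h L z)) \<in> borel_measurable V"
      by (rule measurable_compose[OF step_map_meas \<phi>])
    show "AE z in V. 0 \<le> J L z" by (intro AE_I2) (use J_bounds(1)[OF h] in \<open>auto simp: step_space\<close>)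
  qed (rule J_meas)
  finally show ?thesis by simp
qed

lemma finite_pushforward: "finite_varifold d V'"
proof -
  interpret finite_measure V using V by (simp add: finite_varifold_def)
  have "finite_measure (density V (\<lambda>z. ennreal (J L z)))"
  proof (rule finite_measureI)
    have "emeasure (density V (\<lambda>z. ennreal (J L z))) (space V) = (\<integral>\<^sup>+z. ennreal (J L z) * indicator (space V) z \<partial>V)"
      using J_meas by (subst emeasure_density) auto
    also have "\<dots> \<le> (\<integral>\<^sup>+z. ennreal 2 \<partial>V)"
      by (intro nn_integral_mono) (use J_le_2[OF h] in \<open>auto simp: step_space indicator_def intro!: ennreal_leI simp del: ennreal_numeral\<close>)
    also have "\<dots> = ennreal (2 * measure V (space V))" by (simp add: emeasure_eq_measure ennreal_mult)
    also have "\<dots> < \<infinity>" by simp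
    finally show "emeasure (density V (\<lambda>z. ennreal (J L z))) (space (density V (\<lambda>z. ennreal (J L z)))) \<noteq> \<infinity>"
      by simp
  qed
  then have "finite_measure V'"
    unfolding pushforward_eq by (rule finite_measure.finite_measure_distr) (use step_map_meas in simp)
  then show ?thesis unfolding finite_varifold_def using sets_pushforward by simp
qed

lemma integrable_J: "integrable V (J L)"
  by (rule integrable_finite_varifold[OF V cont_J, where B = 2])
    (use J_bounds(1)[OF h] J_le_2[OF h] in auto)

lemma mass_pushforward: "mass V' = (LINT z|V. J L z)"
proof -
  interpret finite_measure V' using finite_pushforward by (simp add: finite_varifold_def)
  have "mass V' = (LINT z|V'. 1)" by (simp add: mass_def)
  also have "\<dots> = (LINT z|V. J L z)" by (subst integral_pushforward) auto
  finally show ?thesis .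
qed

text \<open>Integrate \<open>jac_expansion_le\<close>. The term linear in \<open>s\<close> is the
  integrated tangential divergence, which is nonpositive by assumption and is dropped.\<close>

lemma mass_pushforward_le:
  assumes "integrable V (\<lambda>z. \<Sum>i\<in>UNIV. L (fst z) (snd z *v axis i 1) \<bullet> (snd z *v axis i 1))"
    and "(LINT z|V. (\<Sum>i\<in>UNIV. L (fst z) (snd z *v axis i 1) \<bullet> (snd z *v axis i 1))) \<le> 0"
  shows "mass V' \<le> mass V + 5 * D * (s * \<kappa>)\<^sup>2 * mass V"
proof -
  interpret finite_measure V using V by (simp add: finite_varifold_def)
  define dvg where "dvg = (\<lambda>z::(real^'n) \<times> (real^'n^'n). \<Sum>i\<in>UNIV. L (fst z) (snd z *v axis i 1) \<bullet> (snd z *v axis i 1))"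
  have i: "integrable V dvg" using assms(1) by (simp add: dvg_def)
  have "mass V' \<le> (LINT z|V. ((1 + 5 * D * (s * \<kappa>)\<^sup>2) + s * dvg z))"
    unfolding mass_pushforward
  proof (rule integral_mono[OF integrable_J])
    fix z assume z: "z \<in> space V"
    then have S: "orthogonal_projection (snd z)" by (auto simp: step_space grassmannian_iff)
    show "J L z \<le> (1 + 5 * D * (s * \<kappa>)\<^sup>2) + s * dvg z"
      using jac_expansion_le[OF s step_bounds(5) \<kappa> S L_le[OF h, where x = "fst z"]]
      by (simp add: D_def dvg_def)
  qed (use i in auto)
  also have "\<dots> = (1 + 5 * D * (s * \<kappa>)\<^sup>2) * mass V + s * (LINT z|V. dvg z)"
    using i by (simp add: mass_def)
  also have "s * (LINT z|V. dvg z) \<le> 0"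
    using assms(2) s by (simp add: dvg_def mult_nonneg_nonpos)
  finally show ?thesis by (simp add: algebra_simps)
qed

end

end

text \<open>With \<open>u\<close> and \<open>u'\<close> the test function pulled back by the two
  steps and weighted by the Jacobians, the difference is
  \<open>\<integral>u dV - \<integral>u dW\<close> plus \<open>\<integral>(u - u') dW\<close>. In
  the first part \<open>u\<close> is itself nearly a test function; the second only sees the
  difference of the fields and costs the mass of \<open>W\<close>.\<close>

lemma bl_dist_pushforward_le:
  fixes h h' :: "real^'n \<Rightarrow> real^'n" and V W :: "'n vmeasure"
  assumes h: "C11_field \<kappa> \<eta> h L" and h': "C11_field \<kappa> \<eta> h' L'"
    and V: "finite_varifold d V" and W: "finite_varifold d W"
    and p: "\<And>x. norm (h x - h' x) \<le> p"
    and q: "\<And>x v. norm (L x v - L' x v) \<le> q * norm v"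
  shows "varifold_bl_dist d (pushforward d (\<lambda>x. x + s *\<^sub>R h x) V) (pushforward d (\<lambda>x. x + s *\<^sub>R h' x) W)
    \<le> (1 + 15 * D * (s * (\<kappa> + \<eta>))) * varifold_bl_dist d V W + 10 * D * (s * (p + q)) * mass W"
    (is "_ \<le> ?R")
  unfolding varifold_bl_dist_eq[of d "pushforward d _ V"]
proof (rule cSUP_least)
  show "bl_test d \<noteq> {}" using zero_in_bl_test by blast
  fix \<phi> :: "(real^'n) \<times> (real^'n^'n) \<Rightarrow> real" assume \<phi>: "\<phi> \<in> bl_test d"
  have \<phi>c: "continuous_on (UNIV \<times> grassmannian d) \<phi>" using \<phi> by (simp add: bl_test_def)
  have \<phi>01: "0 \<le> \<phi> z" "\<phi> z \<le> 1" if "z \<in> UNIV \<times> grassmannian d" for z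
    using \<phi> that by (auto simp: bl_test_def)
  have \<phi>l: "\<bar>\<phi> z - \<phi> w\<bar> \<le> vdist z w"
    if "z \<in> UNIV \<times> grassmannian d" "w \<in> UNIV \<times> grassmannian d" for z w
    using \<phi> that unfolding bl_test_def by blast
  have p0: "0 \<le> p" using order_trans[OF norm_ge_zero p] .
  have q0: "0 \<le> q"
    using order_trans[OF norm_ge_zero q[of undefined "axis undefined 1"]] by (simp add: norm_axis_1)
  define \<tau> where "\<tau> = s * (\<kappa> + \<eta>)"
  have \<tau>: "0 \<le> \<tau>" "6 * (D * \<tau>) \<le> 1" "s * \<kappa> \<le> \<tau>" "\<tau> \<le> D * \<tau>"
    using s \<kappa> \<eta> small D mult_right_mono[of 1 D \<tau>] by (auto simp: \<tau>_def algebra_simps)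
  define u where "u = (\<lambda>z. J L z * \<phi> (step_map s h L z))"
  define u' where "u' = (\<lambda>z. J L' z * \<phi> (step_map s h' L' z))"
  have J\<tau>: "J L z \<le> 1 + 3 * (D * \<tau>)" if "z \<in> UNIV \<times> grassmannian d" for z
    using J_bounds(2)[OF h that] mult_left_mono[OF \<tau>(3), of D] D by linarith
  have cont_u: "continuous_on (UNIV \<times> grassmannian d) (\<lambda>z. J L z * \<phi> (step_map s h L z))"
    if "C11_field \<kappa> \<eta> h L" for h L
  proof (rule continuous_on_mult[OF cont_J[OF that]])
    show "continuous_on (UNIV \<times> grassmannian d) (\<lambda>z. \<phi> (step_map s h L z))"
      by (rule continuous_on_compose2[OF \<phi>c cont_step_map[OF that]]) (use step_map_in[OF that] in blast)
  qed
  have bd: "\<bar>J L z * \<phi> (step_map s h L z)\<bar> \<le> 2"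
    if "C11_field \<kappa> \<eta> h L" "z \<in> UNIV \<times> grassmannian d" for h L z
    using J_bounds(1)[OF that] J_le_2[OF that] \<phi>01[OF step_map_in[OF that]] mult_mono[of "J L z" 2 "\<phi> (step_map s h L z)" 1]
    by simp
  have iu: "integrable W u" "integrable W u'"
    unfolding u_def u'_def
    by (rule integrable_finite_varifold[OF W cont_u[OF h], where B = 2];
        use bd[OF h] in simp)
      (rule integrable_finite_varifold[OF W cont_u[OF h'], where B = 2];
        use bd[OF h'] in simp)
  have 1: "\<bar>(LINT z|V. u z) - (LINT z|W. u z)\<bar> \<le> (1 + 15 * (D * \<tau>)) * varifold_bl_dist d V W"
  proof (rule bl_dist_nonneg_function[OF V W, where A = "1 + 3 * (D * \<tau>)" and B = "1 + 15 * (D * \<tau>)"])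
    fix z :: "(real^'n) \<times> (real^'n^'n)" assume z: "z \<in> UNIV \<times> grassmannian d"
    show "0 \<le> u z \<and> u z \<le> 1 + 3 * (D * \<tau>)"
      using J_bounds(1)[OF h z] J\<tau>[OF z] \<phi>01[OF step_map_in[OF h z]]
        mult_mono[of "J L z" "1 + 3 * (D * \<tau>)" "\<phi> (step_map s h L z)" 1]
      by (simp add: u_def)
    fix w :: "(real^'n) \<times> (real^'n^'n)" assume w: "w \<in> UNIV \<times> grassmannian d"
    have "u z - u w = J L z * (\<phi> (step_map s h L z) - \<phi> (step_map s h L w))
         + (J L z - J L w) * \<phi> (step_map s h L w)"
      by (simp add: u_def algebra_simps)
    moreover have "\<bar>J L z * (\<phi> (step_map s h L z) - \<phi> (step_map s h L w))\<bar>
        \<le> (1 + 3 * (D * \<tau>)) * ((1 + 3 * \<tau>) * vdist z w)"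
      unfolding abs_mult
    proof (rule mult_mono)
      show "\<bar>J L z\<bar> \<le> 1 + 3 * (D * \<tau>)" using J_bounds(1)[OF h z] J\<tau>[OF z] by simp
      show "\<bar>\<phi> (step_map s h L z) - \<phi> (step_map s h L w)\<bar> \<le> (1 + 3 * \<tau>) * vdist z w"
        using \<phi>l[OF step_map_in[OF h z] step_map_in[OF h w]] step_map_lip[OF h z w] by (simp add: \<tau>_def)
    qed (use \<tau> in auto)
    moreover have "\<bar>(J L z - J L w) * \<phi> (step_map s h L w)\<bar> \<le> (6 * (D * \<tau>) * vdist z w) * 1"
      unfolding abs_mult
    proof (rule mult_mono)
      show "\<bar>J L z - J L w\<bar> \<le> 6 * (D * \<tau>) * vdist z w" using J_lip[OF h z w] by (simp add: \<tau>_def mult.assoc)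
      show "\<bar>\<phi> (step_map s h L w)\<bar> \<le> 1" using \<phi>01[OF step_map_in[OF h w]] by simp
    qed (use \<tau> vdist_nonneg[of z w] D in auto)
    \<comment> \<open>Origin of 15: 3 from the Jacobian bound, 6 from its Lipschitz constant, 3 from
      the step map, and 3 from the product term \<open>9 D \<tau> \<tau>\<close>, absorbed because
      \<open>3 D \<tau> \<le> 1\<close>.\<close>
    moreover have "(1 + 3 * (D * \<tau>)) * ((1 + 3 * \<tau>) * vdist z w) + (6 * (D * \<tau>) * vdist z w) * 1
        \<le> (1 + 15 * (D * \<tau>)) * vdist z w"
    proof -
      have "3 * (D * \<tau>) * (3 * \<tau>) \<le> 1 * (3 * \<tau>)" using \<tau> by (intro mult_right_mono) auto
      then have "(1 + 3 * (D * \<tau>)) * (1 + 3 * \<tau>) + 6 * (D * \<tau>) \<le> 1 + 15 * (D * \<tau>)"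
        using \<tau> by (simp add: algebra_simps)
      from mult_right_mono[OF this vdist_nonneg[of z w]] show ?thesis by (simp add: algebra_simps)
    qed
    ultimately show "\<bar>u z - u w\<bar> \<le> (1 + 15 * (D * \<tau>)) * vdist z w" by linarith
  qed (use \<tau> in auto)
  have 2: "norm (LINT z|W. u z - u' z) \<le> (10 * D * (s * (p + q))) * mass W"
  proof (rule norm_integral_finite_varifold_le[OF W])
    show "continuous_on (UNIV \<times> grassmannian d) (\<lambda>z. u z - u' z)"
      unfolding u_def u'_def by (intro continuous_on_diff cont_u h h')
    fix z :: "(real^'n) \<times> (real^'n^'n)" assume z: "z \<in> UNIV \<times> grassmannian d"
    \<comment> \<open>Both fields are compared at the same \<open>z\<close>, so all terms measuring
      the distance of planes vanish.\<close>
    have o0: "onorm (\<lambda>v. (snd z - snd z) *v v) = 0" by (simp add: onorm_zero)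
    have "u z - u' z = J L' z * (\<phi> (step_map s h L z) - \<phi> (step_map s h' L' z))
         + (J L z - J L' z) * \<phi> (step_map s h L z)"
      by (simp add: u_def u'_def algebra_simps)
    moreover have "\<bar>J L' z * (\<phi> (step_map s h L z) - \<phi> (step_map s h' L' z))\<bar> \<le> 2 * (s * p + 2 * (s * q))"
      unfolding abs_mult
    proof (rule mult_mono)
      show "\<bar>J L' z\<bar> \<le> 2" using J_bounds(1)[OF h' z] J_le_2[OF h' z] by simp
      show "\<bar>\<phi> (step_map s h L z) - \<phi> (step_map s h' L' z)\<bar> \<le> s * p + 2 * (s * q)"
        using \<phi>l[OF step_map_in[OF h z] step_map_in[OF h' z]]
          step_map_dist[OF h h' z z p q] o0 by simp
    qed auto
    moreover have "\<bar>(J L z - J L' z) * \<phi> (step_map s h L z)\<bar> \<le> (6 * D * s * q) * 1"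
      unfolding abs_mult
    proof (rule mult_mono)
      show "\<bar>J L z - J L' z\<bar> \<le> 6 * D * s * q" using J_dist[OF h h' z z q] o0 by simp
      show "\<bar>\<phi> (step_map s h L z)\<bar> \<le> 1" using \<phi>01[OF step_map_in[OF h z]] by simp
    qed (use D s q0 in auto)
    moreover have "2 * (s * p + 2 * (s * q)) + (6 * D * s * q) * 1 \<le> 10 * D * (s * (p + q))"
    proof -
      have "s * p \<le> D * (s * p)" "s * q \<le> D * (s * q)"
        using D s p0 q0 mult_right_mono[of 1 D "s * p"] mult_right_mono[of 1 D "s * q"] by auto
      moreover have "0 \<le> D * (s * p)" using D s p0 by simp
      ultimately have "2 * (s * p) + 4 * (s * q) + 6 * (D * (s * q)) \<le> 10 * (D * (s * p)) + 10 * (D * (s * q))"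
        by linarith
      then show ?thesis by (simp add: algebra_simps)
    qed
    ultimately show "norm (u z - u' z) \<le> 10 * D * (s * (p + q))"
      unfolding real_norm_def by linarith
  qed
  have "(LINT z|pushforward d (\<lambda>x. x + s *\<^sub>R h x) V. \<phi> z) - (LINT z|pushforward d (\<lambda>x. x + s *\<^sub>R h' x) W. \<phi> z)
      = ((LINT z|V. u z) - (LINT z|W. u z)) + (LINT z|W. u z - u' z)"
    using iu by (simp add: integral_pushforward[OF h V \<phi>c] integral_pushforward[OF h' W \<phi>c] u_def u'_def)
  then show "\<bar>(LINT z|pushforward d (\<lambda>x. x + s *\<^sub>R h x) V. \<phi> z) - (LINT z|pushforward d (\<lambda>x. x + s *\<^sub>R h' x) W. \<phi> z)\<bar> \<le> ?R"
    using 1 2 unfolding \<tau>_def by (simp add: mult.assoc)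
qed

end

subsection \<open>Weak-star limits\<close>

text \<open>Weak-star convergence is tested on compactly supported functions only, while the
  distance uses test functions without decay. Multiplying by this cutoff raises the Lipschitz
  constant by \<open>1 / R\<close> only, which disappears as \<open>R\<close> grows.\<close>

definition radial_cutoff :: "real \<Rightarrow> (real^'n) \<times> (real^'n^'n) \<Rightarrow> real" where
  "radial_cutoff R z = max 0 (min 1 (2 - norm (fst z) / R))"

lemma radial_cutoff_range: "0 \<le> radial_cutoff R z" "radial_cutoff R z \<le> 1"
  by (auto simp: radial_cutoff_def)

lemma radial_cutoff_inside: "0 < R \<Longrightarrow> norm (fst z) \<le> R \<Longrightarrow> radial_cutoff R z = 1"
  by (simp add: radial_cutoff_def)

lemma radial_cutoff_outside: "0 < R \<Longrightarrow> 2 * R \<le> norm (fst z) \<Longrightarrow> radial_cutoff R z = 0"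
  by (simp add: radial_cutoff_def field_simps)

lemma radial_cutoff_cont: "continuous_on X (radial_cutoff R)"
  unfolding radial_cutoff_def divide_inverse by (intro continuous_intros)

lemma radial_cutoff_lip:
  assumes "0 < R"
  shows "\<bar>radial_cutoff R z - radial_cutoff R w\<bar> \<le> (1 / R) * vdist z w"
proof -
  have "\<bar>radial_cutoff R z - radial_cutoff R w\<bar> \<le> \<bar>norm (fst z) / R - norm (fst w) / R\<bar>"
    unfolding radial_cutoff_def by linarith
  also have "\<dots> = \<bar>norm (fst z) - norm (fst w)\<bar> / R"
    using assms by (simp add: diff_divide_distrib[symmetric])
  also have "\<dots> \<le> norm (fst z - fst w) / R"
    using assms by (intro divide_right_mono norm_triangle_ineq3) auto
  also have "\<dots> \<le> vdist z w / R" using assms by (intro divide_right_mono vdist_ge_fst) auto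
  finally show ?thesis by simp
qed

lemma radial_cutoff_compact_support:
  fixes \<phi> :: "(real^'n) \<times> (real^'n^'n) \<Rightarrow> real"
  assumes "0 < R"
  shows "\<exists>K. compact K \<and> (\<forall>z\<in>UNIV \<times> grassmannian d - K. radial_cutoff R z * \<phi> z = 0)"
proof (intro exI conjI ballI)
  show "compact (cball (0 :: real^'n) (2 * R) \<times> (grassmannian d :: (real^'n^'n) set))"
    by (intro compact_Times compact_cball compact_grassmannian)
  fix z :: "(real^'n) \<times> (real^'n^'n)"
  assume "z \<in> UNIV \<times> grassmannian d - cball 0 (2 * R) \<times> grassmannian d"
  then have "2 * R \<le> norm (fst z)" by auto
  from radial_cutoff_outside[OF assms this] show "radial_cutoff R z * \<phi> z = 0" by simp
qed

lemma weak_star_limit_cutoff: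
  assumes "weak_star_limit d Vs V" "continuous_on (UNIV \<times> grassmannian d) \<phi>" "0 < R"
  shows "(\<lambda>j. LINT z|Vs j. radial_cutoff R z * \<phi> z) \<longlonglongrightarrow> (LINT z|V. radial_cutoff R z * \<phi> z)"
  using assms(1) radial_cutoff_compact_support[OF assms(3), of d \<phi>]
    continuous_on_mult[OF radial_cutoff_cont assms(2)]
  unfolding weak_star_limit_def by blast

lemma varifold_ball_measurable:
  assumes "varifold d V"
  shows "cball 0 R \<times> grassmannian d \<in> sets V"
proof -
  have "cball 0 R \<times> grassmannian d = (UNIV \<times> grassmannian d) \<inter> (cball 0 R \<times> UNIV)" by auto
  moreover have "closed (cball 0 R \<times> UNIV :: ((real^'n) \<times> (real^'n^'n)) set)"
    by (intro closed_Times) auto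
  ultimately have "cball 0 R \<times> grassmannian d \<in> sets (varifold_space d)"
    unfolding varifold_space_def sets_restrict_space by (auto intro: borel_closed)
  then show ?thesis using assms by (simp add: varifold_def)
qed

text \<open>Lower semicontinuity of mass: every ball has mass at most the integral of the cutoff,
  hence at most \<Lambda>, and balls exhaust the space. Finiteness of the limit is what later
  permits dominated convergence.\<close>

lemma finite_varifold_weak_star_limit:
  fixes V :: "'n::finite vmeasure"
  assumes V: "varifold d V" and lim: "weak_star_limit d Vs V"
    and Vs: "\<And>j. finite_varifold d (Vs j)" and mass: "\<And>j. mass (Vs j) \<le> \<Lambda>"
  shows "finite_varifold d V"
proof -
  have sets: "sets V = sets (varifold_space d)" using V by (simp add: varifold_def)
  have space: "space V = UNIV \<times> grassmannian d" by (rule space_finite_varifold[OF sets])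
  have L: "0 \<le> \<Lambda>" using mass[of 0] mass_nonneg[of "Vs 0"] by simp
  let ?B = "\<lambda>R::real. cball (0 :: real^'n) R \<times> (grassmannian d :: (real^'n^'n) set)"
  have fin: "emeasure V (?B R) < \<infinity>" for R
  proof -
    have "compact (?B R)" by (intro compact_Times compact_cball compact_grassmannian)
    then show ?thesis using V by (auto simp: varifold_def)
  qed
  have le: "emeasure V (?B R) \<le> ennreal \<Lambda>" if R: "0 < R" for R
  proof -
    \<comment> \<open>Total finiteness of \<open>V\<close> is not yet known; integrability of the
      cutoff comes from the compact set that supports it.\<close>
    have i2: "integrable V (indicator (?B (2 * R)) :: _ \<Rightarrow> real)"
      using varifold_ball_measurable[OF V] fin by (intro integrable_real_indicator) auto
    have ic: "integrable V (radial_cutoff R)"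
    proof (rule Bochner_Integration.integrable_bound[OF i2])
      show "radial_cutoff R \<in> borel_measurable V"
        by (rule measurable_varifold_continuous[OF sets radial_cutoff_cont])
      show "AE z in V. norm (radial_cutoff R z) \<le> norm (indicator (?B (2 * R)) z :: real)"
      proof (rule AE_I2)
        fix z assume z: "z \<in> space V"
        show "norm (radial_cutoff R z) \<le> norm (indicator (?B (2 * R)) z :: real)"
        proof (cases "z \<in> ?B (2 * R)")
          case True
          then show ?thesis using radial_cutoff_range[of R z] by simp
        next
          case False
          then have "2 * R \<le> norm (fst z)" using z unfolding space by auto
          from radial_cutoff_outside[OF R this] show ?thesis by simp
        qed
      qed
    qed
    have "(LINT z|V. radial_cutoff R z * 1) \<le> \<Lambda>"
    proof (rule LIMSEQ_le_const2[OF weak_star_limit_cutoff[OF lim _ R]])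
      have "(LINT z|Vs j. radial_cutoff R z * 1) \<le> \<Lambda>" for j
      proof -
        have "norm (LINT z|Vs j. radial_cutoff R z) \<le> 1 * mass (Vs j)"
          by (rule norm_integral_finite_varifold_le[OF Vs radial_cutoff_cont])
            (simp add: radial_cutoff_range)
        then show ?thesis using mass[of j] by simp
      qed
      then show "\<exists>N. \<forall>j\<ge>N. (LINT z|Vs j. radial_cutoff R z * 1) \<le> \<Lambda>" by blast
    qed simp
    moreover have "measure V (?B R) \<le> (LINT z|V. radial_cutoff R z)"
    proof -
      have i1: "integrable V (indicator (?B R) :: _ \<Rightarrow> real)"
        using varifold_ball_measurable[OF V] fin by (intro integrable_real_indicator) auto
      have "(LINT z|V. indicator (?B R) z) \<le> (LINT z|V. radial_cutoff R z)"
      proof (rule integral_mono[OF i1 ic])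
        fix z
        show "indicator (?B R) z \<le> radial_cutoff R z"
          using radial_cutoff_inside[OF R, of z] radial_cutoff_range(1)[of R z]
          by (auto simp: indicator_def)
      qed
      then show ?thesis using varifold_ball_measurable[OF V, of R] fin by simp
    qed
    ultimately have "measure V (?B R) \<le> \<Lambda>" by simp
    then show ?thesis using fin[of R] L by (simp add: emeasure_eq_ennreal_measure ennreal_leI)
  qed
  \<comment> \<open>Radii \<open>Suc m\<close> rather than \<open>m\<close>, since \<open>le\<close>
    asks for a positive radius.\<close>
  have "(SUP m. emeasure V (?B (real (Suc m)))) = emeasure V (\<Union>m. ?B (real (Suc m)))"
  proof (rule SUP_emeasure_incseq)
    show "range (\<lambda>m. ?B (real (Suc m))) \<subseteq> sets V" using varifold_ball_measurable[OF V] by blast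
    show "incseq (\<lambda>m. ?B (real (Suc m)))" by (rule incseq_SucI) auto
  qed
  also have "(\<Union>m. ?B (real (Suc m))) = space V"
  proof -
    have "\<exists>m. norm x \<le> real (Suc m)" for x :: "real^'n"
      using real_arch_simple[of "norm x"] by (metis le_add_same_cancel2 of_nat_Suc order_trans zero_le_one)
    then show ?thesis unfolding space by auto
  qed
  finally have "emeasure V (space V) = (SUP m. emeasure V (?B (real (Suc m))))" by simp
  also have "\<dots> \<le> ennreal \<Lambda>" by (rule SUP_least) (rule le, simp)
  finally have "emeasure V (space V) \<noteq> \<infinity>" by (auto simp: top_unique)
  then show ?thesis unfolding finite_varifold_def using sets by (auto intro: finite_measureI)
qed

text \<open>Two limits in a fixed order: for a fixed radius, \<open>j\<close> tends to infinity and
  gives the bound \<open>(1 + 1 / R) C\<close> for the truncated test function; then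
  \<open>R\<close> tends to infinity by dominated convergence in the two limit measures.\<close>

lemma bl_dist_weak_star_limit:
  fixes V W :: "'n::finite vmeasure"
  assumes V: "varifold d V" and W: "varifold d W"
    and limV: "weak_star_limit d Vs V" and limW: "weak_star_limit d Ws W"
    and Vs: "\<And>j. finite_varifold d (Vs j)" and massV: "\<And>j. mass (Vs j) \<le> \<Lambda>"
    and Ws: "\<And>j. finite_varifold d (Ws j)" and massW: "\<And>j. mass (Ws j) \<le> \<Lambda>"
    and C: "\<And>j. varifold_bl_dist d (Vs j) (Ws j) \<le> C"
  shows "varifold_bl_dist d V W \<le> C"
  unfolding varifold_bl_dist_eq
proof (rule cSUP_least)
  show "bl_test d \<noteq> {}" using zero_in_bl_test by blast
  fix \<phi> :: "(real^'n) \<times> (real^'n^'n) \<Rightarrow> real" assume \<phi>: "\<phi> \<in> bl_test d"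
  have \<phi>c: "continuous_on (UNIV \<times> grassmannian d) \<phi>" using \<phi> by (simp add: bl_test_def)
  have \<phi>01: "0 \<le> \<phi> z" "\<phi> z \<le> 1" if "z \<in> UNIV \<times> grassmannian d" for z
    using \<phi> that by (auto simp: bl_test_def)
  have \<phi>l: "\<bar>\<phi> z - \<phi> w\<bar> \<le> vdist z w"
    if "z \<in> UNIV \<times> grassmannian d" "w \<in> UNIV \<times> grassmannian d" for z w
    using \<phi> that unfolding bl_test_def by blast
  have fV: "finite_varifold d V"
    by (rule finite_varifold_weak_star_limit[OF V limV Vs massV])
  have fW: "finite_varifold d W"
    by (rule finite_varifold_weak_star_limit[OF W limW Ws massW])
  let ?I = "\<lambda>m X. LINT z|X. radial_cutoff (real (Suc m)) z * \<phi> z"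
  have 1: "\<bar>?I m V - ?I m W\<bar> \<le> (1 + 1 / real (Suc m)) * C" for m
  proof (rule LIMSEQ_le_const2)
    have R: "0 < real (Suc m)" by simp
    show "(\<lambda>j. \<bar>?I m (Vs j) - ?I m (Ws j)\<bar>) \<longlonglongrightarrow> \<bar>?I m V - ?I m W\<bar>"
      by (intro tendsto_rabs tendsto_diff weak_star_limit_cutoff[OF _ \<phi>c R] limV limW)
    have "\<bar>?I m (Vs j) - ?I m (Ws j)\<bar> \<le> (1 + 1 / real (Suc m)) * C" for j
    proof -
      have "\<bar>?I m (Vs j) - ?I m (Ws j)\<bar> \<le> (1 + 1 / real (Suc m)) * varifold_bl_dist d (Vs j) (Ws j)"
      proof (rule bl_dist_nonneg_function[OF Vs Ws, where A = 1 and B = "1 + 1 / real (Suc m)"])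
        fix z :: "(real^'n) \<times> (real^'n^'n)" assume z: "z \<in> UNIV \<times> grassmannian d"
        let ?c = "radial_cutoff (real (Suc m))"
        show "0 \<le> ?c z * \<phi> z \<and> ?c z * \<phi> z \<le> 1"
          using radial_cutoff_range[of "real (Suc m)" z] \<phi>01[OF z] by (auto intro: mult_le_one)
        fix w :: "(real^'n) \<times> (real^'n^'n)" assume w: "w \<in> UNIV \<times> grassmannian d"
        have "?c z * \<phi> z - ?c w * \<phi> w = ?c z * (\<phi> z - \<phi> w) + (?c z - ?c w) * \<phi> w"
          by (simp add: algebra_simps)
        moreover have "\<bar>?c z * (\<phi> z - \<phi> w)\<bar> \<le> 1 * vdist z w"
          unfolding abs_mult using radial_cutoff_range[of "real (Suc m)" z] \<phi>l[OF z w]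
          by (intro mult_mono) auto
        moreover have "\<bar>(?c z - ?c w) * \<phi> w\<bar> \<le> ((1 / real (Suc m)) * vdist z w) * 1"
          unfolding abs_mult
          by (intro mult_mono radial_cutoff_lip[OF R]) (use \<phi>01[OF w] vdist_nonneg[of z w] in auto)
        ultimately show "\<bar>?c z * \<phi> z - ?c w * \<phi> w\<bar> \<le> (1 + 1 / real (Suc m)) * vdist z w"
          unfolding distrib_right by linarith
      qed (auto intro: add_pos_nonneg)
      also have "\<dots> \<le> (1 + 1 / real (Suc m)) * C" by (intro mult_left_mono C) simp
      finally show ?thesis .
    qed
    then show "\<exists>N. \<forall>j\<ge>N. \<bar>?I m (Vs j) - ?I m (Ws j)\<bar> \<le> (1 + 1 / real (Suc m)) * C" by blast
  qed
  have 2: "(\<lambda>m. ?I m X) \<longlonglongrightarrow> (LINT z|X. \<phi> z)" if X: "finite_varifold d X" for X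
  proof (rule integral_dominated_convergence[where w = "\<lambda>_. 1"])
    have sets: "sets X = sets (varifold_space d)" using X by (simp add: finite_varifold_def)
    have space: "space X = UNIV \<times> grassmannian d" by (rule space_finite_varifold[OF sets])
    show "\<phi> \<in> borel_measurable X" by (rule measurable_varifold_continuous[OF sets \<phi>c])
    show "(\<lambda>z. radial_cutoff (real (Suc m)) z * \<phi> z) \<in> borel_measurable X" for m
      by (rule measurable_varifold_continuous[OF sets continuous_on_mult[OF radial_cutoff_cont \<phi>c]])
    show "integrable X (\<lambda>_. 1 :: real)"
      using X by (simp add: finite_varifold_def finite_measure.integrable_const)
    show "AE z in X. norm (radial_cutoff (real (Suc m)) z * \<phi> z) \<le> 1" for m
      by (rule AE_I2) (use \<phi>01 space in \<open>auto simp: abs_mult radial_cutoff_range intro!: mult_le_one\<close>)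
    show "AE z in X. (\<lambda>m. radial_cutoff (real (Suc m)) z * \<phi> z) \<longlonglongrightarrow> \<phi> z"
    proof (rule AE_I2)
      fix z :: "(real^'n) \<times> (real^'n^'n)"
      obtain N :: nat where N: "norm (fst z) \<le> real N" using real_arch_simple by blast
      have "radial_cutoff (real (Suc m)) z * \<phi> z = \<phi> z" if "m \<ge> N" for m
        using radial_cutoff_inside[of "real (Suc m)" z] N that by simp
      then show "(\<lambda>m. radial_cutoff (real (Suc m)) z * \<phi> z) \<longlonglongrightarrow> \<phi> z"
        by (intro tendsto_eventually eventually_sequentiallyI[of N])
    qed
  qed
  have lhs: "(\<lambda>m. \<bar>?I m V - ?I m W\<bar>) \<longlonglongrightarrow> \<bar>(LINT z|V. \<phi> z) - (LINT z|W. \<phi> z)\<bar>"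
    by (intro tendsto_rabs tendsto_diff 2 fV fW)
  have rhs: "(\<lambda>m. (1 + 1 / real (Suc m)) * C) \<longlonglongrightarrow> (1 + 0) * C"
    by (intro tendsto_mult tendsto_add tendsto_const LIMSEQ_Suc[OF lim_1_over_n])
  show "\<bar>(LINT z|V. \<phi> z) - (LINT z|W. \<phi> z)\<bar> \<le> C"
    using LIMSEQ_le[OF lhs rhs] 1 by simp
qed

subsection \<open>Uniform subdivisions\<close>

text \<open>The defining property of \<open>approx_mcf\<close> holds for all admissible sequences of
  subdivisions, so equal steps may be chosen; then mass growth and rate are counted per
  step.\<close>

definition uniform_subdivision :: "nat \<Rightarrow> real list" where
  "uniform_subdivision N = map (\<lambda>i. real i / real N) [0..<Suc N]"

lemma uniform_subdivision_nth: "i \<le> N \<Longrightarrow> uniform_subdivision N ! i = real i / real N"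
  unfolding uniform_subdivision_def by (simp add: nth_append del: upt_Suc)

lemma uniform_subdivision:
  assumes N: "0 < N"
  shows "subdivision (uniform_subdivision N)" "mesh (uniform_subdivision N) = 1 / real N"
proof -
  let ?t = "uniform_subdivision N"
  have len: "length ?t = Suc N" by (simp add: uniform_subdivision_def)
  have ne: "?t \<noteq> []" using len by auto
  have "sorted_wrt (<) ?t"
    unfolding sorted_wrt_iff_nth_less len
    using N by (auto simp: uniform_subdivision_nth divide_strict_right_mono)
  moreover have "hd ?t = 0" using ne by (simp add: hd_conv_nth uniform_subdivision_nth)
  moreover have "last ?t = 1" using ne N by (simp add: last_conv_nth len uniform_subdivision_nth)
  ultimately show "subdivision ?t" using ne by (simp add: subdivision_def)
  have "(\<lambda>i. ?t ! Suc i - ?t ! i) ` {i. Suc i < length ?t} = {1 / real N}"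
  proof -
    have "?t ! Suc i - ?t ! i = 1 / real N" if "i < N" for i
      using that by (simp add: uniform_subdivision_nth diff_divide_distrib[symmetric])
    moreover have "{i. Suc i < length ?t} \<noteq> {}" using N len by auto
    ultimately show ?thesis using len by auto
  qed
  then show "mesh ?t = 1 / real N" by (simp add: mesh_def)
qed

subsection \<open>Stability of the flow\<close>

context mollifier
begin

definition lip_h :: "real \<Rightarrow> real" where "lip_h \<Lambda> = pmc_bound \<Lambda> * (a + b * \<omega>)"
definition lip_Dh :: "real \<Rightarrow> real" where "lip_Dh \<Lambda> = 2 * pmc_bound \<Lambda> * B * \<omega>"
text \<open>The first group is the cost of transporting test functions by the step. The second is
  the mass times the \<open>C^1\<close> Lipschitz constant of the curvature as a function of the
  varifold; it is the dominant one.\<close>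

definition growth_rate :: "real \<Rightarrow> real" where
  "growth_rate \<Lambda> = D * (15 * (lip_h \<Lambda> + lip_Dh \<Lambda>)
     + 10 * \<Lambda> * (pmc_lip \<Lambda> * (1 + (a + b * \<omega>))))"

end

context mollifier
begin

lemma \<omega>_pos: "0 < \<omega>"
  unfolding \<omega>_def by (rule unit_vol_pos)

lemma D_ge_1: "1 \<le> D"
  unfolding D_def by (rule det_const_ge) simp

lemma mean_curvature_C11:
  assumes "finite_varifold d V" "mass V \<le> \<Lambda>"
  shows "C11_field (lip_h \<Lambda>) (lip_Dh \<Lambda>) (approx_mean_curvature \<psi> \<epsilon> V) (dconv (pmc V))"
  unfolding C11_field_def mean_curvature_eq_conv lip_h_def lip_Dh_def
  using conv_has_derivative[OF pmc_meas[OF assms(1)] norm_pmc_le[OF assms]]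
    norm_dconv_le[OF pmc_meas[OF assms(1)] norm_pmc_le[OF assms]]
    dconv_lip[OF pmc_meas[OF assms(1)] norm_pmc_le[OF assms]]
  by simp

context
  fixes \<Lambda> :: real and d :: nat
  assumes \<Lambda>: "0 \<le> \<Lambda>"
begin

lemma rate_nonneg: "0 \<le> pmc_bound \<Lambda>" "0 \<le> lip_h \<Lambda>" "0 \<le> lip_Dh \<Lambda>" "0 \<le> pmc_lip \<Lambda>" "0 \<le> growth_rate \<Lambda>"
proof -
  have D: "1 \<le> D" by (rule D_ge_1)
  have w: "0 \<le> \<omega>" using \<omega>_pos by simp
  show 1: "0 \<le> pmc_bound \<Lambda>" unfolding pmc_bound_def using nonneg \<Lambda> eps by simp
  show 2: "0 \<le> lip_h \<Lambda>" unfolding lip_h_def using 1 nonneg w by simp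
  show 3: "0 \<le> lip_Dh \<Lambda>" unfolding lip_Dh_def using 1 nonneg w by simp
  show 4: "0 \<le> pmc_lip \<Lambda>" unfolding pmc_lip_def using 1 nonneg eps by simp
  show "0 \<le> growth_rate \<Lambda>" unfolding growth_rate_def using 2 3 4 D nonneg w \<Lambda> by simp
qed

context
  fixes s :: real
  assumes s: "0 \<le> s" and small: "6 * D * (s * (lip_h \<Lambda> + lip_Dh \<Lambda>)) \<le> 1"
begin

lemma step_locale: "step TYPE('n) s (lip_h \<Lambda>) (lip_Dh \<Lambda>) D"
  by unfold_locales (use s small rate_nonneg D_def in auto)

lemma flow_step_mass:
  assumes V: "finite_varifold d V" "mass V \<le> \<Lambda>"
  shows "finite_varifold d (flow_step \<psi> d \<epsilon> s V)"
    "mass (flow_step \<psi> d \<epsilon> s V) \<le> mass V + 5 * D * (lip_h \<Lambda>)\<^sup>2 * \<Lambda> * s\<^sup>2"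
proof -
  interpret step "TYPE('n)" s "lip_h \<Lambda>" "lip_Dh \<Lambda>" D by (rule step_locale)
  note C = mean_curvature_C11[OF V]
  show "finite_varifold d (flow_step \<psi> d \<epsilon> s V)"
    unfolding flow_step_def by (rule finite_pushforward[OF C V(1)])
  have "mass (flow_step \<psi> d \<epsilon> s V) \<le> mass V + 5 * D * (s * lip_h \<Lambda>)\<^sup>2 * mass V"
    unfolding flow_step_def
    by (rule mass_pushforward_le[OF C V(1) first_variation_mean_curvature[OF V]])
  also have "\<dots> \<le> mass V + 5 * D * (s * lip_h \<Lambda>)\<^sup>2 * \<Lambda>"
    using V(2) D_ge_1 by (intro add_left_mono mult_left_mono) auto
  finally show "mass (flow_step \<psi> d \<epsilon> s V) \<le> mass V + 5 * D * (lip_h \<Lambda>)\<^sup>2 * \<Lambda> * s\<^sup>2"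
    by (simp add: power_mult_distrib mult_ac)
qed

text \<open>Both field differences in \<open>bl_dist_pushforward_le\<close> are themselves multiples
  of the distance of \<open>V\<close> and \<open>W\<close>, so the estimate closes into a single
  factor.\<close>

lemma flow_step_bl_dist:
  assumes V: "finite_varifold d V" "mass V \<le> \<Lambda>" and W: "finite_varifold d W" "mass W \<le> \<Lambda>"
  shows "varifold_bl_dist d (flow_step \<psi> d \<epsilon> s V) (flow_step \<psi> d \<epsilon> s W)
     \<le> (1 + s * growth_rate \<Lambda>) * varifold_bl_dist d V W"
proof -
  interpret step "TYPE('n)" s "lip_h \<Lambda>" "lip_Dh \<Lambda>" D by (rule step_locale)
  let ?\<Delta> = "varifold_bl_dist d V W"
  let ?w = "a + b * \<omega>"
  have \<Delta>: "0 \<le> ?\<Delta>" by (rule varifold_bl_dist_nonneg[OF V(1) W(1)])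
  have w: "0 \<le> ?w" using nonneg \<omega>_pos by simp
  note diff = mean_curvature_diff[OF V(1) W(1) V(2) W(2)]
  have "varifold_bl_dist d (flow_step \<psi> d \<epsilon> s V) (flow_step \<psi> d \<epsilon> s W)
     \<le> (1 + 15 * D * (s * (lip_h \<Lambda> + lip_Dh \<Lambda>))) * ?\<Delta>
       + 10 * D * (s * (pmc_lip \<Lambda> * ?\<Delta> + pmc_lip \<Lambda> * ?\<Delta> * ?w)) * mass W"
    unfolding flow_step_def
    by (rule bl_dist_pushforward_le[OF mean_curvature_C11[OF V] mean_curvature_C11[OF W] V(1) W(1)])
      (use diff in \<open>simp_all add: mean_curvature_eq_conv\<close>)
  also have "\<dots> \<le> (1 + 15 * D * (s * (lip_h \<Lambda> + lip_Dh \<Lambda>))) * ?\<Delta>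
       + 10 * D * (s * (pmc_lip \<Lambda> * ?\<Delta> + pmc_lip \<Lambda> * ?\<Delta> * ?w)) * \<Lambda>"
    using W(2) D_ge_1 s rate_nonneg(4) \<Delta> w
    by (intro add_left_mono mult_left_mono) (auto intro!: mult_nonneg_nonneg add_nonneg_nonneg)
  also have "\<dots> = (1 + s * growth_rate \<Lambda>) * ?\<Delta>"
    by (simp add: growth_rate_def algebra_simps)
  finally show ?thesis .
qed

end

end

text \<open>Only the mesh of the subdivision has to be small depending on all the data: the mass can grow
  by \<open>O(1 / N)\<close> in total along \<open>N\<close> steps.\<close>

context
  fixes M :: real and d N :: nat
  assumes M: "0 \<le> M"
    and N: "0 < N" "6 * D * (lip_h (M + 1) + lip_Dh (M + 1)) \<le> real N"
      "5 * D * (lip_h (M + 1))\<^sup>2 * (M + 1) \<le> real N"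
begin

abbreviation "\<Gamma> \<equiv> growth_rate (M + 1)"
abbreviation "excess \<equiv> 5 * D * (lip_h (M + 1))\<^sup>2 * (M + 1)"

lemma M1: "0 \<le> M + 1"
  using M by simp

lemma excess_nonneg: "0 \<le> excess"
  using D_ge_1 M by simp

lemma small_step:
  assumes "s \<le> 1 / real N" "0 \<le> s"
  shows "6 * D * (s * (lip_h (M + 1) + lip_Dh (M + 1))) \<le> 1"
proof -
  have D: "1 \<le> D" by (rule D_ge_1)
  have "6 * D * (s * (lip_h (M + 1) + lip_Dh (M + 1))) = s * (6 * D * (lip_h (M + 1) + lip_Dh (M + 1)))"
    by (simp add: mult_ac)
  also have "\<dots> \<le> (1 / real N) * real N"
    using assms N D rate_nonneg[OF M1] by (intro mult_mono) auto
  finally show ?thesis using N by simp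
qed

text \<open>Each step may spend \<open>excess / N^2\<close> of mass, and at most \<open>N\<close>
  steps spend \<open>excess / N \<le> 1\<close>. A step shorter than \<open>1 / N\<close> is allowed
  because the last one stops at \<open>t\<close>.\<close>

lemma excess_step:
  assumes "i < N" "s \<le> 1 / real N" "0 \<le> s"
  shows "real i * excess / (real N)\<^sup>2 + excess * s\<^sup>2 \<le> real (Suc i) * excess / (real N)\<^sup>2"
    "real (Suc i) * excess / (real N)\<^sup>2 \<le> 1"
proof -
  have "s\<^sup>2 \<le> (1 / real N)\<^sup>2" using assms by (intro power_mono) auto
  then have "excess * s\<^sup>2 \<le> excess * (1 / real N)\<^sup>2" using excess_nonneg by (rule mult_left_mono)
  then show "real i * excess / (real N)\<^sup>2 + excess * s\<^sup>2 \<le> real (Suc i) * excess / (real N)\<^sup>2"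
    by (simp add: power_divide distrib_right add_divide_distrib)
  have "real (Suc i) * excess \<le> real N * real N"
    using assms(1) N(3) excess_nonneg by (intro mult_mono) auto
  then show "real (Suc i) * excess / (real N)\<^sup>2 \<le> 1"
    using N(1) by (simp add: power2_eq_square)
qed

abbreviation "T \<equiv> uniform_subdivision N"
abbreviation "node V \<equiv> flow_node \<psi> d \<epsilon> T V"

lemma node_step: "i < N \<Longrightarrow> node V (Suc i) = flow_step \<psi> d \<epsilon> (1 / real N) (node V i)"
  by (simp add: uniform_subdivision_nth diff_divide_distrib[symmetric])

text \<open>A bootstrap: the estimate for a step presupposes mass at most \<open>M + 1\<close> at
  its start, and the finer bound growing with \<open>i\<close> ensures this for the next step. Both
  are carried through the induction.\<close>

lemma flow_node_mass:
  assumes "finite_varifold d V" "mass V \<le> M" "i \<le> N"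
  shows "finite_varifold d (node V i) \<and> mass (node V i) \<le> M + real i * excess / (real N)\<^sup>2
     \<and> mass (node V i) \<le> M + 1"
  using assms(3)
proof (induction i)
  case 0
  then show ?case using assms by simp
next
  case (Suc i)
  then have i: "i < N" and IH: "finite_varifold d (node V i)"
      "mass (node V i) \<le> M + real i * excess / (real N)\<^sup>2" "mass (node V i) \<le> M + 1"
    by auto
  have s: "0 \<le> 1 / real N" by simp
  note st = flow_step_mass[OF M1 s small_step[OF order_refl s] IH(1,3)]
  show ?case
    unfolding node_step[OF i]
    using st IH(2) excess_step[OF i order_refl s] by auto
qed

text \<open>Discrete Gronwall: each factor \<open>1 + \<Gamma> / N\<close> is at most
  \<open>exp (\<Gamma> / N)\<close>, and the exponents add up to elapsed time.\<close>

lemma flow_node_bl_dist: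
  assumes V: "finite_varifold d V" "mass V \<le> M" and W: "finite_varifold d W" "mass W \<le> M"
    and "i \<le> N"
  shows "varifold_bl_dist d (node V i) (node W i) \<le> exp (\<Gamma> * (real i / real N)) * varifold_bl_dist d V W"
  using assms(5)
proof (induction i)
  case 0
  then show ?case by simp
next
  case (Suc i)
  then have i: "i < N" by simp
  have s: "0 \<le> 1 / real N" by simp
  note mV = flow_node_mass[OF V less_imp_le[OF i]] and mW = flow_node_mass[OF W less_imp_le[OF i]]
  have G: "0 \<le> \<Gamma>" by (rule rate_nonneg[OF M1])
  have "varifold_bl_dist d (node V (Suc i)) (node W (Suc i))
     \<le> (1 + (1 / real N) * \<Gamma>) * varifold_bl_dist d (node V i) (node W i)"
    unfolding node_step[OF i]
    using mV mW by (intro flow_step_bl_dist[OF M1 s small_step[OF order_refl s]]) auto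
  also have "\<dots> \<le> exp ((1 / real N) * \<Gamma>) * (exp (\<Gamma> * (real i / real N)) * varifold_bl_dist d V W)"
    using Suc i mV mW G by (intro mult_mono exp_ge_add_one_self varifold_bl_dist_nonneg) auto
  also have "\<dots> = exp (\<Gamma> * (real (Suc i) / real N)) * varifold_bl_dist d V W"
  proof -
    have "(1 / real N) * \<Gamma> + \<Gamma> * (real i / real N) = \<Gamma> * (real (Suc i) / real N)"
      by (simp add: add_divide_distrib distrib_left)
    then show ?thesis by (metis exp_add mult.assoc)
  qed
  finally show ?case .
qed

text \<open>The interval containing \<open>t\<close> depends on the subdivision only. The equation
  holds for every starting varifold with the same \<open>i\<close>, so two flows can be compared
  step by step.\<close>

lemma discrete_flow_index:
  assumes t: "t \<in> {0..1}"
  obtains i where "i < N" "real i / real N \<le> t" "t - real i / real N \<le> 1 / real N"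
    "\<And>V. discrete_flow \<psi> d \<epsilon> T V t = flow_step \<psi> d \<epsilon> (t - real i / real N) (node V i)"
proof -
  define i where "i = (LEAST i. t \<le> T ! Suc i)"
  \<comment> \<open>The last node equals 1, so \<open>N - 1\<close> witnesses that the least index
    exists and bounds it.\<close>
  have w: "t \<le> T ! Suc (N - 1)" using t N by (simp add: uniform_subdivision_nth)
  have le: "t \<le> T ! Suc i" unfolding i_def using w by (rule LeastI)
  have "i \<le> N - 1" unfolding i_def using w by (rule Least_le)
  then have i: "i < N" using N by simp
  \<comment> \<open>For \<open>i = 0\<close> this is \<open>t \<ge> 0\<close>; otherwise it is the
    minimality of \<open>i\<close>, applied to the preceding index.\<close>
  have lo: "real i / real N \<le> t"
  proof (cases i)
    case 0
    then show ?thesis using t by simp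
  next
    case (Suc j)
    then have "\<not> t \<le> T ! Suc j" using not_less_Least[of j "\<lambda>i. t \<le> T ! Suc i"] by (simp add: i_def)
    then show ?thesis using Suc i by (simp add: uniform_subdivision_nth)
  qed
  have hi: "t - real i / real N \<le> 1 / real N"
    using le i by (simp add: uniform_subdivision_nth add_divide_distrib)
  show ?thesis
  proof (rule that[OF i lo hi])
    show "discrete_flow \<psi> d \<epsilon> T V t = flow_step \<psi> d \<epsilon> (t - real i / real N) (node V i)" for V
      unfolding discrete_flow_def Let_def i_def[symmetric] using i by (simp add: uniform_subdivision_nth)
  qed
qed

lemma discrete_flow_mass:
  assumes V: "finite_varifold d V" "mass V \<le> M" and t: "t \<in> {0..1}"
  shows "finite_varifold d (discrete_flow \<psi> d \<epsilon> T V t)" "mass (discrete_flow \<psi> d \<epsilon> T V t) \<le> M + 1"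
proof -
  obtain i where i: "i < N" "real i / real N \<le> t" "t - real i / real N \<le> 1 / real N"
    "\<And>V. discrete_flow \<psi> d \<epsilon> T V t = flow_step \<psi> d \<epsilon> (t - real i / real N) (node V i)"
    using discrete_flow_index[OF t] by blast
  have s: "0 \<le> t - real i / real N" using i by simp
  note m = flow_node_mass[OF V less_imp_le[OF i(1)]]
  note st = flow_step_mass[OF M1 s small_step[OF i(3) s], of d "node V i"]
  show "finite_varifold d (discrete_flow \<psi> d \<epsilon> T V t)" "mass (discrete_flow \<psi> d \<epsilon> T V t) \<le> M + 1"
    using st m excess_step[OF i(1,3) s] unfolding i(4) by auto
qed

lemma discrete_flow_bl_dist:
  assumes V: "finite_varifold d V" "mass V \<le> M" and W: "finite_varifold d W" "mass W \<le> M"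
    and t: "t \<in> {0..1}"
  shows "varifold_bl_dist d (discrete_flow \<psi> d \<epsilon> T V t) (discrete_flow \<psi> d \<epsilon> T W t)
    \<le> exp (\<Gamma> * t) * varifold_bl_dist d V W"
proof -
  obtain i where i: "i < N" "real i / real N \<le> t" "t - real i / real N \<le> 1 / real N"
    "\<And>V. discrete_flow \<psi> d \<epsilon> T V t = flow_step \<psi> d \<epsilon> (t - real i / real N) (node V i)"
    using discrete_flow_index[OF t] by blast
  define s where "s = t - real i / real N"
  have s: "0 \<le> s" "s \<le> 1 / real N" using i by (auto simp: s_def)
  note mV = flow_node_mass[OF V less_imp_le[OF i(1)]] and mW = flow_node_mass[OF W less_imp_le[OF i(1)]]
  have G: "0 \<le> \<Gamma>" by (rule rate_nonneg[OF M1])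
  have "varifold_bl_dist d (discrete_flow \<psi> d \<epsilon> T V t) (discrete_flow \<psi> d \<epsilon> T W t)
     \<le> (1 + s * \<Gamma>) * varifold_bl_dist d (node V i) (node W i)"
    unfolding i(4) s_def[symmetric]
    using mV mW by (intro flow_step_bl_dist[OF M1 s(1) small_step[OF s(2,1)]]) auto
  also have "\<dots> \<le> exp (s * \<Gamma>) * (exp (\<Gamma> * (real i / real N)) * varifold_bl_dist d V W)"
    using mV mW G s i flow_node_bl_dist[OF V W less_imp_le[OF i(1)]]
    by (intro mult_mono exp_ge_add_one_self varifold_bl_dist_nonneg) auto
  also have "\<dots> = exp (\<Gamma> * t) * varifold_bl_dist d V W"
  proof -
    have "s * \<Gamma> + \<Gamma> * (real i / real N) = \<Gamma> * t" by (simp add: s_def algebra_simps)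
    then show ?thesis by (metis exp_add mult.assoc)
  qed
  finally show ?thesis .
qed

end

text \<open>Both flows are evaluated along the same uniform subdivisions, on which the discrete
  estimate holds with a constant independent of \<open>j\<close>; the weak-star limit then preserves
  it.\<close>

lemma approx_mcf_bl_dist:
  assumes M: "0 \<le> M" and c3: "0 < c\<^sub>3"
    and V0: "finite_varifold d V\<^sub>0" "mass V\<^sub>0 \<le> M" and W0: "finite_varifold d W\<^sub>0" "mass W\<^sub>0 \<le> M"
    and V: "approx_mcf \<psi> c\<^sub>3 d \<epsilon> M V\<^sub>0 V" and W: "approx_mcf \<psi> c\<^sub>3 d \<epsilon> M W\<^sub>0 W"
    and t: "t \<in> {0..1}"
  shows "varifold_bl_dist d (V t) (W t) \<le> exp (growth_rate (M + 1) * t) * varifold_bl_dist d V\<^sub>0 W\<^sub>0"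
proof -
  define r where "r = inverse ((M + 1) ^ 3) * \<epsilon> ^ 8"
  have r: "0 < r" using M eps by (simp add: r_def)
  \<comment> \<open>Three lower bounds for the number of steps: the admissibility condition with
    \<open>c\<^sub>3\<close>, the smallness of a step, and total mass growth at most 1. Starting
    beyond \<open>x\<close> makes every member of the sequence admissible, not only
    eventually.\<close>
  define x where "x = max (c\<^sub>3 / r) (max (6 * D * (lip_h (M + 1) + lip_Dh (M + 1)))
     (5 * D * (lip_h (M + 1))\<^sup>2 * (M + 1)))"
  obtain N0 :: nat where N0: "x \<le> real N0" using real_arch_simple by blast
  define T where "T = (\<lambda>j. uniform_subdivision (Suc (N0 + j)))"
  have N: "c\<^sub>3 / r \<le> real (Suc (N0 + j))" "6 * D * (lip_h (M + 1) + lip_Dh (M + 1)) \<le> real (Suc (N0 + j))"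
    "5 * D * (lip_h (M + 1))\<^sup>2 * (M + 1) \<le> real (Suc (N0 + j))" "0 < Suc (N0 + j)" for j
    using N0 unfolding x_def by auto
  have T1: "subdivision (T j) \<and> c\<^sub>3 * mesh (T j) \<le> inverse ((M + 1) ^ 3) * \<epsilon> ^ 8" for j
  proof -
    have "c\<^sub>3 * (1 / real (Suc (N0 + j))) \<le> r"
      using N(1)[of j] r by (simp add: field_simps)
    then show ?thesis
      using uniform_subdivision[OF N(4)[of j]] by (simp add: T_def r_def)
  qed
  have T2: "(\<lambda>j. mesh (T j)) \<longlonglongrightarrow> 0"
  proof -
    have "(\<lambda>j. 1 / real (j + Suc N0)) \<longlonglongrightarrow> 0" by (rule LIMSEQ_ignore_initial_segment[OF lim_1_over_n])
    moreover have "mesh (T j) = 1 / real (j + Suc N0)" for j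
      using uniform_subdivision(2)[OF N(4)[of j]] by (simp add: T_def add_ac)
    ultimately show ?thesis by simp
  qed
  have lim: "varifold d (V t)" "weak_star_limit d (\<lambda>j. discrete_flow \<psi> d \<epsilon> (T j) V\<^sub>0 t) (V t)"
    "varifold d (W t)" "weak_star_limit d (\<lambda>j. discrete_flow \<psi> d \<epsilon> (T j) W\<^sub>0 t) (W t)"
    using V W t T1 T2 unfolding approx_mcf_def by blast+
  show ?thesis
  proof (rule bl_dist_weak_star_limit[OF lim(1,3,2,4)])
    fix j
    show "finite_varifold d (discrete_flow \<psi> d \<epsilon> (T j) V\<^sub>0 t)" "mass (discrete_flow \<psi> d \<epsilon> (T j) V\<^sub>0 t) \<le> M + 1"
      unfolding T_def by (rule discrete_flow_mass[OF M N(4,2,3) V0 t])+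
    show "finite_varifold d (discrete_flow \<psi> d \<epsilon> (T j) W\<^sub>0 t)" "mass (discrete_flow \<psi> d \<epsilon> (T j) W\<^sub>0 t) \<le> M + 1"
      unfolding T_def by (rule discrete_flow_mass[OF M N(4,2,3) W0 t])+
    show "varifold_bl_dist d (discrete_flow \<psi> d \<epsilon> (T j) V\<^sub>0 t) (discrete_flow \<psi> d \<epsilon> (T j) W\<^sub>0 t)
      \<le> exp (growth_rate (M + 1) * t) * varifold_bl_dist d V\<^sub>0 W\<^sub>0"
      unfolding T_def by (rule discrete_flow_bl_dist[OF M N(4,2,3) V0 W0 t])
  qed
qed

end

subsection \<open>Bounds for the truncated Gaussian kernel\<close>

lemma has_derivative_gradient:
  fixes f :: "real^'n \<Rightarrow> real"
  assumes "f differentiable (at x)"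
  shows "(f has_derivative (\<lambda>v. gradient f x \<bullet> v)) (at x)"
proof -
  let ?D = "frechet_derivative f (at x)"
  have D: "(f has_derivative ?D) (at x)" using assms frechet_derivative_works by blast
  have lin: "linear ?D" using D by (rule has_derivative_linear)
  have "?D v = gradient f x \<bullet> v" for v
  proof -
    have "v = (\<Sum>i\<in>UNIV. (v $ i) *\<^sub>R axis i (1::real))"
      by (simp add: vec_eq_iff axis_def if_distrib cong: if_cong)
    then have "?D v = ?D (\<Sum>i\<in>UNIV. (v $ i) *\<^sub>R axis i (1::real))" by simp
    also have "\<dots> = (\<Sum>i\<in>UNIV. v $ i * ?D (axis i 1))"
      by (simp add: linear_sum[OF lin] linear_scale[OF lin])
    also have "\<dots> = gradient f x \<bullet> v"
      by (simp add: gradient_def inner_vec_def mult.commute)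
    finally show ?thesis .
  qed
  then have "?D = (\<lambda>v. gradient f x \<bullet> v)" by (rule ext)
  then show ?thesis using D by simp
qed

lemma gradient_eqI:
  fixes f :: "real^'n \<Rightarrow> real"
  assumes "(f has_derivative (\<lambda>v. G \<bullet> v)) (at x)"
  shows "gradient f x = G"
proof -
  have "frechet_derivative f (at x) = (\<lambda>v. G \<bullet> v)" using frechet_derivative_at[OF assms] by simp
  then show ?thesis by (simp add: gradient_def vec_eq_iff inner_axis)
qed

lemma lipschitz_of_gradient_le:
  fixes f :: "real^'n \<Rightarrow> real"
  assumes f: "\<And>x. f differentiable (at x)" and C: "\<And>x. norm (gradient f x) \<le> C"
  shows "\<bar>f x - f y\<bar> \<le> C * norm (x - y)"
proof -
  have "norm (f x - f y) \<le> C * norm (x - y)"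
  proof (rule differentiable_bound[of UNIV f "\<lambda>x v. gradient f x \<bullet> v"])
    show "(f has_derivative (\<lambda>v. gradient f x \<bullet> v)) (at x within UNIV)" for x
      using has_derivative_gradient[OF f] .
    show "onorm (\<lambda>v. gradient f x \<bullet> v) \<le> C" for x
    proof (rule onorm_le)
      fix v
      have "norm (gradient f x \<bullet> v) \<le> norm (gradient f x) * norm v" by (simp add: Cauchy_Schwarz_ineq2)
      also have "\<dots> \<le> C * norm v" by (intro mult_right_mono C) simp
      finally show "norm (gradient f x \<bullet> v) \<le> C * norm v" .
    qed
  qed auto
  then show ?thesis by simp
qed

text \<open>The gradient is continuous, hence bounded on the closed unit ball, and it vanishes on
  the open exterior, where \<open>f\<close> is locally constant. Applied to the components of the
  gradient of the cutoff function.\<close>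

lemma C1_compact_support_lipschitz:
  fixes f :: "real^'n \<Rightarrow> real"
  assumes f: "Ck (Suc 0) f" and supp: "\<And>x. norm x > 1 \<Longrightarrow> f x = 0"
  shows "\<exists>C\<ge>0. \<forall>x y. \<bar>f x - f y\<bar> \<le> C * norm (x - y)"
proof -
  have diff: "f differentiable (at x)" for x using f by simp
  have "continuous_on UNIV (\<lambda>x. gradient f x $ i)" for i using f by (simp add: gradient_def)
  then have "continuous_on UNIV (gradient f)"
    using continuous_on_vec_lambda[of UNIV "\<lambda>i x. gradient f x $ i"] by simp
  then have "continuous_on (cball 0 1) (gradient f)" by (rule continuous_on_subset) simp
  then have "compact (gradient f ` cball 0 1)" by (rule compact_continuous_image) simp
  then have "bounded (gradient f ` cball 0 1)" by (rule compact_imp_bounded)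
  then obtain C where C: "C > 0" "\<And>x. x \<in> cball 0 1 \<Longrightarrow> norm (gradient f x) \<le> C"
    unfolding bounded_pos by blast
  have zero: "gradient f x = 0" if x: "norm x > 1" for x
  proof (rule gradient_eqI)
    have op: "open {y :: real^'n. 1 < norm y}" by (intro open_Collect_less continuous_intros)
    have "((\<lambda>y::real^'n. 0::real) has_derivative (\<lambda>v. 0 \<bullet> v)) (at x)" by simp
    then show "(f has_derivative (\<lambda>v. 0 \<bullet> v)) (at x)"
      by (rule has_derivative_transform_within_open[OF _ op]) (use x supp in auto)
  qed
  have "norm (gradient f x) \<le> C" for x
    using C zero[of x] by (cases "norm x \<le> 1") auto
  then show ?thesis using lipschitz_of_gradient_le[OF diff] C(1) by (intro exI[of _ C]) auto
qed

text \<open>The exponential beats any power. The exponent is that of the Gaussian at radius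
  \<open>1 / 2\<close>, where the cutoff function starts to vary. With
  \<open>u = 1 / (8 \<epsilon>^2)\<close>, the bound \<open>u / N \<le> exp (u / N)\<close> is
  raised to the power \<open>n\<close>; \<open>N = Suc n\<close> avoids a division by 0.\<close>

lemma exp_minus_bound:
  assumes "0 < \<epsilon>" "\<epsilon> < 1"
  shows "(1 / \<epsilon>) ^ n * exp (- 1 / (8 * \<epsilon>\<^sup>2)) \<le> (8 * real (Suc n)) ^ n"
proof -
  define N where "N = real (Suc n)"
  define u where "u = 1 / (8 * \<epsilon>\<^sup>2)"
  have u: "0 < u" unfolding u_def using assms by simp
  have N: "1 \<le> N" by (simp add: N_def)
  have "1 / \<epsilon> \<le> (1 / \<epsilon>)\<^sup>2" using assms by (simp add: power2_eq_square divide_simps)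
  also have "\<dots> = 8 * N * (u / N)" using N by (simp add: u_def power_divide)
  also have "\<dots> \<le> 8 * N * exp (u / N)"
  proof (rule mult_left_mono)
    show "u / N \<le> exp (u / N)" using exp_ge_add_one_self[of "u / N"] by linarith
  qed (use N in simp)
  finally have "(1 / \<epsilon>) ^ n \<le> (8 * N * exp (u / N)) ^ n" using assms by (intro power_mono) auto
  also have "\<dots> = (8 * N) ^ n * exp (real n * (u / N))"
    by (simp only: power_mult_distrib exp_of_nat_mult)
  also have "\<dots> \<le> (8 * N) ^ n * exp u"
  proof -
    have "real n * (u / N) \<le> u" using u by (simp add: N_def field_simps)
    then show ?thesis using N by (intro mult_left_mono) auto
  qed
  finally have "(1 / \<epsilon>) ^ n * exp (- u) \<le> (8 * N) ^ n * exp u * exp (- u)"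
    by (intro mult_right_mono) auto
  also have "\<dots> = (8 * N) ^ n" by (simp add: mult.assoc exp_add[symmetric])
  finally show ?thesis by (simp add: u_def N_def)
qed

text \<open>Reduced to one real variable, \<open>norm x / \<epsilon>\<close>: the derivative of
  \<open>exp (- z^2 / 2)\<close> is bounded by 1, and rescaling gives
  \<open>1 / \<epsilon>\<close>.\<close>

lemma gauss_lip:
  fixes x y :: "real^'n"
  assumes "0 < \<epsilon>"
  shows "\<bar>exp (- (norm x)\<^sup>2 / (2 * \<epsilon>\<^sup>2)) - exp (- (norm y)\<^sup>2 / (2 * \<epsilon>\<^sup>2))\<bar> \<le> (1 / \<epsilon>) * norm (x - y)"
proof -
  have 1: "\<bar>exp (- s\<^sup>2 / 2) - exp (- t\<^sup>2 / 2)\<bar> \<le> 1 * \<bar>s - t\<bar>" for s t :: real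
  proof -
    have "norm (exp (- s\<^sup>2 / 2) - exp (- t\<^sup>2 / 2)) \<le> 1 * norm (s - t)"
    proof (rule field_differentiable_bound[of UNIV])
      show "((\<lambda>t. exp (- t\<^sup>2 / 2)) has_field_derivative (- z * exp (- z\<^sup>2 / 2))) (at z within UNIV)" for z :: real
        by (auto intro!: derivative_eq_intros)
      show "norm (- z * exp (- z\<^sup>2 / 2)) \<le> 1" for z :: real
      proof -
        \<comment> \<open>From the square of \<open>\<bar>z\<bar> - 1\<close>; the right-hand side
          is a lower bound of \<open>exp (z^2 / 2)\<close>.\<close>
        have "\<bar>z\<bar> \<le> 1 + z\<^sup>2 / 2"
          using zero_le_power2[of "\<bar>z\<bar> - 1"] by (simp add: power2_eq_square algebra_simps)
        also have "\<dots> \<le> exp (z\<^sup>2 / 2)" by (rule exp_ge_add_one_self)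
        finally have "\<bar>z\<bar> * exp (- z\<^sup>2 / 2) \<le> exp (z\<^sup>2 / 2) * exp (- z\<^sup>2 / 2)" by (intro mult_right_mono) auto
        then show ?thesis by (simp add: abs_mult exp_add[symmetric])
      qed
    qed auto
    then show ?thesis by simp
  qed
  have e: "- (norm v)\<^sup>2 / (2 * \<epsilon>\<^sup>2) = - (norm v / \<epsilon>)\<^sup>2 / 2" for v :: "real^'n"
    by (simp add: power_divide)
  have "\<bar>exp (- (norm x)\<^sup>2 / (2 * \<epsilon>\<^sup>2)) - exp (- (norm y)\<^sup>2 / (2 * \<epsilon>\<^sup>2))\<bar> \<le> \<bar>norm x / \<epsilon> - norm y / \<epsilon>\<bar>"
    using 1[of "norm x / \<epsilon>" "norm y / \<epsilon>"] unfolding e by simp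
  also have "\<dots> = \<bar>norm x - norm y\<bar> / \<epsilon>" using assms by (simp add: diff_divide_distrib[symmetric])
  also have "\<dots> \<le> norm (x - y) / \<epsilon>" using assms by (intro divide_right_mono norm_triangle_ineq3) auto
  finally show ?thesis by simp
qed

lemma gauss_has_derivative:
  fixes x :: "real^'n"
  assumes "0 < \<epsilon>"
  shows "((\<lambda>x. exp (- (norm x)\<^sup>2 / (2 * \<epsilon>\<^sup>2))) has_derivative
     (\<lambda>v. - (x \<bullet> v) / \<epsilon>\<^sup>2 * exp (- (norm x)\<^sup>2 / (2 * \<epsilon>\<^sup>2)))) (at x)"
  unfolding power2_norm_eq_inner
  using assms by (auto intro!: derivative_eq_intros simp: inner_commute field_simps)

section \<open>The cutoff function and the kernel built from it\<close>

locale cutoff_function =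
  fixes \<psi> :: "real^'n \<Rightarrow> real"
  assumes cutoff: "cutoff \<psi>"
begin

lemma \<psi>_diff: "\<psi> differentiable (at x)"
proof -
  have "Ck (Suc 0) \<psi>" using cutoff unfolding cutoff_def by blast
  then show ?thesis by simp
qed

lemma \<psi>_range: "0 \<le> \<psi> x" "\<psi> x \<le> 1"
  and \<psi>_inside: "norm x \<le> 1/2 \<Longrightarrow> \<psi> x = 1"
  and \<psi>_outside: "norm x \<ge> 1 \<Longrightarrow> \<psi> x = 0"
  and \<psi>_grad: "norm (gradient \<psi> x) \<le> 3"
  using cutoff unfolding cutoff_def by blast+

lemma \<psi>_lip: "\<bar>\<psi> x - \<psi> y\<bar> \<le> 3 * norm (x - y)"
  by (rule lipschitz_of_gradient_le[OF \<psi>_diff \<psi>_grad])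

text \<open>At these points \<open>\<psi>\<close> attains its global maximum 1 or minimum 0. This
  includes the two boundary spheres, where \<open>\<psi>\<close> need not be locally
  constant.\<close>

lemma grad_\<psi>_zero:
  assumes "norm x \<le> 1/2 \<or> 1 \<le> norm x"
  shows "gradient \<psi> x = 0"
proof -
  have "(\<lambda>v. gradient \<psi> x \<bullet> v) = (\<lambda>v. 0)"
  proof (rule differential_zero_maxmin[of x UNIV \<psi>])
    show "(\<psi> has_derivative (\<lambda>v. gradient \<psi> x \<bullet> v)) (at x)" by (rule has_derivative_gradient[OF \<psi>_diff])
    show "(\<forall>y\<in>UNIV. \<psi> y \<le> \<psi> x) \<or> (\<forall>y\<in>UNIV. \<psi> x \<le> \<psi> y)"
      using assms \<psi>_inside[of x] \<psi>_outside[of x] \<psi>_range by auto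
  qed auto
  then have "gradient \<psi> x \<bullet> gradient \<psi> x = 0" by (rule fun_cong)
  then show ?thesis by simp
qed

text \<open>The constant depends on \<open>\<psi>\<close> alone; together with dimensional constants
  it determines the final constant.\<close>

lemma grad_\<psi>_lip: "\<exists>C\<ge>0. \<forall>x y. norm (gradient \<psi> x - gradient \<psi> y) \<le> C * norm (x - y)"
proof -
  have "\<exists>C\<ge>0. \<forall>x y. \<bar>gradient \<psi> x $ i - gradient \<psi> y $ i\<bar> \<le> C * norm (x - y)" for i
  proof (rule C1_compact_support_lipschitz)
    have "Ck (Suc (Suc 0)) \<psi>" using cutoff unfolding cutoff_def by blast
    then show "Ck (Suc 0) (\<lambda>x. gradient \<psi> x $ i)" by (simp add: gradient_def)
    show "gradient \<psi> x $ i = 0" if "norm x > 1" for x using grad_\<psi>_zero[of x] that by simp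
  qed
  then obtain C where C: "\<And>i. 0 \<le> C i"
    "\<And>i x y. \<bar>gradient \<psi> x $ i - gradient \<psi> y $ i\<bar> \<le> C i * norm (x - y)"
    by metis
  have "norm (gradient \<psi> x - gradient \<psi> y) \<le> (\<Sum>i\<in>UNIV. C i) * norm (x - y)" for x y
  proof -
    have "norm (gradient \<psi> x - gradient \<psi> y) \<le> (\<Sum>i\<in>UNIV. \<bar>(gradient \<psi> x - gradient \<psi> y) $ i\<bar>)"
      by (rule norm_le_l1_cart)
    also have "\<dots> \<le> (\<Sum>i\<in>UNIV. C i * norm (x - y))" using C(2) by (intro sum_mono) simp
    finally show ?thesis by (simp add: sum_distrib_right)
  qed
  then show ?thesis using C(1) by (intro exI[of _ "\<Sum>i\<in>UNIV. C i"]) (auto intro: sum_nonneg)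
qed

text \<open>One of the two points may be taken in the unit ball, since otherwise both sides of the
  difference vanish. There the product rule gives 1 for the identity and 3 for
  \<open>\<psi>\<close>.\<close>

lemma \<psi>_times_id_lip: "norm (\<psi> x *\<^sub>R x - \<psi> y *\<^sub>R y) \<le> 4 * norm (x - y)"
proof -
  have *: "norm (\<psi> x *\<^sub>R x - \<psi> y *\<^sub>R y) \<le> 4 * norm (x - y)" if y: "norm y \<le> 1" for x y
  proof -
    have "\<psi> x *\<^sub>R x - \<psi> y *\<^sub>R y = \<psi> x *\<^sub>R (x - y) + (\<psi> x - \<psi> y) *\<^sub>R y"
      by (simp add: algebra_simps)
    moreover have "norm (\<psi> x *\<^sub>R (x - y)) \<le> norm (x - y)"
      using \<psi>_range[of x] by (simp add: mult_left_le_one_le)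
    moreover have "norm ((\<psi> x - \<psi> y) *\<^sub>R y) \<le> (3 * norm (x - y)) * 1"
      unfolding norm_scaleR real_norm_def by (intro mult_mono \<psi>_lip y) auto
    ultimately show ?thesis
      using norm_triangle_ineq[of "\<psi> x *\<^sub>R (x - y)" "(\<psi> x - \<psi> y) *\<^sub>R y"] by simp
  qed
  show ?thesis
  proof (cases "norm y \<le> 1")
    case True
    then show ?thesis by (rule *)
  next
    case False
    show ?thesis
    proof (cases "norm x \<le> 1")
      case True
      from *[OF True, of y] show ?thesis by (simp add: norm_minus_commute)
    next
      case F: False
      then have "\<psi> x = 0" "\<psi> y = 0" using False by (auto intro: \<psi>_outside)
      then show ?thesis by simp
    qed
  qed
qed

lemma \<psi>_times_norm_le: "\<psi> x * norm x \<le> \<psi> x" 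
  using \<psi>_range[of x] \<psi>_outside[of x] by (cases "norm x \<le> 1") (auto simp: mult_left_le)

definition gauss :: "real \<Rightarrow> real^'n \<Rightarrow> real" where
  "gauss \<epsilon> x = exp (- (norm x)\<^sup>2 / (2 * \<epsilon>\<^sup>2))"

text \<open>The product of \<open>c(\<epsilon>)\<close> and the Gaussian prefactor. The prefactor
  cancels against the one inside the integral, so no Gaussian integral has to be evaluated.\<close>

definition norm_const :: "real \<Rightarrow> real" where
  "norm_const \<epsilon> = inverse (LINT y|lborel. truncated_gauss \<psi> \<epsilon> y) *
     (2 * pi * \<epsilon>\<^sup>2) powr (- (real CARD('n) / 2))"

context
  fixes \<epsilon> :: real
  assumes eps: "0 < \<epsilon>" "\<epsilon> < 1"
begin

lemma gauss_range: "0 < gauss \<epsilon> x" "gauss \<epsilon> x \<le> 1"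
  by (simp_all add: gauss_def)

lemma \<psi>_gauss_cont: "continuous_on UNIV (\<lambda>x. \<psi> x * gauss \<epsilon> x)"
proof (rule continuous_on_mult)
  show "continuous_on UNIV \<psi>"
    by (rule differentiable_imp_continuous_on) (simp add: differentiable_on_def \<psi>_diff)
  show "continuous_on UNIV (gauss \<epsilon>)" unfolding gauss_def divide_inverse by (intro continuous_intros)
qed

lemma \<psi>_gauss_integrable: "integrable lborel (\<lambda>x. \<psi> x * gauss \<epsilon> x)"
proof (rule integral_ball_bound(1)[where C = 1 and D = 0 and x = 0 and x' = 0])
  show "(\<lambda>x. \<psi> x * gauss \<epsilon> x) \<in> borel_measurable borel"
    by (rule borel_measurable_continuous_onI[OF \<psi>_gauss_cont])
  show "norm (\<psi> x * gauss \<epsilon> x) \<le> 1 * indicator (cball 0 1) x + 0 * indicator (cball 0 1) x" for x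
    using \<psi>_range[of x] \<psi>_outside[of x] gauss_range[of x]
    by (auto simp: indicator_def abs_mult intro: mult_le_one)
qed

text \<open>The integral is restricted to the ball of radius \<open>\<epsilon> / 2\<close>: there
  the Gaussian is at least \<open>exp (- 1 / 8)\<close>, and \<open>\<psi> = 1\<close> because
  \<open>\<epsilon> < 1\<close>.\<close>

lemma integral_\<psi>_gauss_ge:
  "exp (- 1 / 8) * ((\<epsilon> / 2) ^ CARD('n) * unit_vol TYPE('n)) \<le> (LINT x|lborel. \<psi> x * gauss \<epsilon> x)"
proof -
  let ?B = "cball 0 (\<epsilon> / 2) :: (real^'n) set"
  have fin: "emeasure lborel ?B < \<infinity>" using emeasure_bounded_finite[OF bounded_cball] .
  have i: "integrable lborel (\<lambda>x. exp (- 1 / 8) * indicator ?B x :: real)"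
    using fin by (intro integrable_mult_right integrable_real_indicator) auto
  have "(LINT x|lborel. exp (- 1 / 8) * indicator ?B x) \<le> (LINT x|lborel. \<psi> x * gauss \<epsilon> x)"
  proof (rule integral_mono[OF i \<psi>_gauss_integrable])
    fix x :: "real^'n"
    show "exp (- 1 / 8) * indicator ?B x \<le> \<psi> x * gauss \<epsilon> x"
    proof (cases "x \<in> ?B")
      case True
      then have x: "norm x \<le> \<epsilon> / 2" by simp
      then have "(norm x)\<^sup>2 \<le> (\<epsilon> / 2)\<^sup>2" by (intro power_mono) auto
      then have "exp (- 1 / 8) \<le> gauss \<epsilon> x" using eps by (simp add: gauss_def power_divide field_simps)
      moreover have "\<psi> x = 1" using x eps by (intro \<psi>_inside) auto
      ultimately show ?thesis using True by simp
    next
      case False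
      then show ?thesis using \<psi>_range(1)[of x] gauss_range(1)[of x] by simp
    qed
  qed
  moreover have "(LINT x|lborel. exp (- 1 / 8) * indicator ?B x) = exp (- 1 / 8) * measure lborel ?B"
    by simp
  moreover have "measure lborel ?B = (\<epsilon> / 2) ^ CARD('n) * unit_vol TYPE('n)"
    using eps by (simp add: unit_vol_def content_cball)
  ultimately show ?thesis by simp
qed

lemma powr_pos: "0 < (2 * pi * \<epsilon>\<^sup>2) powr (- (real CARD('n) / 2))"
  using eps by simp

lemma kernel_eq: "kernel \<psi> \<epsilon> x = norm_const \<epsilon> * (\<psi> x * gauss \<epsilon> x)"
  by (simp add: kernel_def truncated_gauss_def norm_const_def gauss_def)

lemma integral_truncated_gauss: "(LINT y|lborel. truncated_gauss \<psi> \<epsilon> y)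
   = (2 * pi * \<epsilon>\<^sup>2) powr (- (real CARD('n) / 2)) * (LINT x|lborel. \<psi> x * gauss \<epsilon> x)"
proof -
  have "truncated_gauss \<psi> \<epsilon> = (\<lambda>x. (2 * pi * \<epsilon>\<^sup>2) powr (- (real CARD('n) / 2)) * (\<psi> x * gauss \<epsilon> x))"
    by (rule ext) (simp add: truncated_gauss_def gauss_def)
  then show ?thesis by simp
qed

lemma integral_\<psi>_gauss_pos: "0 < (LINT x|lborel. \<psi> x * gauss \<epsilon> x)"
  by (rule less_le_trans[OF _ integral_\<psi>_gauss_ge]) (use eps unit_vol_pos[where 'n='n] in simp)

lemma norm_const_eq: "norm_const \<epsilon> = inverse (LINT x|lborel. \<psi> x * gauss \<epsilon> x)"
  unfolding norm_const_def integral_truncated_gauss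
  using powr_pos by (simp add: field_simps)

lemma norm_const_pos: "0 < norm_const \<epsilon>"
  unfolding norm_const_eq using integral_\<psi>_gauss_pos by (rule positive_imp_inverse_positive)

lemma norm_const_le:
  "norm_const \<epsilon> \<le> exp (1 / 8) * 2 ^ CARD('n) / unit_vol TYPE('n) * (1 / \<epsilon>) ^ CARD('n)"
proof -
  have w: "0 < unit_vol TYPE('n)" by (rule unit_vol_pos)
  have "norm_const \<epsilon> \<le> inverse (exp (- 1 / 8) * ((\<epsilon> / 2) ^ CARD('n) * unit_vol TYPE('n)))"
    unfolding norm_const_eq using eps w by (intro le_imp_inverse_le integral_\<psi>_gauss_ge) auto
  also have "\<dots> = exp (1 / 8) * 2 ^ CARD('n) / unit_vol TYPE('n) * (1 / \<epsilon>) ^ CARD('n)"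
  proof -
    have "exp (- 1 / 8) = inverse (exp (1 / 8 :: real))" using exp_minus[of "1 / 8 :: real"] by simp
    then show ?thesis using eps w by (simp add: power_divide field_simps)
  qed
  finally show ?thesis .
qed

definition kernel_gradient :: "real^'n \<Rightarrow> real^'n" where
  "kernel_gradient x = (norm_const \<epsilon> * gauss \<epsilon> x) *\<^sub>R (gradient \<psi> x - (1 / \<epsilon>\<^sup>2) *\<^sub>R (\<psi> x *\<^sub>R x))"

lemma kernel_has_derivative: "(kernel \<psi> \<epsilon> has_derivative (\<lambda>v. kernel_gradient x \<bullet> v)) (at x)"
proof -
  have G: "(gauss \<epsilon> has_derivative (\<lambda>v. - (x \<bullet> v) / \<epsilon>\<^sup>2 * gauss \<epsilon> x)) (at x)"
    using gauss_has_derivative[OF eps(1), of x] unfolding gauss_def .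
  have "((\<lambda>x. norm_const \<epsilon> * (\<psi> x * gauss \<epsilon> x)) has_derivative
     (\<lambda>v. norm_const \<epsilon> * (\<psi> x * (- (x \<bullet> v) / \<epsilon>\<^sup>2 * gauss \<epsilon> x) + (gradient \<psi> x \<bullet> v) * gauss \<epsilon> x))) (at x)"
    by (intro has_derivative_mult_right has_derivative_mult has_derivative_gradient \<psi>_diff G)
  moreover have "(\<lambda>x. norm_const \<epsilon> * (\<psi> x * gauss \<epsilon> x)) = kernel \<psi> \<epsilon>"
    by (rule ext) (simp add: kernel_eq)
  moreover have "norm_const \<epsilon> * (\<psi> x * (- (x \<bullet> v) / \<epsilon>\<^sup>2 * gauss \<epsilon> x) + (gradient \<psi> x \<bullet> v) * gauss \<epsilon> x)
      = kernel_gradient x \<bullet> v" for v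
    by (simp add: kernel_gradient_def inner_diff_left algebra_simps)
  ultimately show ?thesis by simp
qed

lemma gradient_kernel: "gradient (kernel \<psi> \<epsilon>) = kernel_gradient"
  by (rule ext) (rule gradient_eqI[OF kernel_has_derivative])

lemma kernel_range: "0 \<le> kernel \<psi> \<epsilon> x" "kernel \<psi> \<epsilon> x \<le> norm_const \<epsilon>"
proof -
  have 1: "0 \<le> \<psi> x * gauss \<epsilon> x" "\<psi> x * gauss \<epsilon> x \<le> 1"
    using \<psi>_range[of x] gauss_range[of x] by (auto intro: mult_le_one)
  then show "0 \<le> kernel \<psi> \<epsilon> x" "kernel \<psi> \<epsilon> x \<le> norm_const \<epsilon>"
    unfolding kernel_eq using norm_const_pos mult_left_mono[OF 1(2), of "norm_const \<epsilon>"] by auto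
qed

lemma kernel_integral: "(LINT x|lborel. kernel \<psi> \<epsilon> x) = 1"
proof -
  have "(LINT x|lborel. kernel \<psi> \<epsilon> x) = norm_const \<epsilon> * (LINT x|lborel. \<psi> x * gauss \<epsilon> x)"
    unfolding kernel_eq by (rule integral_mult_right_zero)
  also have "\<dots> = 1" unfolding norm_const_eq using integral_\<psi>_gauss_pos by (intro left_inverse) simp
  finally show ?thesis .
qed

text \<open>The gradient falls on the Gaussian, which gives \<open>\<epsilon>\<^sup>-\<^sup>2\<close> times the kernel, or on the cutoff
  function, where the Gaussian is of size \<open>exp (-1 / (8 \<epsilon>\<^sup>2))\<close>.\<close>

lemma norm_kernel_gradient_le_kernel:
  "norm (kernel_gradient x) \<le> (1 / \<epsilon>)\<^sup>2 * kernel \<psi> \<epsilon> x + 3 * norm_const \<epsilon> * exp (- 1 / (8 * \<epsilon>\<^sup>2))"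
proof -
  let ?c = "norm_const \<epsilon> * gauss \<epsilon> x"
  have c: "0 \<le> ?c" using norm_const_pos gauss_range[of x] by simp
  have "norm (kernel_gradient x) \<le> ?c * (norm (gradient \<psi> x) + (1 / \<epsilon>\<^sup>2) * (\<psi> x * norm x))"
    unfolding kernel_gradient_def norm_scaleR
    using c eps \<psi>_range[of x] norm_triangle_ineq4[of "gradient \<psi> x" "(1 / \<epsilon>\<^sup>2) *\<^sub>R (\<psi> x *\<^sub>R x)"]
    by (intro mult_mono) auto
  also have "\<dots> = ?c * norm (gradient \<psi> x) + (1 / \<epsilon>\<^sup>2) * (?c * (\<psi> x * norm x))"
    by (simp add: distrib_left)
  also have "?c * norm (gradient \<psi> x) \<le> 3 * norm_const \<epsilon> * exp (- 1 / (8 * \<epsilon>\<^sup>2))"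
  proof (cases "norm x \<le> 1 / 2")
    case True
    then show ?thesis using grad_\<psi>_zero[of x] norm_const_pos by simp
  next
    case False
    then have "(1 / 2)\<^sup>2 \<le> (norm x)\<^sup>2" by (intro power_mono) auto
    then have "gauss \<epsilon> x \<le> exp (- 1 / (8 * \<epsilon>\<^sup>2))"
      using eps by (simp add: gauss_def power2_eq_square divide_simps)
    then have "?c * norm (gradient \<psi> x) \<le> (norm_const \<epsilon> * exp (- 1 / (8 * \<epsilon>\<^sup>2))) * 3"
      using norm_const_pos gauss_range[of x] by (intro mult_mono mult_left_mono \<psi>_grad) auto
    then show ?thesis by simp
  qed
  also have "(1 / \<epsilon>\<^sup>2) * (?c * (\<psi> x * norm x)) \<le> (1 / \<epsilon>)\<^sup>2 * kernel \<psi> \<epsilon> x"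
  proof -
    have "?c * (\<psi> x * norm x) \<le> ?c * \<psi> x" using c by (intro mult_left_mono \<psi>_times_norm_le)
    then have "(1 / \<epsilon>\<^sup>2) * (?c * (\<psi> x * norm x)) \<le> (1 / \<epsilon>\<^sup>2) * (?c * \<psi> x)"
      by (rule mult_left_mono) simp
    then show ?thesis by (simp add: kernel_eq power_divide mult_ac)
  qed
  finally show ?thesis by simp
qed

text \<open>With \<open>e = 1 / \<epsilon>\<close>, the gradient is the Gaussian, bounded by 1 and
  \<open>e\<close>-Lipschitz, times a field \<open>P\<close> bounded by \<open>4 e^2\<close> and
  \<open>(L + 4) e^2\<close>-Lipschitz. The product rule gives \<open>L + 4\<close> plus 4.\<close>

lemma kernel_gradient_lip:
  assumes L: "\<And>x y. norm (gradient \<psi> x - gradient \<psi> y) \<le> L * norm (x - y)" "0 \<le> L"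
  shows "norm (kernel_gradient x - kernel_gradient y)
     \<le> norm_const \<epsilon> * ((L + 8) * (1 / \<epsilon>) ^ 3) * norm (x - y)"
proof -
  define e where "e = 1 / \<epsilon>"
  have e: "1 \<le> e" using eps by (simp add: e_def)
  have e2: "1 \<le> e\<^sup>2" using e by (rule one_le_power)
  define P where "P = (\<lambda>x. gradient \<psi> x - e\<^sup>2 *\<^sub>R (\<psi> x *\<^sub>R x))"
  have g: "kernel_gradient x = norm_const \<epsilon> *\<^sub>R (gauss \<epsilon> x *\<^sub>R P x)" for x
    by (simp add: kernel_gradient_def P_def e_def power_divide)
  have P_le: "norm (P x) \<le> 4 * e\<^sup>2" for x
  proof -
    have "norm (P x) \<le> norm (gradient \<psi> x) + norm (e\<^sup>2 *\<^sub>R (\<psi> x *\<^sub>R x))"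
      unfolding P_def by (rule norm_triangle_ineq4)
    also have "norm (e\<^sup>2 *\<^sub>R (\<psi> x *\<^sub>R x)) = e\<^sup>2 * (\<psi> x * norm x)" using \<psi>_range[of x] by simp
    also have "\<dots> \<le> e\<^sup>2 * 1" using \<psi>_times_norm_le[of x] \<psi>_range[of x] by (intro mult_left_mono) auto
    finally show ?thesis using \<psi>_grad[of x] e2 by simp
  qed
  have P_lip: "norm (P x - P y) \<le> ((L + 4) * e\<^sup>2) * norm (x - y)"
  proof -
    have "P x - P y = (gradient \<psi> x - gradient \<psi> y) - e\<^sup>2 *\<^sub>R (\<psi> x *\<^sub>R x - \<psi> y *\<^sub>R y)"
      by (simp add: P_def algebra_simps)
    also have "norm \<dots> \<le> norm (gradient \<psi> x - gradient \<psi> y) + norm (e\<^sup>2 *\<^sub>R (\<psi> x *\<^sub>R x - \<psi> y *\<^sub>R y))"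
      by (rule norm_triangle_ineq4)
    also have "norm (e\<^sup>2 *\<^sub>R (\<psi> x *\<^sub>R x - \<psi> y *\<^sub>R y)) \<le> e\<^sup>2 * (4 * norm (x - y))"
      unfolding norm_scaleR abs_power2 real_norm_def by (intro mult_left_mono \<psi>_times_id_lip) simp
    also have "norm (gradient \<psi> x - gradient \<psi> y) \<le> (L * norm (x - y)) * e\<^sup>2"
    proof -
      have "(L * norm (x - y)) * 1 \<le> (L * norm (x - y)) * e\<^sup>2" using e2 L(2) by (intro mult_left_mono) auto
      then show ?thesis using L(1)[of x y] by linarith
    qed
    finally show ?thesis by (simp add: algebra_simps)
  qed
  have "gauss \<epsilon> x *\<^sub>R P x - gauss \<epsilon> y *\<^sub>R P y = gauss \<epsilon> x *\<^sub>R (P x - P y) + (gauss \<epsilon> x - gauss \<epsilon> y) *\<^sub>R P y"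
    by (simp add: algebra_simps)
  also have "norm \<dots> \<le> 1 * (((L + 4) * e\<^sup>2) * norm (x - y)) + (e * norm (x - y)) * (4 * e\<^sup>2)"
  proof (rule norm_triangle_mono)
    show "norm (gauss \<epsilon> x *\<^sub>R (P x - P y)) \<le> 1 * (((L + 4) * e\<^sup>2) * norm (x - y))"
      unfolding norm_scaleR using gauss_range[of x] by (intro mult_mono P_lip) auto
    show "norm ((gauss \<epsilon> x - gauss \<epsilon> y) *\<^sub>R P y) \<le> (e * norm (x - y)) * (4 * e\<^sup>2)"
      unfolding norm_scaleR real_norm_def
      by (intro mult_mono P_le) (use gauss_lip[OF eps(1), of x y] e in \<open>auto simp: gauss_def e_def\<close>)
  qed
  also have "\<dots> \<le> ((L + 8) * e ^ 3) * norm (x - y)"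
  proof -
    have "(L + 4) * e\<^sup>2 * 1 \<le> (L + 4) * e\<^sup>2 * e" using e L(2) by (intro mult_left_mono) auto
    then have "(L + 4) * e\<^sup>2 + e * (4 * e\<^sup>2) \<le> (L + 8) * e ^ 3"
      by (simp add: power2_eq_square power3_eq_cube algebra_simps)
    from mult_right_mono[OF this norm_ge_zero[of "x - y"]] show ?thesis by (simp add: algebra_simps)
  qed
  finally have "norm_const \<epsilon> * norm (gauss \<epsilon> x *\<^sub>R P x - gauss \<epsilon> y *\<^sub>R P y)
      \<le> norm_const \<epsilon> * (((L + 8) * e ^ 3) * norm (x - y))"
    using norm_const_pos by (intro mult_left_mono) auto
  moreover have "norm (kernel_gradient x - kernel_gradient y)
      = norm_const \<epsilon> * norm (gauss \<epsilon> x *\<^sub>R P x - gauss \<epsilon> y *\<^sub>R P y)"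
    unfolding g scaleR_diff_right[symmetric] using norm_const_pos by simp
  ultimately show ?thesis by (simp add: e_def mult.assoc)
qed

lemma kernel_outside:
  assumes "norm x \<ge> 1"
  shows "kernel \<psi> \<epsilon> x = 0" "kernel_gradient x = 0"
proof -
  show "kernel \<psi> \<epsilon> x = 0" unfolding kernel_eq using \<psi>_outside[OF assms] by simp
  have "gradient \<psi> x = 0" using grad_\<psi>_zero[of x] assms by blast
  then show "kernel_gradient x = 0" unfolding kernel_gradient_def using \<psi>_outside[OF assms] by simp
qed

end

end

section \<open>The kernel bounds as powers of \<open>1 / \<epsilon>\<close>\<close>

context cutoff_function
begin

definition sup_const :: real where
  "sup_const = exp (1 / 8) * 2 ^ CARD('n) / unit_vol TYPE('n)"

text \<open>Bounds the part of the kernel gradient that falls on the cutoff function: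
  \<open>norm_const\<close> grows like \<open>\<epsilon>^(-n)\<close>, which the exponentially small
  Gaussian absorbs uniformly in \<open>\<epsilon>\<close>.\<close>

definition tail_const :: real where
  "tail_const = 3 * sup_const * (8 * real (Suc CARD('n))) ^ CARD('n)"

lemma sup_const_pos: "0 < sup_const" and tail_const_pos: "0 < tail_const"
proof -
  show 1: "0 < sup_const" unfolding sup_const_def using unit_vol_pos[where 'n='n] by simp
  show "0 < tail_const" unfolding tail_const_def by (intro mult_pos_pos zero_less_power 1) auto
qed

text \<open>Every constant is a power of \<open>e = 1 / \<epsilon>\<close> times a factor depending
  on dimension and cutoff function only; in particular the additive constant of the gradient bound
  is free of \<epsilon>.\<close>

lemma mollifier_kernel:
  assumes eps: "0 < \<epsilon>" "\<epsilon> < 1" and e: "e = 1 / \<epsilon>" and n: "n = CARD('n)"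
    and L: "\<And>x y. norm (gradient \<psi> x - gradient \<psi> y) \<le> L * norm (x - y)" "0 \<le> L"
  shows "mollifier \<psi> \<epsilon> (e\<^sup>2) tail_const (sup_const * e ^ n) ((sup_const + tail_const) * e ^ (n + 2))
     (sup_const * (L + 8) * e ^ (n + 3)) (unit_vol TYPE('n)) (det_const CARD('n))"
proof -
  have e1: "1 \<le> e" using eps by (simp add: e)
  have nc: "norm_const \<epsilon> \<le> sup_const * e ^ n"
    using norm_const_le[OF eps] by (simp add: sup_const_def e n)
  have tail: "3 * norm_const \<epsilon> * exp (- 1 / (8 * \<epsilon>\<^sup>2)) \<le> tail_const"
  proof -
    have "3 * norm_const \<epsilon> * exp (- 1 / (8 * \<epsilon>\<^sup>2)) \<le> 3 * (sup_const * e ^ n) * exp (- 1 / (8 * \<epsilon>\<^sup>2))"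
      using nc by (intro mult_right_mono) auto
    also have "\<dots> = 3 * sup_const * (e ^ n * exp (- 1 / (8 * \<epsilon>\<^sup>2)))" by simp
    also have "\<dots> \<le> 3 * sup_const * (8 * real (Suc n)) ^ n"
      unfolding e using sup_const_pos exp_minus_bound[OF eps, of n] by (intro mult_left_mono) auto
    finally show ?thesis by (simp add: tail_const_def n)
  qed
  have gk: "norm (kernel_gradient \<epsilon> x) \<le> e\<^sup>2 * kernel \<psi> \<epsilon> x + tail_const" for x
    using norm_kernel_gradient_le_kernel[OF eps, of x] tail by (simp add: e)
  have en: "1 \<le> e ^ (n + 2)" by (rule one_le_power[OF e1])
  show ?thesis
  proof (unfold_locales, unfold gradient_kernel[OF eps])
    show "unit_vol TYPE('n) = unit_vol TYPE('n)" "det_const CARD('n) = det_const CARD('n)" "0 < \<epsilon>"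
      using eps by auto
    fix x y :: "real^'n"
    show "0 \<le> kernel \<psi> \<epsilon> x" by (rule kernel_range(1)[OF eps])
    show "kernel \<psi> \<epsilon> x \<le> sup_const * e ^ n" by (rule order_trans[OF kernel_range(2)[OF eps] nc])
    show "kernel \<psi> \<epsilon> x = 0" "kernel_gradient \<epsilon> x = 0" if "1 \<le> norm x"
      using kernel_outside[OF eps that] by auto
    show "(LINT x|lborel. kernel \<psi> \<epsilon> x) = 1" by (rule kernel_integral[OF eps])
    show "(kernel \<psi> \<epsilon> has_derivative (\<lambda>v. kernel_gradient \<epsilon> x \<bullet> v)) (at x)"
      by (rule kernel_has_derivative[OF eps])
    show "norm (kernel_gradient \<epsilon> x) \<le> e\<^sup>2 * kernel \<psi> \<epsilon> x + tail_const" by (rule gk)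
    show "norm (kernel_gradient \<epsilon> x) \<le> (sup_const + tail_const) * e ^ (n + 2)"
    proof -
      have "e\<^sup>2 * kernel \<psi> \<epsilon> x \<le> e\<^sup>2 * (sup_const * e ^ n)"
        by (intro mult_left_mono order_trans[OF kernel_range(2)[OF eps] nc]) simp
      moreover have "tail_const * 1 \<le> tail_const * e ^ (n + 2)"
        using en tail_const_pos by (intro mult_left_mono) auto
      ultimately show ?thesis using gk[of x] by (simp add: algebra_simps power_add power2_eq_square)
    qed
    show "norm (kernel_gradient \<epsilon> x - kernel_gradient \<epsilon> y) \<le> sup_const * (L + 8) * e ^ (n + 3) * norm (x - y)"
    proof -
      have "norm (kernel_gradient \<epsilon> x - kernel_gradient \<epsilon> y) \<le> norm_const \<epsilon> * ((L + 8) * e ^ 3) * norm (x - y)"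
        unfolding e by (rule kernel_gradient_lip[OF eps L])
      also have "\<dots> \<le> (sup_const * e ^ n) * ((L + 8) * e ^ 3) * norm (x - y)"
        using nc L(2) e1 by (intro mult_right_mono) auto
      finally show ?thesis by (simp add: power_add mult_ac)
    qed
    show "0 \<le> e\<^sup>2" "0 \<le> tail_const" "0 < (sup_const + tail_const) * e ^ (n + 2)"
      "0 < sup_const * (L + 8) * e ^ (n + 3)" "0 < sup_const * e ^ n"
      using sup_const_pos tail_const_pos e1 L(2) by (auto intro!: mult_pos_pos add_pos_pos)
  qed
qed

end

text \<open>Counting powers of \<open>e\<close>: \<open>pmc_bound\<close> and
  \<open>a + b \<omega>\<close> have order 2, so \<open>lip_h\<close> has order 4 and
  \<open>lip_Dh\<close> has order \<open>n + 5\<close>. \<open>pmc_lip\<close> also has order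
  \<open>n + 5\<close>, and its product with \<open>a + b \<omega>\<close> decides the exponent
  \<open>n + 7\<close>. One factor \<Lambda> comes from \<open>pmc_bound\<close> and one from the
  mass; lower orders are rounded up, using \<open>e \<ge> 1\<close> and
  \<open>\<Lambda> \<ge> 1\<close>.\<close>

lemma (in mollifier) growth_rate_le:
  assumes e: "1 \<le> e" "\<epsilon> = 1 / e" and \<Lambda>: "1 \<le> \<Lambda>"
    and c: "a = e\<^sup>2" "A = cA * e ^ (n + 2)" "B = cB * e ^ (n + 3)" "K = cK * e ^ n"
    and pos: "0 \<le> cA" "0 \<le> cB" "0 \<le> cK"
  shows "growth_rate \<Lambda> \<le> D * (15 * ((1 + b) * (1 + b * \<omega>) + 2 * (1 + b) * cB * \<omega>)
     + 10 * ((4 * cA + cB + (1 + b) * (cK + cA)) * (2 + b * \<omega>))) * \<Lambda>\<^sup>2 * e ^ (n + 7)"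
proof -
  have D: "0 \<le> D" using D_ge_1 by simp
  have w: "0 \<le> \<omega>" using \<omega>_pos by simp
  have b: "0 \<le> b" by (rule nonneg)
  have L0: "0 \<le> \<Lambda>" using \<Lambda> by simp
  have ep: "e ^ i \<le> e ^ j" if "i \<le> j" for i j using e that by (intro power_increasing) auto
  have e0: "0 < e" using e by simp
  have e2: "1 \<le> e\<^sup>2" using e by (intro one_le_power)
  have div_e: "x / \<epsilon> = x * e" for x unfolding e(2) by simp
  have pb: "pmc_bound \<Lambda> \<le> (1 + b) * \<Lambda> * e\<^sup>2"
  proof -
    have "e\<^sup>2 * 1 \<le> e\<^sup>2 * \<Lambda>" using \<Lambda> by (intro mult_left_mono) auto
    moreover have "b * \<Lambda> * e \<le> b * \<Lambda> * e\<^sup>2"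
      using ep[of 1 2] b L0 by (intro mult_left_mono) auto
    ultimately have "e\<^sup>2 + b * \<Lambda> * e \<le> (1 + b) * \<Lambda> * e\<^sup>2" by (simp add: algebra_simps)
    moreover have "pmc_bound \<Lambda> = e\<^sup>2 + b * \<Lambda> * e" by (simp only: pmc_bound_def div_e) (simp only: c(1))
    ultimately show ?thesis by simp
  qed
  have pb0: "0 \<le> pmc_bound \<Lambda>" by (rule rate_nonneg[OF L0])
  have ab: "a + b * \<omega> \<le> (1 + b * \<omega>) * e\<^sup>2"
    using mult_left_mono[OF e2, of "b * \<omega>"] b w by (simp add: c(1) algebra_simps)
  have ab0: "0 \<le> a + b * \<omega>" using nonneg w by simp
  have "lip_h \<Lambda> \<le> ((1 + b) * \<Lambda> * e\<^sup>2) * ((1 + b * \<omega>) * e\<^sup>2)"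
    unfolding lip_h_def using pb ab pb0 ab0 b L0 by (intro mult_mono) auto
  also have "\<dots> = ((1 + b) * (1 + b * \<omega>)) * \<Lambda> * e ^ 4" by (simp add: power2_eq_square power4_eq_xxxx mult_ac)
  also have "\<dots> \<le> ((1 + b) * (1 + b * \<omega>)) * \<Lambda>\<^sup>2 * e ^ (n + 7)"
    using \<Lambda> b w e0 ep[of 4 "n + 7"] by (intro mult_mono mult_left_mono) (auto simp: power2_eq_square)
  finally have 1: "lip_h \<Lambda> \<le> ((1 + b) * (1 + b * \<omega>)) * (\<Lambda>\<^sup>2 * e ^ (n + 7))" by (simp add: mult.assoc)
  have "lip_Dh \<Lambda> \<le> 2 * ((1 + b) * \<Lambda> * e\<^sup>2) * (cB * e ^ (n + 3)) * \<omega>"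
    unfolding lip_Dh_def unfolding c(3) using pb pos e0 w by (intro mult_right_mono mult_left_mono) auto
  also have "\<dots> = (2 * (1 + b) * cB * \<omega>) * \<Lambda> * e ^ (n + 5)"
    by (simp add: power_add power2_eq_square power3_eq_cube eval_nat_numeral mult_ac)
  also have "\<dots> \<le> (2 * (1 + b) * cB * \<omega>) * \<Lambda>\<^sup>2 * e ^ (n + 7)"
    using \<Lambda> b w e0 pos ep[of "n + 5" "n + 7"] by (intro mult_mono mult_left_mono) (auto simp: power2_eq_square)
  finally have 2: "lip_Dh \<Lambda> \<le> (2 * (1 + b) * cB * \<omega>) * (\<Lambda>\<^sup>2 * e ^ (n + 7))" by (simp add: mult.assoc)
  have 3: "pmc_lip \<Lambda> \<le> (4 * cA + cB + (1 + b) * (cK + cA)) * \<Lambda> * e ^ (n + 5)"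
  proof -
    have "4 * A \<le> 4 * cA * \<Lambda> * e ^ (n + 4)"
    proof -
      have "cA * e ^ (n + 2) \<le> (cA * \<Lambda>) * e ^ (n + 4)"
        using \<Lambda> pos e0 ep[of "n + 2" "n + 4"] mult_left_mono[OF \<Lambda> pos(1)] by (intro mult_mono) auto
      then show ?thesis by (simp add: c(2))
    qed
    moreover have "B \<le> cB * \<Lambda> * e ^ (n + 4)"
      unfolding c(3) using \<Lambda> pos e0 ep[of "n + 3" "n + 4"] mult_left_mono[OF \<Lambda> pos(2)] by (intro mult_mono) auto
    moreover have "pmc_bound \<Lambda> * (K + A) \<le> (1 + b) * (cK + cA) * \<Lambda> * e ^ (n + 4)"
    proof -
      have "K + A \<le> (cK + cA) * e ^ (n + 2)"
        unfolding c(2,4) distrib_right using pos ep[of n "n + 2"] by (intro add_mono mult_left_mono) auto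
      then have "pmc_bound \<Lambda> * (K + A) \<le> ((1 + b) * \<Lambda> * e\<^sup>2) * ((cK + cA) * e ^ (n + 2))"
        using pb nonneg b L0 by (intro mult_mono) auto
      also have "\<dots> = (1 + b) * (cK + cA) * \<Lambda> * e ^ (n + 4)"
        by (simp add: power_add power2_eq_square eval_nat_numeral mult_ac)
      finally show ?thesis .
    qed
    ultimately have "(4 * A + B) + pmc_bound \<Lambda> * (K + A)
        \<le> (4 * cA + cB + (1 + b) * (cK + cA)) * \<Lambda> * e ^ (n + 4)"
      by (simp add: distrib_right)
    then have "((4 * A + B) + pmc_bound \<Lambda> * (K + A)) * e
        \<le> ((4 * cA + cB + (1 + b) * (cK + cA)) * \<Lambda> * e ^ (n + 4)) * e"
      using e0 by (intro mult_right_mono) auto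
    also have "\<dots> = (4 * cA + cB + (1 + b) * (cK + cA)) * \<Lambda> * e ^ (n + 5)"
      by (simp add: eval_nat_numeral mult_ac)
    finally show ?thesis unfolding pmc_lip_def div_e .
  qed
  have "\<Lambda> * (pmc_lip \<Lambda> * (1 + (a + b * \<omega>)))
     \<le> \<Lambda> * (((4 * cA + cB + (1 + b) * (cK + cA)) * \<Lambda> * e ^ (n + 5)) * ((2 + b * \<omega>) * e\<^sup>2))"
  proof (intro mult_left_mono[OF _ L0] mult_mono 3)
    show "1 + (a + b * \<omega>) \<le> (2 + b * \<omega>) * e\<^sup>2" using ab e2 by (simp add: algebra_simps)
    show "0 \<le> 1 + (a + b * \<omega>)" using ab0 by simp
    show "0 \<le> (4 * cA + cB + (1 + b) * (cK + cA)) * \<Lambda> * e ^ (n + 5)" using pos b L0 e0 by simp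
  qed
  also have "\<dots> = ((4 * cA + cB + (1 + b) * (cK + cA)) * (2 + b * \<omega>)) * (\<Lambda>\<^sup>2 * e ^ (n + 7))"
    by (simp add: power_add power2_eq_square eval_nat_numeral mult_ac)
  finally have 4: "\<Lambda> * (pmc_lip \<Lambda> * (1 + (a + b * \<omega>)))
     \<le> ((4 * cA + cB + (1 + b) * (cK + cA)) * (2 + b * \<omega>)) * (\<Lambda>\<^sup>2 * e ^ (n + 7))" .
  define X where "X = \<Lambda>\<^sup>2 * e ^ (n + 7)"
  have lin: "15 * (x + y) + 10 * \<Lambda> * z \<le> (15 * (p + q) + 10 * r) * X"
    if "x \<le> p * X" "y \<le> q * X" "\<Lambda> * z \<le> r * X" for x y z p q r
    using that by (simp add: algebra_simps)
  note this = lin[OF 1[folded X_def] 2[folded X_def] 4[folded X_def]]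
  from mult_left_mono[OF this D] show ?thesis
    unfolding growth_rate_def X_def by (simp add: mult.assoc)
qed

section \<open>From the bound on the weight to the final constant\<close>

lemma finite_varifold_of_weight:
  fixes V :: "'n::finite vmeasure"
  assumes V: "varifold d V" and M: "emeasure (weight V) UNIV \<le> ennreal M" "0 \<le> M"
  shows "finite_varifold d V" "mass V \<le> M"
proof -
  have sets: "sets V = sets (varifold_space d)" using V by (simp add: varifold_def)
  have "fst \<in> borel_measurable V"
    by (rule measurable_varifold_continuous[OF sets]) (intro continuous_intros)
  then have "emeasure (weight V) UNIV = emeasure V (space V)"
    unfolding weight_def by (simp add: emeasure_distr)
  then have le: "emeasure V (space V) \<le> ennreal M" using M by simp
  then have "emeasure V (space V) \<noteq> \<infinity>" by (auto simp: top_unique)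
  then show "finite_varifold d V" unfolding finite_varifold_def using sets by (auto intro: finite_measureI)
  show "mass V \<le> M" unfolding mass_def measure_def using le M(2) by (rule enn2real_leI[rotated])
qed

theorem proposition4p3:
  fixes \<psi> :: "real^'n \<Rightarrow> real"
  assumes "CARD('n) \<ge> 2" and "cutoff \<psi>"
  shows "\<exists>c\<^sub>5>0. \<forall>c\<^sub>3>0. \<forall>(d::nat) (\<epsilon>::real) (M::real)
      (V\<^sub>0 :: ((real^'n) \<times> (real^'n^'n)) measure) (W\<^sub>0 :: ((real^'n) \<times> (real^'n^'n)) measure)
      (V :: real \<Rightarrow> ((real^'n) \<times> (real^'n^'n)) measure)
      (W :: real \<Rightarrow> ((real^'n) \<times> (real^'n^'n)) measure).
    1 \<le> d \<and> d \<le> CARD('n) \<and> 0 < \<epsilon> \<and> \<epsilon> < 1 \<and> M \<ge> 1 \<and>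
    varifold d V\<^sub>0 \<and> compactly_supported V\<^sub>0 \<and> emeasure (weight V\<^sub>0) UNIV \<le> ennreal M \<and>
    varifold d W\<^sub>0 \<and> compactly_supported W\<^sub>0 \<and> emeasure (weight W\<^sub>0) UNIV \<le> ennreal M \<and>
    approx_mcf \<psi> c\<^sub>3 d \<epsilon> M V\<^sub>0 V \<and> approx_mcf \<psi> c\<^sub>3 d \<epsilon> M W\<^sub>0 W \<longrightarrow>
    (\<forall>t\<in>{0..1}. varifold_bl_dist d (V t) (W t) \<le>
       varifold_bl_dist d V\<^sub>0 W\<^sub>0 *
         exp (c\<^sub>5 * (M + 1)\<^sup>2 * t * \<epsilon> powr (- real CARD('n) - 7)))"
proof -
  interpret cutoff_function \<psi> by unfold_locales fact
  obtain L where L: "0 \<le> L" "\<And>x y. norm (gradient \<psi> x - gradient \<psi> y) \<le> L * norm (x - y)"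
    using grad_\<psi>_lip by blast
  define n where "n = CARD('n)"
  define cK where "cK = sup_const"
  define b where "b = tail_const"
  define cA where "cA = cK + b"
  define cB where "cB = cK * (L + 8)"
  define w where "w = unit_vol TYPE('n)"
  define D where "D = det_const CARD('n)"
  have pos: "0 < cK" "0 < b" "0 < cA" "0 < cB" "0 < w" "1 \<le> D"
    using sup_const_pos tail_const_pos L(1) unit_vol_pos[where 'n='n] det_const_ge(2)[OF card_pos_UNIV[where 'n='n]]
    by (auto simp: cK_def b_def cA_def cB_def w_def D_def)
  \<comment> \<open>The coefficient of \<open>growth_rate_le\<close>. Its ingredients involve the
    dimension and \<open>\<psi>\<close> only, so it is fixed before \<open>c\<^sub>3\<close>,
    \<open>d\<close>, \<open>\<epsilon>\<close>, \<open>M\<close> and the varifolds.\<close>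
  define c5 where "c5 = D * (15 * ((1 + b) * (1 + b * w) + 2 * (1 + b) * cB * w)
     + 10 * ((4 * cA + cB + (1 + b) * (cK + cA)) * (2 + b * w)))"
  have "0 < c5"
    unfolding c5_def using pos by (intro mult_pos_pos add_pos_pos) auto
  moreover have "varifold_bl_dist d (V t) (W t) \<le> varifold_bl_dist d V\<^sub>0 W\<^sub>0 *
         exp (c5 * (M + 1)\<^sup>2 * t * \<epsilon> powr (- real CARD('n) - 7))"
    if c3: "0 < c\<^sub>3" and eps: "0 < \<epsilon>" "\<epsilon> < 1" and M: "1 \<le> M"
      and V0: "varifold d V\<^sub>0" "emeasure (weight V\<^sub>0) UNIV \<le> ennreal M"
      and W0: "varifold d W\<^sub>0" "emeasure (weight W\<^sub>0) UNIV \<le> ennreal M"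
      and V: "approx_mcf \<psi> c\<^sub>3 d \<epsilon> M V\<^sub>0 V" and W: "approx_mcf \<psi> c\<^sub>3 d \<epsilon> M W\<^sub>0 W"
      and t: "t \<in> {0..1}"
    for c\<^sub>3 d \<epsilon> M V\<^sub>0 W\<^sub>0 V W t
  proof -
    define e where "e = 1 / \<epsilon>"
    have e: "1 \<le> e" "\<epsilon> = 1 / e" using eps by (auto simp: e_def)
    interpret mollifier \<psi> \<epsilon> "e\<^sup>2" b "cK * e ^ n" "cA * e ^ (n + 2)" "cB * e ^ (n + 3)" w D
        "kernel \<psi> \<epsilon>" "gradient (kernel \<psi> \<epsilon>)"
      unfolding cA_def cB_def cK_def b_def w_def D_def
      \<comment> \<open>The goals left for \<open>reflexive\<close> are the defining equations of
        the locale parameters \<open>k\<close> and \<open>g\<close>.\<close>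
      by (rule mollifier_kernel[OF eps e_def n_def L(2,1)], (rule reflexive)+)
    have M0: "0 \<le> M" using M by simp
    note fV = finite_varifold_of_weight[OF V0 M0] and fW = finite_varifold_of_weight[OF W0 M0]
    have \<Delta>: "0 \<le> varifold_bl_dist d V\<^sub>0 W\<^sub>0" by (rule varifold_bl_dist_nonneg[OF fV(1) fW(1)])
    have "growth_rate (M + 1) \<le> c5 * (M + 1)\<^sup>2 * e ^ (n + 7)"
      unfolding c5_def
      by (rule growth_rate_le[OF e _ refl refl refl refl]) (use M pos in auto)
    then have "growth_rate (M + 1) * t \<le> c5 * (M + 1)\<^sup>2 * e ^ (n + 7) * t"
      using t by (intro mult_right_mono) auto
    also have "e ^ (n + 7) = \<epsilon> powr (- real CARD('n) - 7)"
    proof -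
      have "\<epsilon> powr (- real CARD('n) - 7) = \<epsilon> powr (- real (n + 7))" by (simp add: n_def)
      also have "\<dots> = inverse (\<epsilon> ^ (n + 7))" using eps by (simp only: powr_minus powr_realpow)
      finally show ?thesis by (simp add: e_def power_divide divide_inverse power_inverse)
    qed
    finally have "exp (growth_rate (M + 1) * t) \<le> exp (c5 * (M + 1)\<^sup>2 * t * \<epsilon> powr (- real CARD('n) - 7))"
      by (simp add: mult_ac)
    from mult_right_mono[OF this \<Delta>]
    show ?thesis
      using approx_mcf_bl_dist[OF M0 c3 fV fW V W t] by (simp add: mult.commute)
  qed
  ultimately show ?thesis by (intro exI[of _ c5] conjI) blast+
qed

end
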